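(* Let $A\in\mathbb{R}^{K\times d}$, $y=Au+\xi$, and suppose that $u$ is $(0,\frac1{\lambda_\ast}C_0)$-sub-Gaussian and $\xi$ is $(0,\Gamma)$-sub-Gaussian, where $C_0\in\mathbb{R}^{d\times d}$ and $\Gamma\in\mathbb{R}^{K\times K}$ are known symmetric positive definite matrices and $\lambda_\ast>0$ is unknown. Let $\lambda_l,\lambda_u$ satisfy $0<\lambda_l<\frac12\lambda_\ast<\frac32\lambda_\ast<\lambda_u$. Let $(u_i,y_i)_{i=1}^n$ be i.i.d. samples of $(u,y)$, let $$u_\lambda(y)=(A^\top\Gamma^{-1}A+\lambda C_0^{-1})^{-1}A^\top\Gamma^{-1}y,\qquad \widehat F_n(\lambda)=\frac1n\sum_{i=1}^n\|u_\lambda(y_i)-u_i\|^2,\qquad F(\lambda)=\mathbb{E}\,\|u_\lambda(y)-u\|^2,$$ and let $\hat\lambda_n\in(\lambda_l,\lambda_u)$ be a local minimum of $\widehat F_n$. Then $\partial_\lambda F(\lambda_\ast)=0$, and there exist $C_\ast,c_\ast>0$ such that for any $1>\epsilon>0$ and any $n$, $$\mathbb{P}\big(|\hat\lambda_n-\lambda_\ast|>\epsilon,\ \lambda_l<\hat\lambda_n<\lambda_u\big)\le C_\ast\exp\big(-c_\ast n\min(\epsilon,\epsilon^2)\big).$$ The values of $C_\ast,c_\ast>0$ depend on $\lambda_l,\lambda_u,\lambda_\ast,C_0$ but not on $n$. Moreover, if it is assumed that $\mathrm{tr}(C_0)$, $\|C_0\|_F$, $\|A^\top\Gamma^{-1}A\|$,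 $\|A\|$, $\|\Gamma\|$ are constants independent of the dimension $d$, then $C_\ast,c_\ast>0$ are also dimension independent.
   Context: Sub-Gaussian convention: a random vector $z\in\mathbb{R}^\ell$ is called $(0,\Sigma)$-sub-Gaussian if $z\overset{d}{=}\Sigma^{1/2}\sigma$ for some $\sigma=(\sigma_1,\dots,\sigma_\ell)^\top$ whose components are i.i.d. random variables with $\mathbb{E}\sigma_1=0$, $\mathbb{E}|\sigma_1|^2=1$, $\sup_{p\ge1}p^{-1/2}\,\mathbb{E}[|\sigma_1|^p]^{1/p}\le C_\sigma$ for some $C_\sigma>0$, and which are symmetric, $\sigma_1\overset{d}{=}-\sigma_1$. The vector $u_\lambda(y)$ is the minimizer over $v\in\mathbb{R}^d$ of $\frac12(Av-y)^\top\Gamma^{-1}(Av-y)+\frac\lambda2 v^\top C_0^{-1}v$ (Tikhonov regularization with parameter $\lambda$). Here $\|\cdot\|$ is the Euclidean norm on vectors and the operator norm on matrices, and $\|\cdot\|_F$ is the Frobenius norm. A constant is called dimension independent if it depends only on $\mathrm{tr}(C_0)$, $\|C_0\|_F$, $\|A^\top\Gamma^{-1}A\|$, $\|A\|$, $\|\Gamma\|$.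
   Formalization: The bound fails for A=0 and degenerates as A→0 or C_0^{1/2}A^TΓ^{-1}A C_0^{1/2}→0; so A≠0 is required, C_*,c_* may also depend on ‖A^TΓ^{-1}A‖, and in the dimension-free claim on a lower bound q>0 for tr(C_0A^TΓ^{-1}AC_0). *)

theory Defs
  imports "HOL-Probability.Probability" "Jordan_Normal_Form.Gauss_Jordan_Elimination"
begin

(* Dimensions are explicit natural numbers (Jordan_Normal_Form matrices), because the constants
   of the theorem are chosen before the dimensions.  The types, constants and notation of the same
   name for vectors with a type as index set are hidden. *)

hide_type (open) Finite_Cartesian_Product.vec
hide_const (open) Finite_Cartesian_Product.vec Finite_Cartesian_Product.row
  Finite_Cartesian_Product.column Finite_Cartesian_Product.transpose
  Finite_Cartesian_Product.mat Finite_Cartesian_Product.vec_nth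
unbundle no vec_syntax
unbundle no inner_syntax


section \<open>Vectors and matrices\<close>

definition vec_norm :: "real vec \<Rightarrow> real" where
  "vec_norm v = sqrt (v \<bullet> v)"

definition op_norm :: "real mat \<Rightarrow> real" where
  "op_norm B = Sup {vec_norm (B *\<^sub>v v) | v. v \<in> carrier_vec (dim_col B) \<and> vec_norm v \<le> 1}"

definition frobenius_norm :: "real mat \<Rightarrow> real" where
  "frobenius_norm B = sqrt (\<Sum>i<dim_row B. \<Sum>j<dim_col B. (B $$ (i, j))\<^sup>2)"

definition mat_trace :: "real mat \<Rightarrow> real" where
  "mat_trace B = (\<Sum>i<dim_row B. B $$ (i, i))"

definition sym_pos_def :: "nat \<Rightarrow> real mat \<Rightarrow> bool" where
  "sym_pos_def n B \<longleftrightarrow> B \<in> carrier_mat n n \<and> transpose_mat B = B \<and>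
     (\<forall>v\<in>carrier_vec n. v \<noteq> 0\<^sub>v n \<longrightarrow> v \<bullet> (B *\<^sub>v v) > 0)"

definition sym_pos_semidef :: "nat \<Rightarrow> real mat \<Rightarrow> bool" where
  "sym_pos_semidef n B \<longleftrightarrow> B \<in> carrier_mat n n \<and> transpose_mat B = B \<and>
     (\<forall>v\<in>carrier_vec n. v \<bullet> (B *\<^sub>v v) \<ge> 0)"

(* Used for invertible matrices only. *)
definition mat_inv :: "real mat \<Rightarrow> real mat" where
  "mat_inv B = the (mat_inverse B)"


section \<open>Sub-Gaussian random vectors\<close>

(* The Borel sigma-algebra of R^n, carried by the n-dimensional vectors. *)
definition borel_vec :: "nat \<Rightarrow> real vec measure" where
  "borel_vec n = vimage_algebra (carrier_vec n) (\<lambda>v. \<lambda>i\<in>{..<n}. v $ i) (PiM {..<n} (\<lambda>_. borel))"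

(* The law of the components sigma_i; Csig bounds the supremum over all real p \<ge> 1. *)
definition sub_gaussian_law :: "real \<Rightarrow> real measure \<Rightarrow> bool" where
  "sub_gaussian_law Csig \<mu> \<longleftrightarrow>
     prob_space \<mu> \<and> sets \<mu> = sets borel \<and>
     (\<integral>x. x \<partial>\<mu>) = 0 \<and> (\<integral>x. \<bar>x\<bar>\<^sup>2 \<partial>\<mu>) = 1 \<and>
     (\<forall>p\<ge>1. integrable \<mu> (\<lambda>x. \<bar>x\<bar> powr p) \<and>
        p powr (- 1 / 2) * (\<integral>x. \<bar>x\<bar> powr p \<partial>\<mu>) powr (1 / p) \<le> Csig) \<and>
     distr \<mu> borel uminus = \<mu>"

(* z has the law of S sigma, where S is the symmetric positive semidefinite square root of Sig and
   sigma has i.i.d. components, i.e. its law is a power of a one-dimensional law. *)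
definition sub_gaussian_vec ::
    "real \<Rightarrow> 'w measure \<Rightarrow> nat \<Rightarrow> real mat \<Rightarrow> ('w \<Rightarrow> real vec) \<Rightarrow> bool" where
  "sub_gaussian_vec Csig M l Sig z \<longleftrightarrow>
     z \<in> measurable M (borel_vec l) \<and>
     (\<exists>S \<mu>. sym_pos_semidef l S \<and> S * S = Sig \<and> sub_gaussian_law Csig \<mu> \<and>
        distr M (borel_vec l) z =
        distr (PiM {..<l} (\<lambda>_. \<mu>)) (borel_vec l) (\<lambda>s. S *\<^sub>v vec l s))"


section \<open>The inverse problem\<close>

definition observation ::
    "real mat \<Rightarrow> ('w \<Rightarrow> real vec) \<Rightarrow> ('w \<Rightarrow> real vec) \<Rightarrow> 'w \<Rightarrow> real vec" where
  "observation A u \<xi> \<omega> = A *\<^sub>v u \<omega> + \<xi> \<omega>"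

(* Signal and noise are independent of each other. *)
definition linear_model ::
    "real \<Rightarrow> 'w measure \<Rightarrow> nat \<Rightarrow> nat \<Rightarrow> real mat \<Rightarrow> real mat \<Rightarrow> real
      \<Rightarrow> ('w \<Rightarrow> real vec) \<Rightarrow> ('w \<Rightarrow> real vec) \<Rightarrow> bool" where
  "linear_model Csig M d K \<Gamma> C0 lam_star u \<xi> \<longleftrightarrow>
     prob_space M \<and>
     sub_gaussian_vec Csig M d ((1 / lam_star) \<cdot>\<^sub>m C0) u \<and>
     sub_gaussian_vec Csig M K \<Gamma> \<xi> \<and>
     prob_space.indep_var M (borel_vec d) u (borel_vec K) \<xi>"

definition data_hessian :: "real mat \<Rightarrow> real mat \<Rightarrow> real mat" where
  "data_hessian A \<Gamma> = transpose_mat A * mat_inv \<Gamma> * A"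

definition tikhonov :: "real mat \<Rightarrow> real mat \<Rightarrow> real mat \<Rightarrow> real \<Rightarrow> real vec \<Rightarrow> real vec" where
  "tikhonov A \<Gamma> C0 lam y =
     mat_inv (data_hessian A \<Gamma> + lam \<cdot>\<^sub>m mat_inv C0) *\<^sub>v ((transpose_mat A * mat_inv \<Gamma>) *\<^sub>v y)"

definition risk ::
    "'w measure \<Rightarrow> real mat \<Rightarrow> real mat \<Rightarrow> real mat
      \<Rightarrow> ('w \<Rightarrow> real vec) \<Rightarrow> ('w \<Rightarrow> real vec) \<Rightarrow> real \<Rightarrow> real" where
  "risk M A \<Gamma> C0 u y lam = (\<integral>\<omega>. (vec_norm (tikhonov A \<Gamma> C0 lam (y \<omega>) - u \<omega>))\<^sup>2 \<partial>M)"

definition empirical_risk ::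
    "real mat \<Rightarrow> real mat \<Rightarrow> real mat \<Rightarrow> nat
      \<Rightarrow> (nat \<Rightarrow> 'w \<Rightarrow> real vec) \<Rightarrow> (nat \<Rightarrow> 'w \<Rightarrow> real vec) \<Rightarrow> 'w \<Rightarrow> real \<Rightarrow> real" where
  "empirical_risk A \<Gamma> C0 n us ys \<omega> lam =
     1 / real n * (\<Sum>i=1..n. (vec_norm (tikhonov A \<Gamma> C0 lam (ys i \<omega>) - us i \<omega>))\<^sup>2)"

definition iid_samples ::
    "'w measure \<Rightarrow> nat \<Rightarrow> nat \<Rightarrow> nat \<Rightarrow> ('w \<Rightarrow> real vec) \<Rightarrow> ('w \<Rightarrow> real vec)
      \<Rightarrow> (nat \<Rightarrow> 'w \<Rightarrow> real vec) \<Rightarrow> (nat \<Rightarrow> 'w \<Rightarrow> real vec) \<Rightarrow> bool" where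
  "iid_samples M d K n u y us ys \<longleftrightarrow>
     prob_space.indep_vars M (\<lambda>_. borel_vec d \<Otimes>\<^sub>M borel_vec K) (\<lambda>i \<omega>. (us i \<omega>, ys i \<omega>)) {1..n} \<and>
     (\<forall>i\<in>{1..n}. distr M (borel_vec d \<Otimes>\<^sub>M borel_vec K) (\<lambda>\<omega>. (us i \<omega>, ys i \<omega>)) =
                 distr M (borel_vec d \<Otimes>\<^sub>M borel_vec K) (\<lambda>\<omega>. (u \<omega>, y \<omega>)))"

definition local_minimum_at :: "(real \<Rightarrow> real) \<Rightarrow> real \<Rightarrow> bool" where
  "local_minimum_at f x \<longleftrightarrow> (\<forall>\<^sub>F t in nhds x. f x \<le> f t)"

(* The empirical risk need not have a local minimum inside (lam_l, lam_u); outside this interval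
   the value of the estimator is arbitrary. *)
definition local_min_estimator ::
    "'w measure \<Rightarrow> real mat \<Rightarrow> real mat \<Rightarrow> real mat \<Rightarrow> real \<Rightarrow> real \<Rightarrow> nat
      \<Rightarrow> (nat \<Rightarrow> 'w \<Rightarrow> real vec) \<Rightarrow> (nat \<Rightarrow> 'w \<Rightarrow> real vec) \<Rightarrow> ('w \<Rightarrow> real) \<Rightarrow> bool" where
  "local_min_estimator M A \<Gamma> C0 lam_l lam_u n us ys lhat \<longleftrightarrow>
     lhat \<in> borel_measurable M \<and>
     (AE \<omega> in M. lhat \<omega> \<in> {lam_l<..<lam_u} \<longrightarrow>
        local_minimum_at (empirical_risk A \<Gamma> C0 n us ys \<omega>) (lhat \<omega>))"

end

theory Submission
  imports Defs "Jordan_Normal_Form.Spectral_Radius"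
begin

text \<open>
  A matrix \<open>V\<close> with \<open>V V\<^sup>T = C0\<close> and \<open>V\<^sup>T H V = diag nu\<close>, where \<open>H\<close> is the data Hessian, turns the
  regularized solution into \<open>V diag (1 / (nu + lam)) g\<close>, where \<open>g = nu w + z\<close> for uncorrelated coordinates
  \<open>w\<close> of the signal (variance \<open>1 / lam_star\<close>) and \<open>z\<close> of the noise (variance \<open>nu\<close>). Hence the derivative of
  the risk is \<open>2 (lam / lam_star - 1)\<close> times the sum of \<open>(V\<^sup>T V)\<^sub>k\<^sub>k nu\<^sub>k / (nu\<^sub>k + lam)\<^sup>3\<close>, which vanishes at
  \<open>lam_star\<close> and is at least a multiple of \<open>\<bar>lam - lam_star\<bar>\<close>, because the sum of \<open>(V\<^sup>T V)\<^sub>k\<^sub>k nu\<^sub>k\<close> is the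
  trace of \<open>C0 H C0\<close>.

  At an interior local minimum the empirical derivative vanishes, so there it deviates from its mean by
  at least a multiple of \<open>\<epsilon>\<close>. To control the deviation for all \<open>lam\<close> at once without covering the
  interval, both resolvents are expanded into power series in \<open>lam_u - lam\<close>. The coefficients are bilinear
  forms in the data with sub-exponential norms bounded by a multiple of the trace of \<open>C0\<close>. Bernstein's
  inequality with thresholds growing like \<open>(i + 1) (j + 1)\<close> and a union bound over the coefficients give a
  convergent sum, hence a prefactor independent of \<open>n\<close> and \<open>\<epsilon>\<close>.
\<close>

section \<open>Spectral theorem for real symmetric matrices\<close>

text \<open>The estimator is random and may sit anywhere in the interval, so the empirical gradient
  has to be controlled for all parameters at once, with constants blind to the dimensions and to the
  eigenvalues \<open>nu\<close>. Expanding at the right end \<open>lam_u\<close> achieves this: with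
  \<open>s = lam_u / (nu + lam_u)\<close> and \<open>t = (lam_u - lam) / lam_u\<close> the resolvent
  \<open>lam_u / (nu + lam)\<close> is \<open>s / (1 - t * s)\<close>, where
  \<open>0 \<le> s \<le> 1\<close> and \<open>0 \<le> t \<le> 1 - lam_l / lam_u\<close>, so the rate
  of convergence does not involve \<open>nu\<close>. Neither do the variances of the coefficients,
  because \<open>s * nu / lam_u = 1 - s\<close>: the noise variance \<open>nu\<close> always comes
  with enough factors \<open>s\<close>. The forward operator matters for the lower bound on the
  population gradient: the Hessian norm limits the denominators, and a positive lower bound
  \<open>q\<close> for the trace of \<open>C0 H C0\<close> prevents degeneration. As the gradient
  vanishes linearly at \<open>lam_star\<close>, the two regimes of Bernstein's inequality turn into
  \<open>\<epsilon>\<^sup>2\<close> and \<open>\<epsilon>\<close>.\<close>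

lemma vec_norm_sq: "(vec_norm v)\<^sup>2 = v \<bullet> v" 
  unfolding vec_norm_def by (simp add: scalar_prod_def sum_nonneg)

lemma scalar_prod_self_nonneg: "(v :: real vec) \<bullet> v \<ge> 0"
  by (simp add: scalar_prod_def sum_nonneg)

lemma scalar_prod_self_eq_0:
  assumes "v \<in> carrier_vec n"
  shows "(v :: real vec) \<bullet> v = 0 \<longleftrightarrow> v = 0\<^sub>v n"
  using assms by (auto simp: scalar_prod_def sum_nonneg_eq_0_iff)

lemma scalar_prod_mult_mat_vec:
  fixes A :: "'a :: comm_semiring_0 mat"
  assumes "A \<in> carrier_mat m n" "x \<in> carrier_vec n" "y \<in> carrier_vec m"
  shows "(A *\<^sub>v x) \<bullet> y = x \<bullet> (transpose_mat A *\<^sub>v y)"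
proof -
  have "(A *\<^sub>v x) \<bullet> y = y \<bullet> (A *\<^sub>v x)" using assms by (intro comm_scalar_prod) auto
  also have "\<dots> = (transpose_mat A *\<^sub>v y) \<bullet> x" using transpose_vec_mult_scalar[OF assms] by simp
  also have "\<dots> = x \<bullet> (transpose_mat A *\<^sub>v y)" using assms by (intro comm_scalar_prod) auto
  finally show ?thesis .
qed

lemma smult_mult_mat_vec:
  fixes A :: "real mat"
  assumes "A \<in> carrier_mat m n" "v \<in> carrier_vec n"
  shows "(c \<cdot>\<^sub>m A) *\<^sub>v v = c \<cdot>\<^sub>v (A *\<^sub>v v)"
  using assms by (intro eq_vecI) (auto simp: scalar_prod_def sum_distrib_left mult.assoc)

text \<open>Over the complex numbers an eigenvector \<open>z\<close> exists. By symmetry the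
  Hermitian form of \<open>A\<close> at \<open>z\<close> is its own conjugate, so the eigenvalue is
  real; then the real and the imaginary part of \<open>z\<close> satisfy the same equation, and one
  of them is nonzero.\<close>

lemma symmetric_has_unit_eigenvector:
  fixes A :: "real mat"
  assumes A: "A \<in> carrier_mat n n" and sym: "transpose_mat A = A" and n: "n > 0"
  shows "\<exists>v e. v \<in> carrier_vec n \<and> v \<bullet> v = 1 \<and> A *\<^sub>v v = e \<cdot>\<^sub>v v"
proof -
  define B :: "complex mat" where "B = map_mat of_real A"
  have B: "B \<in> carrier_mat n n" using A by (simp add: B_def)
  from spectrum_non_empty[OF B n] obtain c where "eigenvalue B c" by (auto simp: spectrum_def)
  then obtain z where z: "z \<in> carrier_vec n" "z \<noteq> 0\<^sub>v n" "B *\<^sub>v z = c \<cdot>\<^sub>v z"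
    using B unfolding eigenvalue_def eigenvector_def by auto
  have Asym: "A $$ (i,j) = A $$ (j,i)" if "i < n" "j < n" for i j
    using sym A that by (metis carrier_matD index_transpose_mat(1))
  have ev: "(\<Sum>j<n. of_real (A $$ (i,j)) * z $ j) = c * z $ i" if "i < n" for i
  proof -
    have "(B *\<^sub>v z) $ i = (c \<cdot>\<^sub>v z) $ i" using z(3) by simp
    thus ?thesis using that B z(1) A by (simp add: scalar_prod_def B_def atLeast0LessThan)
  qed
  have "Im c * (\<Sum>i<n. (cmod (z $ i))\<^sup>2) = 0"
  proof -
    define q where "q = (\<Sum>i<n. cnj (z $ i) * (\<Sum>j<n. of_real (A $$ (i,j)) * z $ j))"
    have "q = (\<Sum>i<n. cnj (z $ i) * (c * z $ i))"
      unfolding q_def by (intro sum.cong refl) (simp add: ev)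
    hence q1: "q = c * of_real (\<Sum>i<n. (cmod (z $ i))\<^sup>2)"
      by (simp add: sum_distrib_left complex_norm_square mult_ac flip: of_real_power)
    have "cnj q = (\<Sum>i<n. \<Sum>j<n. z $ i * (of_real (A $$ (i,j)) * cnj (z $ j)))"
      by (simp add: q_def sum_distrib_left)
    also have "\<dots> = (\<Sum>j<n. \<Sum>i<n. z $ i * (of_real (A $$ (i,j)) * cnj (z $ j)))" by (rule sum.swap)
    also have "\<dots> = q" unfolding q_def sum_distrib_left
      by (intro sum.cong refl) (simp add: Asym mult_ac)
    finally have "cnj q = q" .
    hence "Im q = 0" by (metis complex_cnj_zero_iff cnj.simps(2) add.inverse_neutral neg_equal_zero)
    thus ?thesis using q1 by simp
  qed
  moreover have "(\<Sum>i<n. (cmod (z $ i))\<^sup>2) \<noteq> 0"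
  proof
    assume "(\<Sum>i<n. (cmod (z $ i))\<^sup>2) = 0"
    hence "\<forall>i<n. z $ i = 0" by (subst (asm) sum_nonneg_eq_0_iff) auto
    thus False using z(1,2) by (auto intro!: eq_vecI)
  qed
  ultimately have c: "Im c = 0" by simp
  obtain p where p: "p \<in> carrier_vec n" "p \<noteq> 0\<^sub>v n" "A *\<^sub>v p = Re c \<cdot>\<^sub>v p"
  proof -
    have re: "A *\<^sub>v map_vec Re z = Re c \<cdot>\<^sub>v map_vec Re z"
      using A z(1) c by (intro eq_vecI) (auto simp: scalar_prod_def atLeast0LessThan dest!: arg_cong[OF ev, of _ Re])
    have im: "A *\<^sub>v map_vec Im z = Re c \<cdot>\<^sub>v map_vec Im z"
      using A z(1) c by (intro eq_vecI) (auto simp: scalar_prod_def atLeast0LessThan dest!: arg_cong[OF ev, of _ Im])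
    have "map_vec Re z \<noteq> 0\<^sub>v n \<or> map_vec Im z \<noteq> 0\<^sub>v n"
    proof (rule ccontr)
      assume "\<not> ?thesis"
      hence a: "map_vec Re z = 0\<^sub>v n" "map_vec Im z = 0\<^sub>v n" by auto
      have "z $ i = 0" if "i < n" for i
        using arg_cong[OF a(1), of "\<lambda>v. v $ i"] arg_cong[OF a(2), of "\<lambda>v. v $ i"] that z(1)
        by (simp add: complex_eq_iff)
      thus False using z(1,2) by (auto intro!: eq_vecI)
    qed
    thus ?thesis using that re im z(1) by (metis map_carrier_vec)
  qed
  define r where "r = 1 / vec_norm p"
  have pp: "p \<bullet> p > 0" using scalar_prod_self_eq_0[OF p(1)] p(2) scalar_prod_self_nonneg[of p] by linarith
  have "r * (r * (p \<bullet> p)) = 1"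
    using vec_norm_sq[of p] pp unfolding r_def by (simp add: field_simps power2_eq_square)
  hence "(r \<cdot>\<^sub>v p) \<bullet> (r \<cdot>\<^sub>v p) = 1" using p(1) by (simp add: mult.assoc)
  moreover have "A *\<^sub>v (r \<cdot>\<^sub>v p) = Re c \<cdot>\<^sub>v (r \<cdot>\<^sub>v p)"
    using A p by (simp add: mult_mat_vec smult_smult_assoc mult.commute)
  ultimately show ?thesis using p(1) by (intro exI[of _ "r \<cdot>\<^sub>v p"] exI[of _ "Re c"]) simp
qed

text \<open>The Householder reflection exchanging the first unit vector and \<open>v\<close>.\<close>
lemma orthogonal_symmetric_with_first_column:
  fixes v :: "real vec"
  assumes v: "v \<in> carrier_vec n" "v \<bullet> v = 1" and n: "n > 0"
  shows "\<exists>Q. Q \<in> carrier_mat n n \<and> transpose_mat Q = Q \<and> Q * Q = 1\<^sub>m n \<and> col Q 0 = v"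
proof (cases "v = unit_vec n 0")
  case True
  thus ?thesis using n by (intro exI[of _ "1\<^sub>m n"]) auto
next
  case False
  define p where "p i = v $ i - (if i = 0 then 1 else 0)" for i
  define s where "s = (\<Sum>i<n. (p i)\<^sup>2)"
  have s0: "s \<noteq> 0"
  proof
    assume "s = 0"
    hence "\<forall>i<n. p i = 0" unfolding s_def by (subst (asm) sum_nonneg_eq_0_iff) auto
    hence "v = unit_vec n 0" using v(1) by (intro eq_vecI) (auto simp: p_def unit_vec_def)
    thus False using False by simp
  qed
  have vv: "(\<Sum>i<n. (v $ i)\<^sup>2) = 1" using v by (simp add: scalar_prod_def power2_eq_square atLeast0LessThan)
  have s: "s = - 2 * p 0"
  proof -
    have "s = (\<Sum>i<n. (v $ i)\<^sup>2 + (if i = 0 then 1 - 2 * v $ i else 0))"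
      unfolding s_def p_def by (intro sum.cong refl) (auto simp: power2_eq_square algebra_simps)
    thus ?thesis using vv n by (simp add: sum.distrib p_def)
  qed
  define Q where "Q = mat n n (\<lambda>(i,j). (if i = j then 1 else 0) - 2 / s * p i * p j)"
  have "(\<Sum>k<n. Q $$ (i,k) * Q $$ (k,j)) = (if i = j then 1 else 0)" if "i < n" "j < n" for i j
  proof -
    have "(\<Sum>k<n. Q $$ (i,k) * Q $$ (k,j)) =
      (\<Sum>k<n. (if k = i then (if i = j then 1 else 0) else 0) - (if k = i then 2 / s * p i * p j else 0)
         - (if k = j then 2 / s * p i * p j else 0) + (4 / s^2 * p i * p j) * (p k)\<^sup>2)"
      unfolding Q_def using that
      by (intro sum.cong refl) (auto simp: algebra_simps power2_eq_square)
    also have "\<dots> = (if i = j then 1 else 0) - 2 / s * p i * p j - 2 / s * p i * p j + (4 / s^2 * p i * p j) * s"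
      using that unfolding sum.distrib sum_subtractf sum_distrib_left[symmetric] s_def[symmetric] by simp
    also have "\<dots> = (if i = j then 1 else 0)" using s0 by (simp add: field_simps power2_eq_square)
    finally show ?thesis .
  qed
  hence "Q * Q = 1\<^sub>m n" 
    by (intro eq_matI) (auto simp: Q_def scalar_prod_def atLeast0LessThan)
  moreover have "transpose_mat Q = Q" by (intro eq_matI) (auto simp: Q_def)
  moreover have "col Q 0 = v"
  proof (intro eq_vecI)
    fix i assume "i < dim_vec v"
    hence i: "i < n" using v(1) by simp
    have "2 / s * p i * p 0 = (2 * p 0 / s) * p i" by simp
    also have "2 * p 0 / s = -1" using s s0 by (simp add: field_simps)
    finally show "col Q 0 $ i = v $ i" using i n by (simp add: Q_def) (simp add: p_def)
  qed (use v in \<open>simp add: Q_def\<close>)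
  ultimately show ?thesis by (intro exI[of _ Q]) (simp add: Q_def)
qed

text \<open>Deflation: conjugation with a symmetric involution \<open>Q\<close> whose first column
  is an eigenvector clears the first column off the diagonal, and symmetry clears the row. If
  \<open>P\<close> diagonalizes the remaining block and \<open>R\<close> is its block extension,
  then \<open>Q * R\<close> is the orthogonal matrix sought.\<close>

lemma real_spectral_theorem:
  fixes A :: "real mat"
  assumes "A \<in> carrier_mat n n" and "transpose_mat A = A"
  shows "\<exists>P nu. P \<in> carrier_mat n n \<and> transpose_mat P * P = 1\<^sub>m n \<and>
     transpose_mat P * A * P = mat n n (\<lambda>(i,j). if i = j then nu i else 0)"
  using assms
proof (induction n arbitrary: A)
  case 0
  show ?case by (intro exI[of _ "1\<^sub>m 0"] conjI exI eq_matI) auto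
next
  case (Suc n)
  let ?N = "Suc n"
  note A = Suc.prems
  obtain v e where v: "v \<in> carrier_vec ?N" "v \<bullet> v = 1" "A *\<^sub>v v = e \<cdot>\<^sub>v v"
    using symmetric_has_unit_eigenvector[OF A] by auto
  obtain Q where Q: "Q \<in> carrier_mat ?N ?N" "transpose_mat Q = Q" "Q * Q = 1\<^sub>m ?N" "col Q 0 = v"
    using orthogonal_symmetric_with_first_column[OF v(1,2)] by auto
  define B where "B = Q * A * Q"
  have B: "B \<in> carrier_mat ?N ?N" using A Q by (simp add: B_def)
  have Bsym: "transpose_mat B = B"
    using A Q by (simp add: B_def transpose_mult[of _ ?N ?N _ ?N] assoc_mult_mat[of _ ?N ?N _ ?N _ ?N])
  have B0: "B $$ (i,0) = (if i = 0 then e else 0)" if "i < ?N" for i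
  proof -
    have "col B 0 = Q *\<^sub>v (A *\<^sub>v col Q 0)"
      using A Q unfolding B_def by (simp add: col_mult2[of _ ?N ?N _ ?N] assoc_mult_mat_vec[of _ ?N ?N _ ?N])
    also have "\<dots> = e \<cdot>\<^sub>v (Q *\<^sub>v col Q 0)" using Q v by (simp add: mult_mat_vec)
    also have "Q *\<^sub>v col Q 0 = col (Q * Q) 0" using Q by (subst col_mult2[of _ ?N ?N _ ?N]) auto
    also have "\<dots> = unit_vec ?N 0" using Q by simp
    finally have "col B 0 = e \<cdot>\<^sub>v unit_vec ?N 0" .
    hence "col B 0 $ i = (e \<cdot>\<^sub>v unit_vec ?N 0) $ i" by simp
    thus ?thesis using that B by (auto split: if_splits)
  qed
  define B' where "B' = mat n n (\<lambda>(i,j). B $$ (Suc i, Suc j))"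
  have B': "B' \<in> carrier_mat n n" by (simp add: B'_def)
  have Bs: "B $$ (i,j) = B $$ (j,i)" if "i < ?N" "j < ?N" for i j
    using Bsym B that by (metis carrier_matD index_transpose_mat(1))
  have Bblock: "B = four_block_mat (mat 1 1 (\<lambda>_. e)) (0\<^sub>m 1 n) (0\<^sub>m n 1) B'"
    using B B0 Bs by (intro eq_matI) (auto simp: B'_def four_block_mat_def)
  have "transpose_mat B' = B'" using Bs by (intro eq_matI) (auto simp: B'_def)
  from Suc.IH[OF B' this] obtain P nu where P: "P \<in> carrier_mat n n" "transpose_mat P * P = 1\<^sub>m n"
     "transpose_mat P * B' * P = mat n n (\<lambda>(i,j). if i = j then nu i else 0)" by auto
  define R where "R = four_block_mat (1\<^sub>m 1) (0\<^sub>m 1 n) (0\<^sub>m n 1) P"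
  have R: "R \<in> carrier_mat ?N ?N" using P four_block_carrier_mat[of "1\<^sub>m 1" 1 1 P n n] by (simp add: R_def)
  have Rt: "transpose_mat R = four_block_mat (1\<^sub>m 1) (0\<^sub>m 1 n) (0\<^sub>m n 1) (transpose_mat P)"
    using P by (simp add: R_def transpose_four_block_mat[of _ 1 1 _ n _ n])
  have RR: "transpose_mat R * R = 1\<^sub>m ?N"
    unfolding Rt unfolding R_def using P
    by (subst mult_four_block_mat[of _ 1 1 _ n _ n _ _ 1 _ n]) (auto intro!: eq_matI)
  have RBR: "transpose_mat R * B * R = four_block_mat (mat 1 1 (\<lambda>_. e)) (0\<^sub>m 1 n) (0\<^sub>m n 1) (transpose_mat P * B' * P)"
    unfolding Rt Bblock unfolding R_def using P B'
    by (subst mult_four_block_mat[of _ 1 1 _ n _ n _ _ 1 _ n], auto)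
       (subst mult_four_block_mat[of _ 1 1 _ n _ n _ _ 1 _ n], auto)
  have RQ: "transpose_mat (Q * R) = transpose_mat R * Q" using Q R by (simp add: transpose_mult[of _ ?N ?N _ ?N])
  have "transpose_mat (Q * R) * (Q * R) = transpose_mat R * (Q * Q) * R"
    unfolding RQ using Q(1) R by (simp add: assoc_mult_mat[of _ ?N ?N _ ?N _ ?N])
  also have "\<dots> = 1\<^sub>m ?N" using RR R Q(3) by simp
  finally have 1: "transpose_mat (Q * R) * (Q * R) = 1\<^sub>m ?N" .
  have "transpose_mat (Q * R) * A * (Q * R) = transpose_mat R * B * R"
    unfolding RQ B_def using Q(1) R A by (simp add: assoc_mult_mat[of _ ?N ?N _ ?N _ ?N])
  also have "\<dots> = mat ?N ?N (\<lambda>(i,j). if i = j then (case i of 0 \<Rightarrow> e | Suc k \<Rightarrow> nu k) else 0)"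
    unfolding RBR P(3) by (intro eq_matI) (auto simp: four_block_mat_def split: nat.splits)
  finally show ?case using 1 Q R
    by (intro exI[of _ "Q * R"] exI[of _ "\<lambda>i. case i of 0 \<Rightarrow> e | Suc k \<Rightarrow> nu k"]) auto
qed

section \<open>Diagonalization of the inverse problem\<close>

text \<open>Since \<open>mat_inv\<close> takes \<open>the\<close> of an option, the case
  \<open>None\<close> has to be excluded: a right inverse of a square matrix is two-sided, so
  \<open>A\<close> is a unit of the matrix ring.\<close>

lemma mat_inv_eqI:
  assumes "A \<in> carrier_mat n n" "B \<in> carrier_mat n n" "A * B = 1\<^sub>m n"
  shows "mat_inv A = B"
proof (cases "mat_inverse A")
  case None
  have "B * A = 1\<^sub>m n" using mat_mult_left_right_inverse[OF assms] .
  hence "A \<in> Units (ring_mat TYPE(real) n ())" using assms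
    unfolding Units_def by (auto simp: ring_mat_def)
  thus ?thesis using mat_inverse(1)[OF assms(1) None, of "()"] by simp
next
  case (Some C)
  hence C: "C * A = 1\<^sub>m n" "C \<in> carrier_mat n n" using mat_inverse(2)[OF assms(1)] by auto
  have "C = C * (A * B)" using assms C by simp
  also have "\<dots> = B" using assms C by (subst assoc_mult_mat[symmetric, of _ n n _ n _ n]) auto
  finally show ?thesis using Some by (simp add: mat_inv_def)
qed

lemma sym_pos_def_inverse:
  assumes "sym_pos_def n B"
  shows "mat_inv B \<in> carrier_mat n n" "B * mat_inv B = 1\<^sub>m n" "mat_inv B * B = 1\<^sub>m n"
    "transpose_mat (mat_inv B) = mat_inv B"
proof -
  have B: "B \<in> carrier_mat n n" "transpose_mat B = B" using assms by (auto simp: sym_pos_def_def)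
  have "det B \<noteq> 0"
  proof
    assume "det B = 0"
    then obtain v where v: "v \<in> carrier_vec n" "v \<noteq> 0\<^sub>v n" "B *\<^sub>v v = 0\<^sub>v n"
      using det_0_iff_vec_prod_zero_field[OF B(1)] by auto
    hence "v \<bullet> (B *\<^sub>v v) > 0" using assms by (auto simp: sym_pos_def_def)
    thus False using v by simp
  qed
  hence "B \<in> Units (ring_mat TYPE(real) n ())" by (rule det_non_zero_imp_unit[OF B(1)])
  then obtain C where C: "C \<in> carrier_mat n n" "B * C = 1\<^sub>m n" "C * B = 1\<^sub>m n"
    unfolding Units_def by (auto simp: ring_mat_def)
  hence eq: "mat_inv B = C" using mat_inv_eqI[OF B(1)] by auto
  show 1: "mat_inv B \<in> carrier_mat n n" "B * mat_inv B = 1\<^sub>m n" "mat_inv B * B = 1\<^sub>m n" using C eq by auto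
  have "B * transpose_mat C = transpose_mat (C * B)"
    by (subst transpose_mult[OF C(1) B(1)]) (simp add: B)
  also have "\<dots> = 1\<^sub>m n" using C by simp
  finally show "transpose_mat (mat_inv B) = mat_inv B" using mat_inv_eqI[OF B(1), of "transpose_mat C"] C eq by auto
qed

lemma sym_pos_def_inverse_pos:
  assumes "sym_pos_def n B" "v \<in> carrier_vec n" "v \<noteq> 0\<^sub>v n"
  shows "v \<bullet> (mat_inv B *\<^sub>v v) > 0"
proof -
  note I = sym_pos_def_inverse[OF assms(1)]
  have B: "B \<in> carrier_mat n n" using assms by (auto simp: sym_pos_def_def)
  define w where "w = mat_inv B *\<^sub>v v"
  have w: "w \<in> carrier_vec n" using I assms by (simp add: w_def)
  have v: "v = B *\<^sub>v w" unfolding w_def using I B assms(2)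
    by (subst assoc_mult_mat_vec[symmetric, of _ n n _ n]) auto
  have "w \<noteq> 0\<^sub>v n" using v assms(3) B by auto
  hence "w \<bullet> (B *\<^sub>v w) > 0" using assms w by (auto simp: sym_pos_def_def)
  also have "w \<bullet> (B *\<^sub>v w) = v \<bullet> w" using v w assms(2) by (metis comm_scalar_prod)
  finally show ?thesis by (simp add: w_def)
qed

section \<open>Euclidean, Frobenius and operator norms\<close>

lemma vec_norm_nonneg [simp]: "vec_norm v \<ge> 0"
  by (simp add: vec_norm_def scalar_prod_self_nonneg)

lemma vec_norm_smult: "vec_norm (c \<cdot>\<^sub>v v) = \<bar>c\<bar> * vec_norm v"
proof -
  have "(c \<cdot>\<^sub>v v) \<bullet> (c \<cdot>\<^sub>v v) = c\<^sup>2 * (v \<bullet> v)"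
    by (simp add: scalar_prod_def sum_distrib_left power2_eq_square mult_ac)
  thus ?thesis by (simp add: vec_norm_def real_sqrt_mult)
qed

lemma scalar_prod_squared_le: "(v \<bullet> w)\<^sup>2 \<le> (v \<bullet> v) * (w \<bullet> w)"
  if "dim_vec v = dim_vec w" for v w :: "real vec"
  using that Cauchy_Schwarz_ineq_sum[of "\<lambda>i. v $ i" "\<lambda>i. w $ i" "{0..<dim_vec w}"]
  by (simp add: scalar_prod_def power2_eq_square)

lemma abs_scalar_prod_le: "\<bar>v \<bullet> w\<bar> \<le> vec_norm v * vec_norm w"
  if "dim_vec v = dim_vec w"
  using real_sqrt_le_mono[OF scalar_prod_squared_le[OF that]] by (simp add: vec_norm_def real_sqrt_mult)

lemma vec_norm_mult_le_frobenius:
  assumes "v \<in> carrier_vec (dim_col B)"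
  shows "vec_norm (B *\<^sub>v v) \<le> frobenius_norm B * vec_norm v"
proof -
  have "(B *\<^sub>v v) \<bullet> (B *\<^sub>v v) = (\<Sum>i<dim_row B. (row B i \<bullet> v)\<^sup>2)"
    by (simp add: scalar_prod_def[of "B *\<^sub>v v"] power2_eq_square atLeast0LessThan)
  also have "\<dots> \<le> (\<Sum>i<dim_row B. (row B i \<bullet> row B i) * (v \<bullet> v))"
    using assms by (intro sum_mono scalar_prod_squared_le) auto
  also have "\<dots> = (\<Sum>i<dim_row B. \<Sum>j<dim_col B. (B $$ (i,j))\<^sup>2) * (v \<bullet> v)"
    by (simp add: scalar_prod_def[of "row B _"] sum_distrib_right power2_eq_square atLeast0LessThan)
  finally have "sqrt ((B *\<^sub>v v) \<bullet> (B *\<^sub>v v)) \<le> sqrt (\<dots>)" by (rule real_sqrt_le_mono)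
  thus ?thesis by (simp add: vec_norm_def frobenius_norm_def real_sqrt_mult)
qed

text \<open>The Frobenius bound shows that the set under the supremum is bounded above; only then is
  \<open>Sup\<close> known to be an upper bound. It also settles vectors of norm zero, which cannot
  be rescaled.\<close>

lemma vec_norm_mult_le_op_norm:
  assumes v: "v \<in> carrier_vec (dim_col B)"
  shows "vec_norm (B *\<^sub>v v) \<le> op_norm B * vec_norm v"
proof -
  let ?S = "{vec_norm (B *\<^sub>v v) | v. v \<in> carrier_vec (dim_col B) \<and> vec_norm v \<le> 1}"
  have fr: "frobenius_norm B \<ge> 0" by (simp add: frobenius_norm_def sum_nonneg)
  have "bdd_above ?S"
  proof (rule bdd_aboveI[of _ "frobenius_norm B"])
    fix x assume "x \<in> ?S"
    then obtain w where w: "x = vec_norm (B *\<^sub>v w)" "w \<in> carrier_vec (dim_col B)" "vec_norm w \<le> 1" by auto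
    thus "x \<le> frobenius_norm B"
      using vec_norm_mult_le_frobenius[OF w(2)] mult_left_mono[OF w(3) fr] by simp
  qed
  hence up: "vec_norm (B *\<^sub>v w) \<le> op_norm B" if "w \<in> carrier_vec (dim_col B)" "vec_norm w \<le> 1" for w
    unfolding op_norm_def using that by (intro cSup_upper) auto
  show ?thesis
  proof (cases "vec_norm v = 0")
    case True
    thus ?thesis using vec_norm_mult_le_frobenius[OF v] by simp
  next
    case False
    hence p: "vec_norm v > 0" using vec_norm_nonneg[of v] by linarith
    have "vec_norm (B *\<^sub>v (inverse (vec_norm v) \<cdot>\<^sub>v v)) \<le> op_norm B"
      using v p by (intro up) (auto simp: vec_norm_smult)
    also have "B *\<^sub>v (inverse (vec_norm v) \<cdot>\<^sub>v v) = inverse (vec_norm v) \<cdot>\<^sub>v (B *\<^sub>v v)"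
      using v by (intro mult_mat_vec[of _ "dim_row B" "dim_col B"]) auto
    finally show ?thesis using p by (simp add: vec_norm_smult field_simps)
  qed
qed

section \<open>The data Hessian\<close>

lemma data_hessian:
  assumes A: "A \<in> carrier_mat K d" and G: "sym_pos_def K \<Gamma>"
  shows "data_hessian A \<Gamma> \<in> carrier_mat d d" "transpose_mat (data_hessian A \<Gamma>) = data_hessian A \<Gamma>"
    and "v \<in> carrier_vec d \<Longrightarrow> v \<bullet> (data_hessian A \<Gamma> *\<^sub>v v) = (A *\<^sub>v v) \<bullet> (mat_inv \<Gamma> *\<^sub>v (A *\<^sub>v v))"
proof -
  note I = sym_pos_def_inverse[OF G]
  show "data_hessian A \<Gamma> \<in> carrier_mat d d" using A I by (simp add: data_hessian_def)
  have "transpose_mat (data_hessian A \<Gamma>) = transpose_mat A * (mat_inv \<Gamma> * A)"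
    unfolding data_hessian_def using A I(1)
    by (subst transpose_mult[of _ d K _ d], simp, simp, subst transpose_mult[of _ d K _ K])
       (auto simp: I(4))
  also have "\<dots> = data_hessian A \<Gamma>"
    unfolding data_hessian_def using A I by (simp add: assoc_mult_mat[of _ d K _ K _ d])
  finally show "transpose_mat (data_hessian A \<Gamma>) = data_hessian A \<Gamma>" .
  assume v: "v \<in> carrier_vec d"
  have "data_hessian A \<Gamma> *\<^sub>v v = transpose_mat A *\<^sub>v (mat_inv \<Gamma> *\<^sub>v (A *\<^sub>v v))"
    unfolding data_hessian_def using A I v
    by (simp add: assoc_mult_mat_vec[of _ d K _ d] assoc_mult_mat_vec[of _ d K _ K])
  thus "v \<bullet> (data_hessian A \<Gamma> *\<^sub>v v) = (A *\<^sub>v v) \<bullet> (mat_inv \<Gamma> *\<^sub>v (A *\<^sub>v v))"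
    using scalar_prod_mult_mat_vec[of A K d v "mat_inv \<Gamma> *\<^sub>v (A *\<^sub>v v)"] A I v by simp
qed

lemma data_hessian_nonneg:
  assumes A: "A \<in> carrier_mat K d" and G: "sym_pos_def K \<Gamma>" and v: "v \<in> carrier_vec d"
  shows "v \<bullet> (data_hessian A \<Gamma> *\<^sub>v v) \<ge> 0"
proof (cases "A *\<^sub>v v = 0\<^sub>v K")
  case True
  thus ?thesis using data_hessian(3)[OF A G v] sym_pos_def_inverse[OF G] by simp
next
  case False
  thus ?thesis using data_hessian(3)[OF A G v] sym_pos_def_inverse_pos[OF G _ False] A v by simp
qed

lemma data_hessian_eq_0:
  assumes A: "A \<in> carrier_mat K d" and G: "sym_pos_def K \<Gamma>"
    and 0: "\<And>v. v \<in> carrier_vec d \<Longrightarrow> data_hessian A \<Gamma> *\<^sub>v v = 0\<^sub>v d"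
  shows "A = 0\<^sub>m K d"
proof (intro eq_matI)
  fix i j assume ij: "i < dim_row (0\<^sub>m K d)" "j < dim_col (0\<^sub>m K d)"
  let ?e = "unit_vec d j"
  have "(A *\<^sub>v ?e) \<bullet> (mat_inv \<Gamma> *\<^sub>v (A *\<^sub>v ?e)) = 0"
    using data_hessian(3)[OF A G, of ?e] 0[of ?e] by simp
  hence "A *\<^sub>v ?e = 0\<^sub>v K"
    using sym_pos_def_inverse_pos[OF G, of "A *\<^sub>v ?e"] A by force
  hence "(A *\<^sub>v ?e) $ i = 0" using ij by simp
  thus "A $$ (i,j) = 0\<^sub>m K d $$ (i,j)" using A ij by simp
qed (use A in auto)

text \<open>Otherwise the Hessian would annihilate every vector. This turns
  \<open>A \<noteq> 0\<close> into a positive number from which a curvature bound for fixed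
  \<open>C0\<close> can be made.\<close>

lemma data_hessian_op_norm_pos:
  assumes A: "A \<in> carrier_mat K d" and G: "sym_pos_def K \<Gamma>" and "A \<noteq> 0\<^sub>m K d"
  shows "op_norm (data_hessian A \<Gamma>) > 0"
proof (rule ccontr)
  assume neg: "\<not> ?thesis"
  have "data_hessian A \<Gamma> *\<^sub>v v = 0\<^sub>v d" if v: "v \<in> carrier_vec d" for v
  proof -
    have c: "data_hessian A \<Gamma> *\<^sub>v v \<in> carrier_vec d" using data_hessian(1)[OF A G] v by simp
    have "vec_norm (data_hessian A \<Gamma> *\<^sub>v v) \<le> op_norm (data_hessian A \<Gamma>) * vec_norm v"
      using data_hessian(1)[OF A G] v by (intro vec_norm_mult_le_op_norm) auto
    also have "\<dots> \<le> 0" using neg by (simp add: mult_nonpos_nonneg)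
    finally have "vec_norm (data_hessian A \<Gamma> *\<^sub>v v) = 0" using vec_norm_nonneg[of "data_hessian A \<Gamma> *\<^sub>v v"] by linarith
    hence "(data_hessian A \<Gamma> *\<^sub>v v) \<bullet> (data_hessian A \<Gamma> *\<^sub>v v) = 0" by (simp flip: vec_norm_sq)
    thus ?thesis using scalar_prod_self_eq_0[OF c] by simp
  qed
  hence "A = 0\<^sub>m K d" by (rule data_hessian_eq_0[OF A G])
  thus False using assms(3) by simp
qed

lemma diag_entry_le:
  assumes "D = transpose_mat V * H * V" "V \<in> carrier_mat d d" "H \<in> carrier_mat d d" "k < d"
  shows "D $$ (k,k) = col V k \<bullet> (H *\<^sub>v col V k)"
proof -
  have "D = transpose_mat V * (H * V)" using assms by (simp add: assoc_mult_mat[of _ d d _ d _ d])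
  thus ?thesis using assms by (simp add: col_mult2[of _ d d _ d])
qed

text \<open>\<open>C0\<close> and \<open>H\<close> need not commute, so a congruence takes the place
  of a common orthonormal basis. The spectral decomposition of \<open>C0\<close> gives
  \<open>E\<close> with \<open>E E^T = C0\<close>; an orthogonal factor \<open>Q\<close> on the
  right preserves this identity and is therefore free to diagonalize \<open>E^T H E\<close>.\<close>

lemma simultaneous_diagonalization:
  assumes C: "sym_pos_def d C0"
    and H: "H \<in> carrier_mat d d" "transpose_mat H = H" "\<And>v. v \<in> carrier_vec d \<Longrightarrow> v \<bullet> (H *\<^sub>v v) \<ge> 0"
  shows "\<exists>V nu. V \<in> carrier_mat d d \<and> V * transpose_mat V = C0 \<and>
    transpose_mat V * H * V = mat d d (\<lambda>(i,j). if i = j then nu i else 0) \<and> (\<forall>k<d. nu k \<ge> 0)"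
proof -
  have C0: "C0 \<in> carrier_mat d d" "transpose_mat C0 = C0" using C by (auto simp: sym_pos_def_def)
  obtain P m where P: "P \<in> carrier_mat d d" "transpose_mat P * P = 1\<^sub>m d"
    and PCP: "transpose_mat P * C0 * P = mat d d (\<lambda>(i,j). if i = j then m i else 0)"
    using real_spectral_theorem[OF C0] by auto
  have PP: "P * transpose_mat P = 1\<^sub>m d" using mat_mult_left_right_inverse[of "transpose_mat P" d P] P by auto
  have m: "m k \<ge> 0" if "k < d" for k
  proof -
    have "m k = col P k \<bullet> (C0 *\<^sub>v col P k)"
      using diag_entry_le[OF PCP[symmetric] P(1) C0(1) that] that by simp
    also have "\<dots> \<ge> 0"
      using C C0 P(1) unfolding sym_pos_def_def by (cases "col P k = 0\<^sub>v d") (auto intro!: less_imp_le)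
    finally show ?thesis .
  qed
  define D where "D = mat d d (\<lambda>(i,j). if i = j then sqrt (m i) else 0)"
  define E where "E = P * D"
  have D: "D \<in> carrier_mat d d" by (simp add: D_def)
  have E: "E \<in> carrier_mat d d" using P D by (simp add: E_def)
  have Dt: "transpose_mat D = D" unfolding D_def by (intro eq_matI) auto
  have DD: "D * D = transpose_mat P * C0 * P"
    unfolding PCP D_def using m
    by (intro eq_matI) (auto simp: scalar_prod_def if_distrib[of "\<lambda>x. x * _"] cong: if_cong)
  have "E * transpose_mat E = P * (D * D) * transpose_mat P"
    unfolding E_def using P(1) D Dt
    by (simp add: transpose_mult[of _ d d _ d] assoc_mult_mat[of _ d d _ d _ d])
  also have "\<dots> = (P * transpose_mat P) * C0 * (P * transpose_mat P)"
    unfolding DD using P(1) C0 by (simp add: assoc_mult_mat[of _ d d _ d _ d])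
  also have "\<dots> = C0" unfolding PP using C0 by simp
  finally have EE: "E * transpose_mat E = C0" .
  define N where "N = transpose_mat E * H * E"
  have N: "N \<in> carrier_mat d d" "transpose_mat N = N"
    using E H by (simp_all add: N_def transpose_mult[of _ d d _ d] assoc_mult_mat[of _ d d _ d _ d])
  obtain Q nu where Q: "Q \<in> carrier_mat d d" "transpose_mat Q * Q = 1\<^sub>m d"
    and QNQ: "transpose_mat Q * N * Q = mat d d (\<lambda>(i,j). if i = j then nu i else 0)"
    using real_spectral_theorem[OF N] by auto
  have QQ: "Q * transpose_mat Q = 1\<^sub>m d" using mat_mult_left_right_inverse[of "transpose_mat Q" d Q] Q by auto
  have EQ: "E * Q \<in> carrier_mat d d" using E Q by simp
  have t: "transpose_mat (E * Q) = transpose_mat Q * transpose_mat E" using E Q by (simp add: transpose_mult[of _ d d _ d])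
  have "(E * Q) * transpose_mat (E * Q) = E * (Q * transpose_mat Q) * transpose_mat E"
    unfolding t using E Q(1) by (simp add: assoc_mult_mat[of _ d d _ d _ d])
  also have "\<dots> = C0" unfolding QQ using E EE by simp
  finally have 1: "(E * Q) * transpose_mat (E * Q) = C0" .
  have 2: "transpose_mat (E * Q) * H * (E * Q) = mat d d (\<lambda>(i,j). if i = j then nu i else 0)"
    unfolding QNQ[symmetric] N_def t using E Q(1) H by (simp add: assoc_mult_mat[of _ d d _ d _ d])
  have "nu k \<ge> 0" if "k < d" for k
    using diag_entry_le[OF 2[symmetric] EQ H(1) that] H(3)[of "col (E * Q) k"] EQ that by simp
  thus ?thesis using EQ 1 2 by blast
qed

lemma mult_mat_vec_index:
  assumes "A \<in> carrier_mat m n" "v \<in> carrier_vec n" "i < m"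
  shows "(A *\<^sub>v v) $ i = (\<Sum>j<n. A $$ (i,j) * v $ j)"
  using assms by (simp add: scalar_prod_def atLeast0LessThan)

lemma mult_mat_index:
  assumes "A \<in> carrier_mat m n" "B \<in> carrier_mat n p" "i < m" "j < p"
  shows "(A * B) $$ (i,j) = (\<Sum>k<n. A $$ (i,k) * B $$ (k,j))"
  using assms by (simp add: scalar_prod_def atLeast0LessThan)

section \<open>Coordinates adapted to prior and Hessian\<close>

locale diagonalized_problem =
  fixes d K :: nat and A \<Gamma> C0 V :: "real mat" and nu :: "nat \<Rightarrow> real"
  assumes A: "A \<in> carrier_mat K d" and spd_noise: "sym_pos_def K \<Gamma>" and spd_C0: "sym_pos_def d C0"
    and V: "V \<in> carrier_mat d d" and VVt: "V * transpose_mat V = C0"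
    and VtHV: "transpose_mat V * data_hessian A \<Gamma> * V = mat d d (\<lambda>(i,j). if i = j then nu i else 0)"
    and nu_nonneg: "k < d \<Longrightarrow> nu k \<ge> 0"
begin

text \<open>The inverse of \<open>V\<close>, as \<open>V V^T = C0\<close>.\<close>

definition U :: "real mat" where "U = transpose_mat V * mat_inv C0"
text \<open>Sends data to coordinates: composed with \<open>A\<close> it becomes
  \<open>D * U\<close>, and it turns the noise covariance \<open>\<Gamma>\<close> into
  \<open>D\<close>.\<close>

definition B :: "real mat" where "B = transpose_mat V * (transpose_mat A * mat_inv \<Gamma>)"
definition D :: "real mat" where "D = mat d d (\<lambda>(i,j). if i = j then nu i else 0)"
abbreviation H :: "real mat" where "H \<equiv> data_hessian A \<Gamma>"

text \<open>Entries of \<open>V^T V\<close>. As \<open>V\<close> need not be orthogonal,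
  off-diagonal entries may be nonzero; they couple the coordinates in the Euclidean loss.\<close>

definition gram :: "nat \<Rightarrow> nat \<Rightarrow> real" where "gram k l = (\<Sum>m<d. V $$ (m,k) * V $$ (m,l))"

lemma C0: "C0 \<in> carrier_mat d d" "transpose_mat C0 = C0" using spd_C0 by (auto simp: sym_pos_def_def)
lemma Gamma: "\<Gamma> \<in> carrier_mat K K" "transpose_mat \<Gamma> = \<Gamma>" using spd_noise by (auto simp: sym_pos_def_def)
lemmas iC0 = sym_pos_def_inverse[OF spd_C0]
lemmas iGamma = sym_pos_def_inverse[OF spd_noise]
lemmas H = data_hessian(1,2)[OF A spd_noise]

lemma carriers: "U \<in> carrier_mat d d" "B \<in> carrier_mat d K" "D \<in> carrier_mat d d"
  using V A iC0 iGamma by (simp_all add: U_def B_def D_def)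

lemma VU: "V * U = 1\<^sub>m d"
  unfolding U_def using V iC0 VVt by (subst assoc_mult_mat[symmetric, of _ d d _ d _ d]) auto

lemma UV: "U * V = 1\<^sub>m d"
  using mat_mult_left_right_inverse[OF V carriers(1) VU] .

lemma UtVt: "transpose_mat U * transpose_mat V = 1\<^sub>m d"
  using VU V carriers by (metis transpose_mult transpose_one)

lemma VtUt: "transpose_mat V * transpose_mat U = 1\<^sub>m d"
  using UV V carriers by (metis transpose_mult transpose_one)

lemma inverse_C0: "mat_inv C0 = transpose_mat U * U"
proof (rule mat_inv_eqI)
  have "C0 * (transpose_mat U * U) = V * transpose_mat V * (transpose_mat U * U)" by (simp only: VVt)
  also have "\<dots> = V * (transpose_mat V * transpose_mat U) * U"
    using V carriers by (simp add: assoc_mult_mat[of _ d d _ d _ d])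
  finally show "C0 * (transpose_mat U * U) = 1\<^sub>m d" using V carriers by (simp add: VtUt VU)
qed (use C0 carriers in auto)

lemma H_eq: "H = transpose_mat U * D * U"
proof -
  have "transpose_mat U * D * U = (transpose_mat U * transpose_mat V) * H * (V * U)"
    unfolding D_def VtHV[symmetric] using V carriers H by (simp add: assoc_mult_mat[of _ d d _ d _ d])
  thus ?thesis using H by (simp add: UtVt VU)
qed

lemma BA: "B * A = D * U"
proof -
  have "B * A = transpose_mat V * H"
    unfolding B_def data_hessian_def using A V iGamma
    by (subst assoc_mult_mat[of _ d d _ K _ d]) auto
  also have "\<dots> = (transpose_mat V * transpose_mat U) * D * U"
    unfolding H_eq using V carriers by (simp add: assoc_mult_mat[of _ d d _ d _ d])
  finally show ?thesis using carriers by (simp add: VtUt)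
qed

lemma B_transpose: "transpose_mat B = mat_inv \<Gamma> * (A * V)"
  unfolding B_def using A V iGamma
  by (subst transpose_mult[of _ d d _ K], simp, simp, subst transpose_mult[of _ d K _ K])
     (auto simp: assoc_mult_mat[of _ K K _ d _ d])

text \<open>\<open>\<Gamma>\<close> cancels the inverse inside \<open>transpose_mat B\<close>,
  leaving \<open>B * A * V = D * U * V = D\<close>. So the transformed noise is uncorrelated for any
  noise covariance.\<close>

lemma noise_cov: "B * \<Gamma> * transpose_mat B = D"
proof -
  have AV: "A * V \<in> carrier_mat K d" using A V by simp
  have "\<Gamma> * transpose_mat B = A * V"
    unfolding B_transpose using AV Gamma iGamma by (subst assoc_mult_mat[symmetric, of _ K K _ K _ d]) auto
  hence "B * \<Gamma> * transpose_mat B = B * (A * V)"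
    using carriers Gamma by (subst assoc_mult_mat[of _ d K _ K _ d]) auto
  also have "\<dots> = B * A * V" using carriers A V by (subst assoc_mult_mat[of _ d K _ d _ d]) auto
  also have "\<dots> = D" unfolding BA using carriers V by (subst assoc_mult_mat[of _ d d _ d _ d]) (auto simp: UV)
  finally show ?thesis .
qed

lemma signal_cov: "U * C0 * transpose_mat U = 1\<^sub>m d"
proof -
  have "U * C0 * transpose_mat U = U * (V * transpose_mat V) * transpose_mat U" by (simp only: VVt)
  also have "\<dots> = (U * V) * (transpose_mat V * transpose_mat U)"
    using V carriers by (simp add: assoc_mult_mat[of _ d d _ d _ d])
  finally show ?thesis by (simp add: UV VtUt)
qed

text \<open>The regularized Hessian is \<open>U^T (D + lam I) U\<close>, so its inverse is
  \<open>V (D + lam I)^-1 V^T\<close>, and the last factor merges with the data operator into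
  \<open>B\<close>. Only a diagonal matrix depends on \<open>lam\<close>.\<close>

lemma tikhonov_eq:
  assumes "lam > 0" "y \<in> carrier_vec K"
  shows "tikhonov A \<Gamma> C0 lam y = V *\<^sub>v vec d (\<lambda>k. (B *\<^sub>v y) $ k / (nu k + lam))"
proof -
  define F where "F = mat d d (\<lambda>(i,j). if i = j then 1 / (nu i + lam) else 0)"
  have F: "F \<in> carrier_mat d d" by (simp add: F_def)
  define W where "W = D + lam \<cdot>\<^sub>m 1\<^sub>m d"
  have W: "W \<in> carrier_mat d d" using carriers by (simp add: W_def)
  have WF: "W * F = 1\<^sub>m d"
  proof (intro eq_matI)
    fix i j assume "i < dim_row (1\<^sub>m d)" "j < dim_col (1\<^sub>m d)"
    hence ij: "i < d" "j < d" by auto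
    have "(W * F) $$ (i,j) = (\<Sum>k<d. W $$ (i,k) * F $$ (k,j))" using W F ij by (intro mult_mat_index)
    also have "\<dots> = (\<Sum>k<d. if k = i then (nu i + lam) * F $$ (i,j) else 0)"
      using ij by (intro sum.cong) (auto simp: W_def D_def)
    also have "\<dots> = (nu i + lam) * F $$ (i,j)" using ij by simp
    also have "\<dots> = 1\<^sub>m d $$ (i,j)" using ij nu_nonneg[OF ij(1)] assms(1) by (auto simp: F_def)
    finally show "(W * F) $$ (i,j) = 1\<^sub>m d $$ (i,j)" .
  qed (use W F in auto)
  have P: "H + lam \<cdot>\<^sub>m mat_inv C0 = transpose_mat U * W * U"
    unfolding W_def H_eq inverse_C0 using carriers
    by (simp add: add_mult_distrib_mat[of _ d d _ _ d] mult_add_distrib_mat[of _ d d _ d]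
        mult_smult_distrib[of _ d d _ d] mult_smult_assoc_mat[of _ d d _ d])
  have "mat_inv (H + lam \<cdot>\<^sub>m mat_inv C0) = V * F * transpose_mat V"
  proof (rule mat_inv_eqI)
    have "(H + lam \<cdot>\<^sub>m mat_inv C0) * (V * F * transpose_mat V)
      = transpose_mat U * (W * ((U * V) * F)) * transpose_mat V"
      unfolding P using carriers V F W by (simp add: assoc_mult_mat[of _ d d _ d _ d])
    also have "\<dots> = 1\<^sub>m d" using carriers F by (simp add: UV WF UtVt)
    finally show "(H + lam \<cdot>\<^sub>m mat_inv C0) * (V * F * transpose_mat V) = 1\<^sub>m d" .
  qed (use H iC0 V F in auto)
  hence "tikhonov A \<Gamma> C0 lam y = V * F * transpose_mat V *\<^sub>v ((transpose_mat A * mat_inv \<Gamma>) *\<^sub>v y)"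
    by (simp add: tikhonov_def)
  also have "\<dots> = V *\<^sub>v (F *\<^sub>v (B *\<^sub>v y))"
    unfolding B_def using V F A iGamma assms(2)
    by (simp add: assoc_mult_mat_vec[of _ d d _ d] assoc_mult_mat_vec[of _ d d _ K] assoc_mult_mat_vec[of _ d K _ K])
  also have "F *\<^sub>v (B *\<^sub>v y) = vec d (\<lambda>k. (B *\<^sub>v y) $ k / (nu k + lam))"
  proof (intro eq_vecI)
    fix i assume "i < dim_vec (vec d (\<lambda>k. (B *\<^sub>v y) $ k / (nu k + lam)))"
    hence i: "i < d" by simp
    have "(F *\<^sub>v (B *\<^sub>v y)) $ i = (\<Sum>j<d. F $$ (i,j) * (B *\<^sub>v y) $ j)"
      using F carriers assms i by (intro mult_mat_vec_index) auto
    also have "\<dots> = (\<Sum>j<d. if j = i then (B *\<^sub>v y) $ i / (nu i + lam) else 0)"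
      using i by (intro sum.cong) (auto simp: F_def)
    finally show "(F *\<^sub>v (B *\<^sub>v y)) $ i = vec d (\<lambda>k. (B *\<^sub>v y) $ k / (nu k + lam)) $ i" using i by simp
  qed (use F in auto)
  finally show ?thesis .
qed

text \<open>Serves the loss and again the tail bounds, where it turns a bilinear form coupled by
  \<open>gram\<close> into a sum of \<open>d\<close> products of linear forms, one for each row of
  \<open>V\<close>.\<close>

lemma sum_gram: "(\<Sum>k<d. \<Sum>l<d. gram k l * (x k * y l)) = (\<Sum>m<d. (\<Sum>k<d. V $$ (m,k) * x k) * (\<Sum>l<d. V $$ (m,l) * y l))"
proof -
  have "(\<Sum>k<d. \<Sum>l<d. gram k l * (x k * y l)) = (\<Sum>k<d. \<Sum>l<d. \<Sum>m<d. (V $$ (m,k) * x k) * (V $$ (m,l) * y l))"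
    unfolding gram_def sum_distrib_right by (simp add: mult_ac)
  also have "\<dots> = (\<Sum>k<d. \<Sum>m<d. \<Sum>l<d. (V $$ (m,k) * x k) * (V $$ (m,l) * y l))"
    by (intro sum.cong refl sum.swap)
  also have "\<dots> = (\<Sum>m<d. \<Sum>k<d. \<Sum>l<d. (V $$ (m,k) * x k) * (V $$ (m,l) * y l))" by (rule sum.swap)
  finally show ?thesis by (simp add: sum_product)
qed

lemma loss_eq:
  assumes "lam > 0" "y \<in> carrier_vec K" "u \<in> carrier_vec d"
  shows "(vec_norm (tikhonov A \<Gamma> C0 lam y - u))\<^sup>2 = (\<Sum>k<d. \<Sum>l<d. gram k l *
     (((B *\<^sub>v y) $ k / (nu k + lam) - (U *\<^sub>v u) $ k) * ((B *\<^sub>v y) $ l / (nu l + lam) - (U *\<^sub>v u) $ l)))"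
proof -
  define x where "x k = (B *\<^sub>v y) $ k / (nu k + lam) - (U *\<^sub>v u) $ k" for k
  have "V *\<^sub>v (U *\<^sub>v u) = u"
    using V carriers assms VU by (subst assoc_mult_mat_vec[symmetric, of _ d d _ d]) auto
  hence "tikhonov A \<Gamma> C0 lam y - u = V *\<^sub>v vec d (\<lambda>k. (B *\<^sub>v y) $ k / (nu k + lam)) - V *\<^sub>v (U *\<^sub>v u)"
    by (simp add: tikhonov_eq assms)
  also have "\<dots> = V *\<^sub>v (vec d (\<lambda>k. (B *\<^sub>v y) $ k / (nu k + lam)) - U *\<^sub>v u)"
    using V carriers assms by (subst mult_minus_distrib_mat_vec[of _ d d]) auto
  also have "vec d (\<lambda>k. (B *\<^sub>v y) $ k / (nu k + lam)) - U *\<^sub>v u = vec d x"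
    using carriers by (intro eq_vecI) (auto simp: x_def)
  finally have "tikhonov A \<Gamma> C0 lam y - u = V *\<^sub>v vec d x" .
  hence "(vec_norm (tikhonov A \<Gamma> C0 lam y - u))\<^sup>2 = (\<Sum>m<d. (V *\<^sub>v vec d x) $ m * (V *\<^sub>v vec d x) $ m)"
    using V by (simp add: vec_norm_sq scalar_prod_def atLeast0LessThan del: index_mult_mat_vec)
  also have "\<dots> = (\<Sum>m<d. (\<Sum>k<d. V $$ (m,k) * x k) * (\<Sum>k<d. V $$ (m,k) * x k))"
    using V by (intro sum.cong refl) (simp add: mult_mat_vec_index[of _ d d] del: index_mult_mat_vec)
  finally show ?thesis unfolding sum_gram[symmetric] x_def .
qed

lemma BA_vec:
  assumes "u \<in> carrier_vec d" "k < d"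
  shows "(B *\<^sub>v (A *\<^sub>v u)) $ k = nu k * (U *\<^sub>v u) $ k"
proof -
  have "B *\<^sub>v (A *\<^sub>v u) = D *\<^sub>v (U *\<^sub>v u)"
    using carriers A assms BA by (metis assoc_mult_mat_vec)
  also have "(D *\<^sub>v (U *\<^sub>v u)) $ k = (\<Sum>j<d. D $$ (k,j) * (U *\<^sub>v u) $ j)"
    using carriers assms by (intro mult_mat_vec_index) auto
  also have "\<dots> = (\<Sum>j<d. if j = k then nu k * (U *\<^sub>v u) $ k else 0)"
    using assms by (intro sum.cong) (auto simp: D_def)
  finally show ?thesis using assms by simp
qed

lemma gram_diag_nonneg: "gram k k \<ge> 0" by (simp add: gram_def sum_nonneg)

lemma sum_row_eq_trace: "(\<Sum>m<d. \<Sum>k<d. (V $$ (m,k))\<^sup>2) = mat_trace C0"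
  unfolding VVt[symmetric] mat_trace_def using V
  by (simp add: mult_mat_index[of _ d d _ d] power2_eq_square del: index_mult_mat(1))

lemma trace_gram: "(\<Sum>k<d. gram k k) = mat_trace C0"
  unfolding gram_def by (subst sum.swap) (simp add: sum_row_eq_trace flip: power2_eq_square)

text \<open>\<open>C0 * H * C0\<close> is \<open>V D V^T\<close>. Up to denominators this trace is
  the slope of the risk gradient.\<close>

lemma trace_gram_nu: "(\<Sum>k<d. gram k k * nu k) = mat_trace (C0 * H * C0)"
proof -
  have "C0 * H * C0 = V * ((transpose_mat V * H * V) * transpose_mat V)"
    unfolding VVt[symmetric] using V H by (simp add: assoc_mult_mat[of _ d d _ d _ d])
  also have "\<dots> = V * (D * transpose_mat V)" by (simp add: VtHV D_def)
  finally have eq: "C0 * H * C0 = V * (D * transpose_mat V)" .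
  have DVt: "(D * transpose_mat V) $$ (k,m) = nu k * V $$ (m,k)" if "k < d" "m < d" for k m
  proof -
    have "(D * transpose_mat V) $$ (k,m) = (\<Sum>j<d. D $$ (k,j) * transpose_mat V $$ (j,m))"
      using carriers V that by (intro mult_mat_index) auto
    also have "\<dots> = (\<Sum>j<d. if j = k then nu k * V $$ (m,k) else 0)"
      using that V by (intro sum.cong) (auto simp: D_def)
    finally show ?thesis using that by simp
  qed
  have "mat_trace (C0 * H * C0) = (\<Sum>m<d. \<Sum>k<d. V $$ (m,k) * (nu k * V $$ (m,k)))"
    unfolding eq mat_trace_def
    using V carriers mult_mat_index[of V d d "D * transpose_mat V" d]
    by (simp add: DVt del: index_mult_mat(1))
  also have "\<dots> = (\<Sum>k<d. \<Sum>m<d. V $$ (m,k) * (nu k * V $$ (m,k)))" by (rule sum.swap)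
  finally show ?thesis by (simp add: gram_def sum_distrib_left mult_ac)
qed

text \<open>\<open>nu k\<close> is the quadratic form of \<open>H\<close> at a column of
  \<open>V\<close>, whose squared length \<open>gram k k\<close> is part of the trace of
  \<open>C0\<close>. This yields an eigenvalue bound free of the dimension.\<close>

lemma nu_le:
  assumes "k < d" shows "nu k \<le> op_norm H * gram k k"
proof -
  have "nu k = col V k \<bullet> (H *\<^sub>v col V k)"
    using diag_entry_le[OF VtHV[symmetric] V H(1) assms] assms by simp
  also have "\<dots> \<le> vec_norm (col V k) * vec_norm (H *\<^sub>v col V k)"
    using abs_scalar_prod_le[of "col V k" "H *\<^sub>v col V k"] H V by simp
  also have "\<dots> \<le> vec_norm (col V k) * (op_norm H * vec_norm (col V k))"
    using H V by (intro mult_left_mono vec_norm_mult_le_op_norm) auto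
  also have "\<dots> = op_norm H * (col V k \<bullet> col V k)" by (simp add: power2_eq_square flip: vec_norm_sq)
  also have "col V k \<bullet> col V k = gram k k"
    using V assms by (simp add: scalar_prod_def gram_def atLeast0LessThan)
  finally show ?thesis .
qed

text \<open>A diagonal entry of \<open>C0\<close>. Strict positivity matters because these sums
  become Jensen weights, by which one divides.\<close>

lemma row_pos:
  assumes "m < d" shows "(\<Sum>k<d. (V $$ (m,k))\<^sup>2) > 0"
proof -
  have "(\<Sum>k<d. (V $$ (m,k))\<^sup>2) = C0 $$ (m,m)"
    unfolding VVt[symmetric] using V assms
    by (simp add: mult_mat_index[of _ d d _ d] power2_eq_square del: index_mult_mat(1))
  also have "\<dots> = unit_vec d m \<bullet> (C0 *\<^sub>v unit_vec d m)" using C0 assms by simp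
  also have "\<dots> > 0" using spd_C0 assms unfolding sym_pos_def_def by auto
  finally show ?thesis .
qed

end

lemma diagonalized_problem_exists:
  assumes "A \<in> carrier_mat K d" "sym_pos_def K \<Gamma>" "sym_pos_def d C0"
  shows "\<exists>V nu. diagonalized_problem d K A \<Gamma> C0 V nu"
  using simultaneous_diagonalization[OF assms(3) data_hessian(1,2)[OF assms(1,2)] data_hessian_nonneg[OF assms(1,2)]]
    assms by (auto simp: diagonalized_problem_def)

lemma op_norm_leI:
  assumes "\<And>v. v \<in> carrier_vec (dim_col B) \<Longrightarrow> vec_norm (B *\<^sub>v v) \<le> c * vec_norm v" "c \<ge> 0"
  shows "op_norm B \<le> c"
  unfolding op_norm_def
proof (rule cSup_least)
  have "vec_norm (0\<^sub>v (dim_col B)) \<le> 1" by (simp add: vec_norm_def)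
  thus "{vec_norm (B *\<^sub>v v) |v. v \<in> carrier_vec (dim_col B) \<and> vec_norm v \<le> 1} \<noteq> {}"
    using zero_carrier_vec by blast
next
  fix x assume "x \<in> {vec_norm (B *\<^sub>v v) |v. v \<in> carrier_vec (dim_col B) \<and> vec_norm v \<le> 1}"
  then obtain v where v: "x = vec_norm (B *\<^sub>v v)" "v \<in> carrier_vec (dim_col B)" "vec_norm v \<le> 1" by auto
  show "x \<le> c" using assms(1)[OF v(2)] mult_left_mono[OF v(3) assms(2)] v(1) by simp
qed

text \<open>Read backwards, a nonzero Hessian norm bounds the trace of \<open>C0 H C0\<close> from
  below once \<open>C0\<close> is fixed. With \<open>c\<close> the squared Frobenius norm of
  \<open>U\<close>, Cauchy-Schwarz applied to \<open>U * V = 1\<close> gives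
  \<open>1 \<le> c * gram k k\<close>, so every \<open>nu k\<close> is at most \<open>c\<close>
  times that trace; the two factors \<open>U\<close> in \<open>H = U^T D U\<close> cost another
  \<open>c\<close>.\<close>

lemma (in diagonalized_problem) op_norm_data_hessian_le:
  "op_norm H \<le> (mat_trace (mat_inv C0))\<^sup>2 * mat_trace (C0 * H * C0)"
proof -
  define c where "c = mat_trace (mat_inv C0)"
  have c: "c = (\<Sum>k<d. \<Sum>i<d. (U $$ (k,i))\<^sup>2)"
  proof -
    have "c = (\<Sum>i<d. \<Sum>k<d. (U $$ (k,i))\<^sup>2)"
      unfolding c_def mat_trace_def inverse_C0 using carriers
      by (simp add: mult_mat_index[of _ d d _ d] power2_eq_square del: index_mult_mat(1))
    thus ?thesis by (subst sum.swap)
  qed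
  have row_le: "(\<Sum>i<d. (U $$ (k,i))\<^sup>2) \<le> c" if "k < d" for k
    unfolding c using that by (intro member_le_sum) (auto intro: sum_nonneg)
  have c0: "c \<ge> 0" unfolding c by (intro sum_nonneg) auto
  have gram: "1 \<le> c * gram k k" if "k < d" for k
  proof -
    have "1 = (U * V) $$ (k,k)" using that by (simp add: UV)
    also have "\<dots> = (\<Sum>i<d. U $$ (k,i) * V $$ (i,k))" using carriers V that by (intro mult_mat_index) auto
    finally have "1 = (\<Sum>i<d. U $$ (k,i) * V $$ (i,k))\<^sup>2" by simp
    also have "\<dots> \<le> (\<Sum>i<d. (U $$ (k,i))\<^sup>2) * (\<Sum>i<d. (V $$ (i,k))\<^sup>2)" by (rule Cauchy_Schwarz_ineq_sum)
    also have "\<dots> \<le> c * gram k k"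
      using row_le[OF that] by (intro mult_mono) (auto simp: gram_def power2_eq_square sum_nonneg c0)
    finally show ?thesis .
  qed
  define q where "q = mat_trace (C0 * H * C0)"
  have nuq: "nu k \<le> c * q" if "k < d" for k
  proof -
    have "nu k \<le> nu k * (c * gram k k)" using mult_left_mono[OF gram[OF that] nu_nonneg[OF that]] by simp
    also have "\<dots> = c * (gram k k * nu k)" by simp
    also have "\<dots> \<le> c * q" unfolding q_def trace_gram_nu[symmetric]
      using that c0 by (intro mult_left_mono member_le_sum) (auto intro!: mult_nonneg_nonneg gram_diag_nonneg nu_nonneg)
    finally show ?thesis .
  qed
  have q0: "q \<ge> 0" unfolding q_def trace_gram_nu[symmetric]
    by (intro sum_nonneg mult_nonneg_nonneg gram_diag_nonneg nu_nonneg) auto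
  have fr: "frobenius_norm U = sqrt c" "frobenius_norm (transpose_mat U) = sqrt c"
    unfolding frobenius_norm_def using carriers c by (simp_all, subst sum.swap, simp)
  have "op_norm H \<le> c * (c * q)"
  proof (rule op_norm_leI)
    fix v :: "real vec" assume "v \<in> carrier_vec (dim_col H)"
    hence v: "v \<in> carrier_vec d" using H by simp
    have D: "vec_norm (D *\<^sub>v w) \<le> c * q * vec_norm w" if w: "w \<in> carrier_vec d" for w
    proof -
      have Dw: "(D *\<^sub>v w) $ k = nu k * w $ k" if "k < d" for k
      proof -
        have "(D *\<^sub>v w) $ k = (\<Sum>j<d. D $$ (k,j) * w $ j)"
          using carriers w that by (intro mult_mat_vec_index) auto
        also have "\<dots> = (\<Sum>j<d. if j = k then nu k * w $ k else 0)"
          using that by (intro sum.cong) (auto simp: D_def)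
        finally show ?thesis using that by simp
      qed
      have "(vec_norm (D *\<^sub>v w))\<^sup>2 = (\<Sum>k<d. (nu k * w $ k)\<^sup>2)"
        unfolding vec_norm_sq using carriers
        by (simp add: scalar_prod_def[of "D *\<^sub>v w"] Dw power2_eq_square atLeast0LessThan del: index_mult_mat_vec)
      also have "\<dots> \<le> (\<Sum>k<d. (c * q)\<^sup>2 * (w $ k)\<^sup>2)"
        unfolding power_mult_distrib[of "nu _"] using nuq nu_nonneg by (intro sum_mono mult_right_mono power_mono) auto
      also have "\<dots> = (c * q * vec_norm w)\<^sup>2"
        unfolding power_mult_distrib[of _ "vec_norm w"] vec_norm_sq sum_distrib_left[symmetric] using w
        by (simp add: scalar_prod_def power2_eq_square atLeast0LessThan)
      finally show ?thesis by (rule power2_le_imp_le) (simp add: c0 q0)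
    qed
    have "H *\<^sub>v v = transpose_mat U *\<^sub>v (D *\<^sub>v (U *\<^sub>v v))"
      unfolding H_eq using carriers v by (simp add: assoc_mult_mat_vec[of _ d d _ d])
    moreover have "D *\<^sub>v (U *\<^sub>v v) \<in> carrier_vec d" using carriers v by simp
    ultimately have "vec_norm (H *\<^sub>v v) \<le> sqrt c * vec_norm (D *\<^sub>v (U *\<^sub>v v))"
      using vec_norm_mult_le_frobenius[of "D *\<^sub>v (U *\<^sub>v v)" "transpose_mat U"] carriers fr by simp
    also have "\<dots> \<le> sqrt c * (c * q * vec_norm (U *\<^sub>v v))"
      using D[of "U *\<^sub>v v"] carriers v c0 by (intro mult_left_mono) auto
    also have "\<dots> \<le> sqrt c * (c * q * (sqrt c * vec_norm v))"
      using vec_norm_mult_le_frobenius[of v U] carriers fr v c0 q0 by (intro mult_left_mono) auto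
    also have "\<dots> = (sqrt c * sqrt c) * (c * q) * vec_norm v" by (simp only: mult_ac)
    also have "sqrt c * sqrt c = c" using c0 by simp
    finally show "vec_norm (H *\<^sub>v v) \<le> c * (c * q) * vec_norm v" .
  qed (use c0 q0 in simp)
  thus ?thesis by (simp add: c_def q_def power2_eq_square mult.assoc)
qed

section \<open>Sub-Gaussian vectors\<close>

lemma space_borel_vec [simp]: "space (borel_vec n) = carrier_vec n"
  by (simp add: borel_vec_def)

lemma measurable_borel_vecI:
  assumes "\<And>\<omega>. \<omega> \<in> space M \<Longrightarrow> f \<omega> \<in> carrier_vec n"
    and "\<And>i. i < n \<Longrightarrow> (\<lambda>\<omega>. f \<omega> $ i) \<in> borel_measurable M"
  shows "f \<in> measurable M (borel_vec n)"
  unfolding borel_vec_def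
  by (rule measurable_vimage_algebra2) (use assms in \<open>auto intro!: measurable_restrict\<close>)

lemma measurable_vec_index [measurable]:
  assumes "i < n" shows "(\<lambda>v. v $ i) \<in> borel_measurable (borel_vec n)"
proof -
  have "(\<lambda>v::real vec. \<lambda>i\<in>{..<n}. v $ i) \<in> measurable (borel_vec n) (PiM {..<n} (\<lambda>_. borel))"
    unfolding borel_vec_def by (rule measurable_vimage_algebra1) (auto simp: space_PiM)
  from measurable_compose[OF this measurable_component_singleton[of i]] assms
  show ?thesis by simp
qed

lemma measurable_scalar_prod_borel_vec:
  fixes a :: "real vec"
  assumes "a \<in> carrier_vec n"
  shows "(\<lambda>v. a \<bullet> v) \<in> borel_measurable (borel_vec n)"
proof -
  have "(\<lambda>v. \<Sum>i<n. a $ i * v $ i) \<in> borel_measurable (borel_vec n)" by measurable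
  also have "?this \<longleftrightarrow> ?thesis" by (intro measurable_cong) (simp add: scalar_prod_def atLeast0LessThan)
  finally show ?thesis .
qed

lemma measurable_mult_mat_vec:
  assumes "B \<in> carrier_mat m n"
  shows "(\<lambda>v. B *\<^sub>v v) \<in> measurable (borel_vec n) (borel_vec m)"
proof (rule measurable_borel_vecI)
  fix i assume i: "i < m"
  have "(\<lambda>v. \<Sum>j<n. B $$ (i,j) * v $ j) \<in> borel_measurable (borel_vec n)" by measurable
  also have "?this \<longleftrightarrow> (\<lambda>v. (B *\<^sub>v v) $ i) \<in> borel_measurable (borel_vec n)"
    using assms i by (intro measurable_cong) (auto simp: scalar_prod_def atLeast0LessThan)
  finally show "(\<lambda>v. (B *\<^sub>v v) $ i) \<in> borel_measurable (borel_vec n)" .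
qed (use assms in auto)

lemma measurable_add_vec:
  assumes "f \<in> measurable M (borel_vec n)" "g \<in> measurable M (borel_vec n)"
  shows "(\<lambda>\<omega>. f \<omega> + g \<omega>) \<in> measurable M (borel_vec n)"
proof (rule measurable_borel_vecI)
  have sp: "f \<omega> \<in> carrier_vec n" "g \<omega> \<in> carrier_vec n" if "\<omega> \<in> space M" for \<omega>
    using assms that by (auto dest: measurable_space)
  show "f \<omega> + g \<omega> \<in> carrier_vec n" if "\<omega> \<in> space M" for \<omega> using sp[OF that] by simp
  fix i assume i: "i < n"
  have "(\<lambda>\<omega>. f \<omega> $ i + g \<omega> $ i) \<in> borel_measurable M"
    using assms i by (intro borel_measurable_add) (auto intro: measurable_compose[OF _ measurable_vec_index])
  also have "?this \<longleftrightarrow> (\<lambda>\<omega>. (f \<omega> + g \<omega>) $ i) \<in> borel_measurable M"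
    using i sp(2) by (intro measurable_cong) (auto dest!: sp(2))
  finally show "(\<lambda>\<omega>. (f \<omega> + g \<omega>) $ i) \<in> borel_measurable M" .
qed

section \<open>Moments and Laplace transform of the component law\<close>

text \<open>Each step multiplies one side by \<open>m\<close> and the other by a larger factor. The
  case \<open>k = m\<close> will absorb the power \<open>k ^ k\<close> of the moment bound into the
  factorials.\<close>

lemma fact_mult_power_le: "fact m * real m ^ k \<le> (fact (m + k) :: real)"
proof (induction k)
  case (Suc k)
  have "fact m * real m ^ Suc k = (fact m * real m ^ k) * real m" by simp
  also have "\<dots> \<le> fact (m + k) * real (Suc (m + k))" using Suc by (intro mult_mono) auto
  finally show ?case by (simp add: mult.commute)
qed simp

lemma sums_cosh_even: "(\<lambda>k. x ^ (2 * k) / fact (2 * k)) sums cosh (x :: real)"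
proof -
  have "(\<lambda>n. if even n then x ^ n /\<^sub>R fact n else 0) sums cosh x" by (rule cosh_converges)
  also have "?this \<longleftrightarrow> (\<lambda>k. if even (2 * k) then x ^ (2 * k) /\<^sub>R fact (2 * k) else 0) sums cosh x"
    by (subst sums_mono_reindex[of "\<lambda>k. 2 * k", symmetric])
       (auto simp: strict_mono_def elim!: evenE)
  finally show ?thesis by (simp add: field_simps)
qed

context
  fixes C :: real and \<mu> :: "real measure"
  assumes mu: "sub_gaussian_law C \<mu>"
begin

interpretation prob_space \<mu> using mu by (simp add: sub_gaussian_law_def)

lemma sub_gaussian_law_sets: "sets \<mu> = sets borel" "prob_space \<mu>" using mu by (simp_all add: sub_gaussian_law_def)

text \<open>The moment condition at \<open>p = 2 * k\<close>, raised to that power;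
  \<open>k = 0\<close> is apart because \<open>p \<ge> 1\<close>. Even powers suffice, since
  symmetry of the law reduces the exponential to \<open>cosh\<close>.\<close>

lemma sub_gaussian_law_even_moment:
  "integrable \<mu> (\<lambda>x. x ^ (2 * k)) \<and> (\<integral>x. x ^ (2 * k) \<partial>\<mu>) \<le> (C\<^sup>2 * (2 * real k)) ^ k"
proof (cases "k = 0")
  case True
  thus ?thesis by (simp add: prob_space)
next
  case False
  define p where "p = real (2 * k)"
  have p: "p \<ge> 1" using False by (simp add: p_def)
  have eq: "\<bar>x\<bar> powr p = x ^ (2 * k)" for x :: real
    by (cases "x = 0") (use False in \<open>simp_all add: p_def powr_realpow power_even_abs flip: of_nat_mult\<close>)
  have 1: "integrable \<mu> (\<lambda>x. x ^ (2 * k))" "p powr (- 1 / 2) * (\<integral>x. x ^ (2 * k) \<partial>\<mu>) powr (1 / p) \<le> C"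
    using mu p unfolding sub_gaussian_law_def by (auto simp: eq dest!: spec[of _ p])
  define m where "m = (\<integral>x. x ^ (2 * k) \<partial>\<mu>)"
  have m: "m \<ge> 0" unfolding m_def by (intro integral_nonneg_AE) auto
  have "m powr (1 / p) \<le> C * p powr (1 / 2)"
  proof -
    have "p powr (1/2) * (p powr (- 1 / 2) * m powr (1 / p)) \<le> p powr (1/2) * C"
      using 1(2) unfolding m_def by (intro mult_left_mono) auto
    thus ?thesis using p by (simp add: mult.commute powr_minus field_simps)
  qed
  hence "(m powr (1 / p)) ^ (2 * k) \<le> (C * p powr (1 / 2)) ^ (2 * k)"
    by (intro power_mono) auto
  also have "(m powr (1 / p)) ^ (2 * k) = m"
    using m p False by (cases "m = 0") (simp_all add: p_def powr_powr flip: powr_realpow)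
  also have "(C * p powr (1 / 2)) ^ (2 * k) = (C\<^sup>2 * p) ^ k"
    using p by (simp add: power_mult power_mult_distrib powr_half_sqrt)
  finally show ?thesis using 1 by (simp add: m_def p_def)
qed

lemma sub_gaussian_law_moments:
  "integrable \<mu> (\<lambda>x. x)" "(\<integral>x. x \<partial>\<mu>) = 0" "integrable \<mu> (\<lambda>x. x\<^sup>2)" "(\<integral>x. x\<^sup>2 \<partial>\<mu>) = 1"
proof -
  show "integrable \<mu> (\<lambda>x. x\<^sup>2)" using sub_gaussian_law_even_moment[of 1] by simp
  have "integrable \<mu> (\<lambda>x. \<bar>x\<bar>)" using mu unfolding sub_gaussian_law_def by (auto dest!: spec[of _ 1])
  thus "integrable \<mu> (\<lambda>x. x)"
    by (subst (asm) integrable_abs_iff) (auto simp: measurable_cong_sets[OF sub_gaussian_law_sets(1) refl])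
qed (use mu in \<open>simp_all add: sub_gaussian_law_def\<close>)

text \<open>By symmetry \<open>exp\<close> may be replaced by \<open>cosh\<close>, a series of
  nonnegative terms that is integrated termwise without integrability. Term \<open>k\<close> is at
  most \<open>(2 * C\<^sup>2 * s\<^sup>2) ^ k * k ^ k / fact (2 * k)\<close>, and
  \<open>k ^ k / fact (2 * k) \<le> 1 / fact k\<close> rebuilds an exponential series. With no odd
  terms present, the bound holds for every \<open>s\<close>.\<close>

lemma sub_gaussian_law_mgf:
  "(\<integral>\<^sup>+x. ennreal (exp (s * x)) \<partial>\<mu>) \<le> ennreal (exp (2 * C\<^sup>2 * s\<^sup>2))"
proof -
  have [measurable_cong]: "sets \<mu> = sets borel" by (rule sub_gaussian_law_sets)
  have "(\<integral>\<^sup>+x. ennreal (exp (s * x)) \<partial>\<mu>) = (\<integral>\<^sup>+x. ennreal (exp (s * x)) \<partial>distr \<mu> borel uminus)"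
    using mu by (simp add: sub_gaussian_law_def)
  also have "\<dots> = (\<integral>\<^sup>+x. ennreal (exp (- s * x)) \<partial>\<mu>)" by (subst nn_integral_distr) auto
  finally have sym: "(\<integral>\<^sup>+x. ennreal (exp (s * x)) \<partial>\<mu>) = (\<integral>\<^sup>+x. ennreal (exp (- s * x)) \<partial>\<mu>)" .
  have "2 * (\<integral>\<^sup>+x. ennreal (exp (s * x)) \<partial>\<mu>) = (\<integral>\<^sup>+x. ennreal (exp (s * x)) + ennreal (exp (- s * x)) \<partial>\<mu>)"
    by (subst nn_integral_add) (auto simp: sym mult_2)
  also have "\<dots> = (\<integral>\<^sup>+x. 2 * ennreal (cosh (s * x)) \<partial>\<mu>)"
    by (intro nn_integral_cong) (simp add: cosh_field_def flip: ennreal_plus ennreal_mult' ennreal_numeral)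
  also have "\<dots> = 2 * (\<integral>\<^sup>+x. ennreal (cosh (s * x)) \<partial>\<mu>)"
    by (subst nn_integral_cmult) (auto simp: cosh_field_def[abs_def])
  finally have "(\<integral>\<^sup>+x. ennreal (exp (s * x)) \<partial>\<mu>) = (\<integral>\<^sup>+x. ennreal (cosh (s * x)) \<partial>\<mu>)"
    by (subst (asm) ennreal_mult_cancel_left) auto
  also have "\<dots> = (\<integral>\<^sup>+x. (\<Sum>k. ennreal ((s * x) ^ (2 * k) / fact (2 * k))) \<partial>\<mu>)"
    using sums_cosh_even by (intro nn_integral_cong suminf_ennreal_eq[symmetric]) auto
  also have "\<dots> = (\<Sum>k. \<integral>\<^sup>+x. ennreal ((s * x) ^ (2 * k) / fact (2 * k)) \<partial>\<mu>)"
    by (intro nn_integral_suminf) auto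
  also have "\<dots> \<le> (\<Sum>k. ennreal ((2 * C\<^sup>2 * s\<^sup>2) ^ k /\<^sub>R fact k))"
  proof (intro suminf_le)
    fix k
    have int: "integrable \<mu> (\<lambda>x. s ^ (2 * k) / fact (2 * k) * x ^ (2 * k))"
      using sub_gaussian_law_even_moment[of k] by (intro integrable_mult_right) auto
    have "(\<integral>\<^sup>+x. ennreal ((s * x) ^ (2 * k) / fact (2 * k)) \<partial>\<mu>)
      = (\<integral>\<^sup>+x. ennreal (s ^ (2 * k) / fact (2 * k) * x ^ (2 * k)) \<partial>\<mu>)"
      by (simp add: power_mult_distrib)
    also have "\<dots> = ennreal (\<integral>x. s ^ (2 * k) / fact (2 * k) * x ^ (2 * k) \<partial>\<mu>)"
      by (intro nn_integral_eq_integral int) auto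
    also have "(\<integral>x. s ^ (2 * k) / fact (2 * k) * x ^ (2 * k) \<partial>\<mu>) = s ^ (2 * k) / fact (2 * k) * (\<integral>x. x ^ (2 * k) \<partial>\<mu>)"
      by simp
    also have "\<dots> \<le> s ^ (2 * k) / fact (2 * k) * (C\<^sup>2 * (2 * real k)) ^ k"
      using sub_gaussian_law_even_moment[of k] by (intro mult_left_mono) auto
    also have "\<dots> = (2 * C\<^sup>2 * s\<^sup>2) ^ k * real k ^ k / fact (2 * k)"
      by (simp add: power_mult_distrib power_mult power2_eq_square mult_ac)
    also have "\<dots> \<le> (2 * C\<^sup>2 * s\<^sup>2) ^ k * (1 / fact k)"
    proof -
      have "real k ^ k / fact (2 * k) \<le> 1 / fact k"
        using fact_mult_power_le[of k k] by (simp add: field_simps mult_2[symmetric])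
      thus ?thesis unfolding times_divide_eq_right[symmetric] by (intro mult_left_mono) (auto simp del: times_divide_eq_right)
    qed
    also have "\<dots> = (2 * C\<^sup>2 * s\<^sup>2) ^ k /\<^sub>R fact k" by (simp add: field_simps)
    finally show "(\<integral>\<^sup>+x. ennreal ((s * x) ^ (2 * k) / fact (2 * k)) \<partial>\<mu>) \<le> ennreal ((2 * C\<^sup>2 * s\<^sup>2) ^ k /\<^sub>R fact k)"
      by (simp add: ennreal_leI)
  qed auto
  also have "\<dots> = ennreal (exp (2 * C\<^sup>2 * s\<^sup>2))"
    by (intro suminf_ennreal_eq exp_converges) auto
  finally show ?thesis .
qed

end

text \<open>A coordinate, or a product of two, is written as a product over all components, with
  factor 1 elsewhere and a square where both indices meet, so that the product formula for integrals
  applies.\<close>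

lemma product_coordinate_moments:
  assumes mu: "sub_gaussian_law C \<mu>" and i: "i < l" and j: "j < l"
  defines "P \<equiv> PiM {..<l} (\<lambda>_::nat. \<mu>)"
  shows "integrable P (\<lambda>s. s i)" "(\<integral>s. s i \<partial>P) = 0"
    "integrable P (\<lambda>s. s i * s j)" "(\<integral>s. s i * s j \<partial>P) = (if i = j then 1 else 0)"
proof -
  interpret prob_space \<mu> using mu by (simp add: sub_gaussian_law_def)
  interpret product_sigma_finite "\<lambda>_. \<mu>" ..
  note mom = sub_gaussian_law_moments[OF mu]
  define f where "f k x = (if k = i then x else 1 :: real)" for k x
  have f: "integrable \<mu> (f k)" for k using mom by (cases "k = i") (simp_all add: f_def[abs_def])
  have fs: "(\<Prod>k<l. f k (s k)) = s i" for s using i by (simp add: f_def)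
  have "integral\<^sup>L \<mu> (f i) = 0" using mom by (simp add: f_def[abs_def])
  hence "(\<Prod>k<l. integral\<^sup>L \<mu> (f k)) = 0" using i by (intro prod_zero) blast+
  thus "integrable P (\<lambda>s. s i)" "(\<integral>s. s i \<partial>P) = 0"
    using product_integrable_prod[of "{..<l}" f, OF _ f] product_integral_prod[of "{..<l}" f, OF _ f]
    by (simp_all add: fs P_def)
  define g where "g k x = (if k = i then x else 1) * (if k = j then x else 1 :: real)" for k x
  have g: "integrable \<mu> (g k)" for k
    using mom by (cases "k = i"; cases "k = j") (simp_all add: g_def[abs_def] power2_eq_square)
  have gs: "(\<Prod>k<l. g k (s k)) = s i * s j" for s
    using i j by (simp add: g_def prod.distrib)
  have "(\<Prod>k<l. integral\<^sup>L \<mu> (g k)) = (if i = j then 1 else 0)"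
  proof (cases "i = j")
    case True
    have "integral\<^sup>L \<mu> (g k) = 1" for k
      using mom True prob_space by (cases "k = j") (simp_all add: g_def[abs_def] power2_eq_square)
    thus ?thesis using True by simp
  next
    case False
    hence "integral\<^sup>L \<mu> (g i) = 0" using mom by (simp add: g_def[abs_def])
    hence "(\<Prod>k<l. integral\<^sup>L \<mu> (g k)) = 0" using i by (intro prod_zero) blast+
    thus ?thesis using False by simp
  qed
  thus "integrable P (\<lambda>s. s i * s j)" "(\<integral>s. s i * s j \<partial>P) = (if i = j then 1 else 0)"
    using product_integrable_prod[of "{..<l}" g, OF _ g] product_integral_prod[of "{..<l}" g, OF _ g]
    by (simp_all add: gs P_def)
qed

text \<open>A linear functional of the vector is a linear functional of the independent components, with
  coefficients \<open>S *\<^sub>v a\<close> whose squared length is the variance \<open>a \<bullet> (Sig *\<^sub>v a)\<close>.\<close>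
context
  fixes C :: real and M :: "'w measure" and l :: nat and Sig S :: "real mat" and \<mu> :: "real measure" and z :: "'w \<Rightarrow> real vec"
  assumes S: "sym_pos_semidef l S" "S * S = Sig" and mu: "sub_gaussian_law C \<mu>"
    and meas: "z \<in> measurable M (borel_vec l)"
    and distr: "distr M (borel_vec l) z = distr (PiM {..<l} (\<lambda>_. \<mu>)) (borel_vec l) (\<lambda>s. S *\<^sub>v vec l s)"
begin

abbreviation (input) "root_lin a s \<equiv> (\<Sum>i<l. (S *\<^sub>v a) $ i * s i)"
abbreviation (input) "component_law \<equiv> PiM {..<l} (\<lambda>_. \<mu>)"

lemma root_carrier: "S \<in> carrier_mat l l" "transpose_mat S = S" using S by (auto simp: sym_pos_semidef_def)

lemma measurable_root_mult: "(\<lambda>s. S *\<^sub>v vec l s) \<in> measurable component_law (borel_vec l)"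
proof (rule measurable_compose[OF _ measurable_mult_mat_vec[OF root_carrier(1)]])
  have sets: "sets component_law = sets (PiM {..<l} (\<lambda>_. borel))"
    using sub_gaussian_law_sets(1)[OF mu] by (intro sets_PiM_cong) auto
  show "(\<lambda>s. vec l s) \<in> measurable component_law (borel_vec l)"
    by (rule measurable_borel_vecI) (simp_all add: measurable_cong_sets[OF sets refl])
qed

lemma scalar_prod_root: 
  assumes "a \<in> carrier_vec l" shows "a \<bullet> (S *\<^sub>v vec l s) = root_lin a s"
proof -
  have "a \<bullet> (S *\<^sub>v vec l s) = (S *\<^sub>v vec l s) \<bullet> a" using assms root_carrier by (intro comm_scalar_prod) auto
  also have "\<dots> = vec l s \<bullet> (S *\<^sub>v a)"
    using scalar_prod_mult_mat_vec[OF root_carrier(1), of "vec l s" a] root_carrier assms by simp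
  also have "\<dots> = root_lin a s"
    using root_carrier unfolding scalar_prod_def[of "vec l s"]
    by (simp add: atLeast0LessThan mult.commute[of "s _"] del: index_mult_mat_vec)
  finally show ?thesis .
qed

lemma sum_root_products:
  assumes "a \<in> carrier_vec l" "b \<in> carrier_vec l"
  shows "(\<Sum>i<l. (S *\<^sub>v a) $ i * (S *\<^sub>v b) $ i) = a \<bullet> (Sig *\<^sub>v b)"
proof -
  have "(\<Sum>i<l. (S *\<^sub>v a) $ i * (S *\<^sub>v b) $ i) = (S *\<^sub>v a) \<bullet> (S *\<^sub>v b)"
    using root_carrier by (simp add: scalar_prod_def[of "S *\<^sub>v a"] atLeast0LessThan del: index_mult_mat_vec)
  also have "\<dots> = a \<bullet> (Sig *\<^sub>v b)"
    using scalar_prod_mult_mat_vec[OF root_carrier(1), of a "S *\<^sub>v b"] root_carrier assms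
    by (simp add: assoc_mult_mat_vec[of _ l l _ l] flip: S(2))
  finally show ?thesis .
qed

lemma nn_integral_linear:
  assumes a: "a \<in> carrier_vec l" and [measurable]: "f \<in> borel_measurable borel"
  shows "(\<integral>\<^sup>+\<omega>. f (a \<bullet> z \<omega>) \<partial>M) = (\<integral>\<^sup>+s. f (root_lin a s) \<partial>component_law)"
proof -
  have m: "(\<lambda>v. f (a \<bullet> v)) \<in> borel_measurable (borel_vec l)"
    using measurable_scalar_prod_borel_vec[OF a] by measurable
  have "(\<integral>\<^sup>+\<omega>. f (a \<bullet> z \<omega>) \<partial>M) = (\<integral>\<^sup>+v. f (a \<bullet> v) \<partial>distr M (borel_vec l) z)"
    by (subst nn_integral_distr[OF meas]) (use m in auto)
  also have "\<dots> = (\<integral>\<^sup>+s. f (a \<bullet> (S *\<^sub>v vec l s)) \<partial>component_law)"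
    unfolding distr by (subst nn_integral_distr[OF measurable_root_mult]) (use m in auto)
  finally show ?thesis by (simp add: scalar_prod_root a)
qed

lemma integral_linear:
  fixes g :: "real vec \<Rightarrow> real"
  assumes g: "g \<in> borel_measurable (borel_vec l)"
  shows "integrable M (\<lambda>\<omega>. g (z \<omega>)) \<longleftrightarrow> integrable component_law (\<lambda>s. g (S *\<^sub>v vec l s))"
    "(\<integral>\<omega>. g (z \<omega>) \<partial>M) = (\<integral>s. g (S *\<^sub>v vec l s) \<partial>component_law)"
  using integrable_distr_eq[OF meas g] integrable_distr_eq[OF measurable_root_mult g]
    integral_distr[OF meas g] integral_distr[OF measurable_root_mult g] distr by simp_all

lemma sub_gaussian_mgf_aux:
  assumes a: "a \<in> carrier_vec l"
  shows "(\<integral>\<^sup>+\<omega>. ennreal (exp (a \<bullet> z \<omega>)) \<partial>M) \<le> ennreal (exp (2 * C\<^sup>2 * (a \<bullet> (Sig *\<^sub>v a))))"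
proof -
  have eq: "(\<integral>\<^sup>+\<omega>. ennreal (exp (a \<bullet> z \<omega>)) \<partial>M) = (\<integral>\<^sup>+s. ennreal (exp (root_lin a s)) \<partial>component_law)"
    by (rule nn_integral_linear[OF a, of "\<lambda>x. ennreal (exp x)"]) simp
  interpret prob_space \<mu> using mu by (simp add: sub_gaussian_law_def)
  interpret product_sigma_finite "\<lambda>_. \<mu>" ..
  have [measurable_cong]: "sets \<mu> = sets borel" using mu by (rule sub_gaussian_law_sets)
  define c where "c i = (S *\<^sub>v a) $ i" for i
  have "(\<integral>\<^sup>+\<omega>. ennreal (exp (a \<bullet> z \<omega>)) \<partial>M) =
      (\<integral>\<^sup>+s. (\<Prod>i<l. ennreal (exp (c i * s i))) \<partial>PiM {..<l} (\<lambda>_. \<mu>))"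
    unfolding eq c_def[symmetric] by (simp add: exp_sum prod_ennreal)
  also have "\<dots> = (\<Prod>i<l. \<integral>\<^sup>+x. ennreal (exp (c i * x)) \<partial>\<mu>)"
    by (rule product_nn_integral_prod) measurable
  also have "\<dots> \<le> (\<Prod>i<l. ennreal (exp (2 * C\<^sup>2 * (c i)\<^sup>2)))"
    by (intro prod_mono_ennreal sub_gaussian_law_mgf[OF mu])
  also have "\<dots> = ennreal (exp (\<Sum>i<l. 2 * C\<^sup>2 * (c i)\<^sup>2))"
    by (simp add: prod_ennreal exp_sum)
  also have "(\<Sum>i<l. 2 * C\<^sup>2 * (c i)\<^sup>2) = 2 * C\<^sup>2 * (a \<bullet> (Sig *\<^sub>v a))"
    unfolding sum_distrib_left[symmetric] sum_root_products[OF a a, symmetric] c_def[symmetric] power2_eq_square ..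
  finally show ?thesis .
qed

lemma sub_gaussian_mean_aux:
  assumes a: "a \<in> carrier_vec l"
  shows "integrable M (\<lambda>\<omega>. a \<bullet> z \<omega>)" "(\<integral>\<omega>. a \<bullet> z \<omega> \<partial>M) = 0"
proof -
  note eq = integral_linear[OF measurable_scalar_prod_borel_vec[OF a], unfolded scalar_prod_root[OF a]]
  note m = product_coordinate_moments[OF mu, of _ l]
  have int: "integrable (PiM {..<l} (\<lambda>_. \<mu>)) (\<lambda>s. (S *\<^sub>v a) $ i * s i)" if "i < l" for i
    using m(1)[OF that that] by (intro integrable_mult_right)
  have "integrable (PiM {..<l} (\<lambda>_. \<mu>)) (\<lambda>s. \<Sum>i<l. (S *\<^sub>v a) $ i * s i)"
    using int by (intro Bochner_Integration.integrable_sum) (simp del: index_mult_mat_vec)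
  thus "integrable M (\<lambda>\<omega>. a \<bullet> z \<omega>)" using eq by blast
  have "(\<integral>s. (\<Sum>i<l. (S *\<^sub>v a) $ i * s i) \<partial>PiM {..<l} (\<lambda>_. \<mu>)) =
      (\<Sum>i<l. \<integral>s. (S *\<^sub>v a) $ i * s i \<partial>PiM {..<l} (\<lambda>_. \<mu>))"
    using int by (intro Bochner_Integration.integral_sum) (simp del: index_mult_mat_vec)
  also have "\<dots> = 0"
    using m(2) by (intro sum.neutral ballI) (simp del: index_mult_mat_vec)
  finally have "(\<integral>s. (\<Sum>i<l. (S *\<^sub>v a) $ i * s i) \<partial>PiM {..<l} (\<lambda>_. \<mu>)) = 0" .
  thus "(\<integral>\<omega>. a \<bullet> z \<omega> \<partial>M) = 0" using eq by simp
qed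

lemma sub_gaussian_covariance_aux:
  assumes a: "a \<in> carrier_vec l" and b: "b \<in> carrier_vec l"
  shows "integrable M (\<lambda>\<omega>. (a \<bullet> z \<omega>) * (b \<bullet> z \<omega>))" "(\<integral>\<omega>. (a \<bullet> z \<omega>) * (b \<bullet> z \<omega>) \<partial>M) = a \<bullet> (Sig *\<^sub>v b)"
proof -
  note m = product_coordinate_moments[OF mu, of _ l]
  define \<alpha> \<beta> where "\<alpha> i = (S *\<^sub>v a) $ i" and "\<beta> i = (S *\<^sub>v b) $ i" for i
  have prod: "(\<Sum>i<l. \<alpha> i * s i) * (\<Sum>i<l. \<beta> i * s i) = (\<Sum>i<l. \<Sum>j<l. \<alpha> i * \<beta> j * (s i * s j))" for s
    by (simp add: sum_product mult_ac)
  note eq' = integral_linear[OF borel_measurable_times[OF measurable_scalar_prod_borel_vec[OF a]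
      measurable_scalar_prod_borel_vec[OF b]], unfolded scalar_prod_root[OF a] scalar_prod_root[OF b],
      folded \<alpha>_def \<beta>_def, unfolded prod]
  have int: "integrable (PiM {..<l} (\<lambda>_. \<mu>)) (\<lambda>s. \<alpha> i * \<beta> j * (s i * s j))" if "i < l" "j < l" for i j
    using m(3)[OF that] by (intro integrable_mult_right)
  have int': "integrable (PiM {..<l} (\<lambda>_. \<mu>)) (\<lambda>s. \<Sum>j<l. \<alpha> i * \<beta> j * (s i * s j))" if "i \<in> {..<l}" for i
    using int that by (intro Bochner_Integration.integrable_sum) simp
  have "integrable (PiM {..<l} (\<lambda>_. \<mu>)) (\<lambda>s. \<Sum>i<l. \<Sum>j<l. \<alpha> i * \<beta> j * (s i * s j))"
    by (rule Bochner_Integration.integrable_sum[OF int'])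
  thus "integrable M (\<lambda>\<omega>. (a \<bullet> z \<omega>) * (b \<bullet> z \<omega>))" using eq' by blast
  have "(\<integral>s. (\<Sum>i<l. \<Sum>j<l. \<alpha> i * \<beta> j * (s i * s j)) \<partial>PiM {..<l} (\<lambda>_. \<mu>)) =
     (\<Sum>i<l. \<integral>s. (\<Sum>j<l. \<alpha> i * \<beta> j * (s i * s j)) \<partial>PiM {..<l} (\<lambda>_. \<mu>))"
    by (rule Bochner_Integration.integral_sum[OF int'])
  also have "\<dots> = (\<Sum>i<l. \<Sum>j<l. \<integral>s. \<alpha> i * \<beta> j * (s i * s j) \<partial>PiM {..<l} (\<lambda>_. \<mu>))"
    using int by (intro sum.cong refl Bochner_Integration.integral_sum) simp
  also have "\<dots> = (\<Sum>i<l. \<Sum>j<l. \<alpha> i * \<beta> j * (if i = j then 1 else 0))"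
    using m(4) by (intro sum.cong refl) simp
  also have "\<dots> = (\<Sum>i<l. \<alpha> i * \<beta> i)" by (simp add: if_distrib cong: if_cong)
  finally show "(\<integral>\<omega>. (a \<bullet> z \<omega>) * (b \<bullet> z \<omega>) \<partial>M) = a \<bullet> (Sig *\<^sub>v b)"
    using eq' sum_root_products[OF a b] unfolding \<alpha>_def \<beta>_def by simp
qed

end

text \<open>From here on the square root and the component law are hidden; only \<open>Sig\<close>
  and \<open>C\<close> remain visible.\<close>

lemma
  assumes z: "sub_gaussian_vec C M l Sig z" and a: "a \<in> carrier_vec l"
  shows sub_gaussian_vec_mgf: "(\<integral>\<^sup>+\<omega>. ennreal (exp (a \<bullet> z \<omega>)) \<partial>M) \<le> ennreal (exp (2 * C\<^sup>2 * (a \<bullet> (Sig *\<^sub>v a))))"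
    and sub_gaussian_vec_mean: "integrable M (\<lambda>\<omega>. a \<bullet> z \<omega>)" "(\<integral>\<omega>. a \<bullet> z \<omega> \<partial>M) = 0"
    and sub_gaussian_vec_covariance: "b \<in> carrier_vec l \<Longrightarrow> integrable M (\<lambda>\<omega>. (a \<bullet> z \<omega>) * (b \<bullet> z \<omega>))"
      "b \<in> carrier_vec l \<Longrightarrow> (\<integral>\<omega>. (a \<bullet> z \<omega>) * (b \<bullet> z \<omega>) \<partial>M) = a \<bullet> (Sig *\<^sub>v b)"
proof -
  from z obtain S \<mu> where *: "sym_pos_semidef l S" "S * S = Sig" "sub_gaussian_law C \<mu>" "z \<in> measurable M (borel_vec l)"
    "distr M (borel_vec l) z = distr (PiM {..<l} (\<lambda>_. \<mu>)) (borel_vec l) (\<lambda>s. S *\<^sub>v vec l s)"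
    unfolding sub_gaussian_vec_def by auto
  show "(\<integral>\<^sup>+\<omega>. ennreal (exp (a \<bullet> z \<omega>)) \<partial>M) \<le> ennreal (exp (2 * C\<^sup>2 * (a \<bullet> (Sig *\<^sub>v a))))"
    by (rule sub_gaussian_mgf_aux[OF * a])
  show "integrable M (\<lambda>\<omega>. a \<bullet> z \<omega>)" "(\<integral>\<omega>. a \<bullet> z \<omega> \<partial>M) = 0" by (rule sub_gaussian_mean_aux[OF * a])+
  show "integrable M (\<lambda>\<omega>. (a \<bullet> z \<omega>) * (b \<bullet> z \<omega>))" "(\<integral>\<omega>. (a \<bullet> z \<omega>) * (b \<bullet> z \<omega>) \<partial>M) = a \<bullet> (Sig *\<^sub>v b)"
    if "b \<in> carrier_vec l" by (rule sub_gaussian_covariance_aux[OF * a that])+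
qed

section \<open>Exponential moments and deviations of quadratic forms\<close>

context prob_space
begin

text \<open>A single term of the \<open>cosh\<close> series is at most \<open>cosh\<close>, which
  bounds the power by \<open>fact (2 * k) / s ^ (2 * k) * cosh (s * L \<omega>)\<close>. The rest is
  \<open>fact (2 * k) \<le> 4 ^ k * (fact k)\<^sup>2\<close> and
  \<open>fact k \<le> k ^ k\<close>.\<close>

lemma nn_integral_power_le_mgf:
  assumes [measurable]: "L \<in> borel_measurable M" and k: "\<kappa> > 0"
    and mgf: "\<And>s. (\<integral>\<^sup>+\<omega>. ennreal (exp (s * L \<omega>)) \<partial>M) \<le> ennreal (exp (\<kappa> * s\<^sup>2))"
  shows "(\<integral>\<^sup>+\<omega>. ennreal (L \<omega> ^ (2 * k)) \<partial>M) \<le> ennreal ((4 * exp 1 * \<kappa>) ^ k * fact k)"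
proof (cases "k = 0")
  case True
  thus ?thesis by (simp add: emeasure_space_1)
next
  case False
  \<comment> \<open>Minimizes \<open>exp (\<kappa> * s\<^sup>2) / s ^ (2 * k)\<close>; it would be
    zero for \<open>k = 0\<close>, hence the separate case.\<close>
  define s where "s = sqrt (k / \<kappa>)"
  have s2: "s\<^sup>2 = k / \<kappa>" and s0: "s > 0" using k False by (simp_all add: s_def)
  define A where "A = fact (2 * k) / s ^ (2 * k)"
  have A0: "A \<ge> 0" by (simp add: A_def s0 less_imp_le)
  have pt: "L \<omega> ^ (2 * k) \<le> A / 2 * exp (s * L \<omega>) + A / 2 * exp (- s * L \<omega>)" for \<omega>
  proof -
    have "(s * L \<omega>) ^ (2 * k) / fact (2 * k) \<le> cosh (s * L \<omega>)"
      using sums_cosh_even[of "s * L \<omega>"] 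
      by (metis (no_types, lifting) sums_iff sum_le_suminf[of _ "{k}"] finite.emptyI finite_insert
          sum.insert sum.empty empty_iff add.right_neutral zero_le_divide_iff zero_le_even_power
          even_mult_iff even_numeral fact_ge_zero)
    hence "A * ((s * L \<omega>) ^ (2 * k) / fact (2 * k)) \<le> A * cosh (s * L \<omega>)" by (rule mult_left_mono[OF _ A0])
    moreover have "A * ((s * L \<omega>) ^ (2 * k) / fact (2 * k)) = L \<omega> ^ (2 * k)"
      using s0 by (simp add: A_def power_mult_distrib)
    moreover have "A * cosh (s * L \<omega>) = A / 2 * exp (s * L \<omega>) + A / 2 * exp (- s * L \<omega>)"
      by (simp add: cosh_field_def field_simps)
    ultimately show ?thesis by simp
  qed
  have "(\<integral>\<^sup>+\<omega>. ennreal (L \<omega> ^ (2 * k)) \<partial>M)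
    \<le> (\<integral>\<^sup>+\<omega>. ennreal (A / 2) * ennreal (exp (s * L \<omega>)) + ennreal (A / 2) * ennreal (exp (- s * L \<omega>)) \<partial>M)"
    using pt A0 by (intro nn_integral_mono) (simp flip: ennreal_mult ennreal_plus)
  also have "\<dots> = ennreal (A / 2) * (\<integral>\<^sup>+\<omega>. ennreal (exp (s * L \<omega>)) \<partial>M) + ennreal (A / 2) * (\<integral>\<^sup>+\<omega>. ennreal (exp (- s * L \<omega>)) \<partial>M)"
    by (simp add: nn_integral_add nn_integral_cmult)
  also have "\<dots> \<le> ennreal (A / 2) * ennreal (exp (\<kappa> * s\<^sup>2)) + ennreal (A / 2) * ennreal (exp (\<kappa> * s\<^sup>2))"
    using mgf[of s] mgf[of "- s"] by (intro add_mono mult_left_mono) auto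
  also have "\<dots> = ennreal (A * exp (\<kappa> * s\<^sup>2))"
    using A0 by (simp flip: ennreal_mult ennreal_plus)
  also have "A * exp (\<kappa> * s\<^sup>2) \<le> (4 * exp 1 * \<kappa>) ^ k * fact k"
  proof -
    have "fact (2 * k) \<le> (4 ^ k * (fact k)\<^sup>2 :: real)"
    proof (induction k)
      case (Suc n)
      have "fact (2 * Suc n) = (2 * real n + 2) * (2 * real n + 1) * fact (2 * n)" by (simp add: algebra_simps)
      also have "\<dots> \<le> (2 * real n + 2) * (2 * real n + 2) * (4 ^ n * (fact n)\<^sup>2)"
        using Suc by (intro mult_mono) auto
      also have "\<dots> = 4 ^ Suc n * (fact (Suc n))\<^sup>2" by (simp add: power2_eq_square algebra_simps)
      finally show ?case .
    qed simp
    hence "A \<le> 4 ^ k * (fact k)\<^sup>2 / s ^ (2 * k)" unfolding A_def using s0 by (intro divide_right_mono) auto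
    also have "\<dots> = 4 ^ k * fact k * (fact k / real k ^ k) * \<kappa> ^ k"
      unfolding power_mult s2 using k False by (simp add: power_divide power2_eq_square)
    also have "\<dots> \<le> 4 ^ k * fact k * 1 * \<kappa> ^ k"
      using k False fact_le_power[of k, where ?'a = real] by (intro mult_mono) (auto simp: field_simps)
    finally have "A \<le> 4 ^ k * fact k * 1 * \<kappa> ^ k" .
    hence "A * exp (\<kappa> * s\<^sup>2) \<le> 4 ^ k * fact k * 1 * \<kappa> ^ k * exp (\<kappa> * s\<^sup>2)" by (rule mult_right_mono) simp
    also have ek: "exp (\<kappa> * s\<^sup>2) = exp 1 ^ k" unfolding s2 using k by (simp flip: exp_of_nat_mult)
    also have "4 ^ k * fact k * 1 * \<kappa> ^ k * exp 1 ^ k = (4 * exp 1 * \<kappa>) ^ k * fact k"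
      by (simp only: power_mult_distrib mult_ac mult_1_left)
    finally show ?thesis unfolding ek .
  qed
  finally show ?thesis by (simp add: ennreal_leI)
qed

text \<open>The factor \<open>fact k\<close> of the moment bound cancels that of the exponential
  series. What is left is geometric with ratio \<open>4 * exp 1 * \<kappa> * b \<le> 1 / 2\<close>,
  which explains both the threshold on \<open>b\<close> and the value 2.\<close>

lemma nn_integral_exp_square_le:
  assumes [measurable]: "L \<in> borel_measurable M" and k: "\<kappa> > 0"
    and mgf: "\<And>s. (\<integral>\<^sup>+\<omega>. ennreal (exp (s * L \<omega>)) \<partial>M) \<le> ennreal (exp (\<kappa> * s\<^sup>2))"
    and b: "b \<ge> 0" "8 * exp 1 * \<kappa> * b \<le> 1"
  shows "(\<integral>\<^sup>+\<omega>. ennreal (exp (b * (L \<omega>)\<^sup>2)) \<partial>M) \<le> 2"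
proof -
  have "(\<integral>\<^sup>+\<omega>. ennreal (exp (b * (L \<omega>)\<^sup>2)) \<partial>M) = (\<integral>\<^sup>+\<omega>. (\<Sum>k. ennreal ((b * (L \<omega>)\<^sup>2) ^ k /\<^sub>R fact k)) \<partial>M)"
    using b by (intro nn_integral_cong suminf_ennreal_eq[symmetric] exp_converges) auto
  also have "\<dots> = (\<Sum>k. \<integral>\<^sup>+\<omega>. ennreal ((b * (L \<omega>)\<^sup>2) ^ k /\<^sub>R fact k) \<partial>M)"
    by (intro nn_integral_suminf) auto
  also have "\<dots> \<le> (\<Sum>k. ennreal ((1 / 2) ^ k))"
  proof (intro suminf_le)
    fix k
    have "(\<integral>\<^sup>+\<omega>. ennreal ((b * (L \<omega>)\<^sup>2) ^ k /\<^sub>R fact k) \<partial>M) = (\<integral>\<^sup>+\<omega>. ennreal (b ^ k / fact k) * ennreal (L \<omega> ^ (2 * k)) \<partial>M)"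
      using b by (intro nn_integral_cong, subst ennreal_mult[symmetric])
        (auto simp: power_mult_distrib divide_inverse mult_ac intro!: zero_le_even_power simp flip: power_mult)
    also have "\<dots> = ennreal (b ^ k / fact k) * (\<integral>\<^sup>+\<omega>. ennreal (L \<omega> ^ (2 * k)) \<partial>M)" by (intro nn_integral_cmult) auto
    also have "\<dots> \<le> ennreal (b ^ k / fact k) * ennreal ((4 * exp 1 * \<kappa>) ^ k * fact k)"
      by (intro mult_left_mono nn_integral_power_le_mgf k mgf) auto
    also have "\<dots> = ennreal ((4 * exp 1 * \<kappa> * b) ^ k)"
      using b k by (simp add: power_mult_distrib mult_ac flip: ennreal_mult)
    also have "\<dots> \<le> ennreal ((1 / 2) ^ k)" using b k by (intro ennreal_leI power_mono) auto
    finally show "(\<integral>\<^sup>+\<omega>. ennreal ((b * (L \<omega>)\<^sup>2) ^ k /\<^sub>R fact k) \<partial>M) \<le> ennreal ((1 / 2) ^ k)" .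
  qed auto
  also have "\<dots> = ennreal 2" using geometric_sums[of "1 / 2 :: real"] by (intro suminf_ennreal_eq) auto
  finally show ?thesis by simp
qed

text \<open>Jensen's inequality with weights proportional to the variance proxies makes the bound
  independent of the number of squares.\<close>
lemma nn_integral_exp_sum_squares_le:
  fixes d :: nat
  assumes L: "\<And>m. m < d \<Longrightarrow> L m \<in> borel_measurable M"
    and pos: "\<And>m. m < d \<Longrightarrow> \<kappa> m > 0"
    and mgf: "\<And>m s. m < d \<Longrightarrow> (\<integral>\<^sup>+\<omega>. ennreal (exp (s * L m \<omega>)) \<partial>M) \<le> ennreal (exp (\<kappa> m * s\<^sup>2))"
    and b: "b \<ge> 0" "8 * exp 1 * (\<Sum>m<d. \<kappa> m) * b \<le> 1"
  shows "(\<integral>\<^sup>+\<omega>. ennreal (exp (b * (\<Sum>m<d. (L m \<omega>)\<^sup>2))) \<partial>M) \<le> 2"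
proof (cases "d = 0")
  case True
  thus ?thesis by (simp add: emeasure_space_1 one_le_numeral)
next
  case False
  define K where "K = (\<Sum>m<d. \<kappa> m)"
  have K: "K > 0" unfolding K_def using False pos by (intro sum_pos) auto
  define p where "p m = \<kappa> m / K" for m
  have p: "p m > 0" if "m < d" for m using pos[OF that] K by (simp add: p_def)
  have p1: "(\<Sum>m<d. p m) = 1" using K by (simp add: p_def K_def flip: sum_divide_distrib)
  note [measurable] = L
  have "exp (b * (\<Sum>m<d. (L m \<omega>)\<^sup>2)) \<le> (\<Sum>m<d. p m * exp (b / p m * (L m \<omega>)\<^sup>2))" for \<omega>
  proof -
    have "b * (\<Sum>m<d. (L m \<omega>)\<^sup>2) = (\<Sum>m<d. p m *\<^sub>R (b / p m * (L m \<omega>)\<^sup>2))"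
      unfolding sum_distrib_left using p by (intro sum.cong) force+
    also have "exp \<dots> \<le> (\<Sum>m<d. p m * exp (b / p m * (L m \<omega>)\<^sup>2))"
      using False p1 p convex_on_exp[of 1] by (intro convex_on_sum[of _ UNIV]) (auto simp: less_imp_le)
    finally show ?thesis .
  qed
  hence "(\<integral>\<^sup>+\<omega>. ennreal (exp (b * (\<Sum>m<d. (L m \<omega>)\<^sup>2))) \<partial>M) \<le> (\<integral>\<^sup>+\<omega>. ennreal (\<Sum>m<d. p m * exp (b / p m * (L m \<omega>)\<^sup>2)) \<partial>M)"
    by (intro nn_integral_mono ennreal_leI)
  also have "\<dots> = (\<integral>\<^sup>+\<omega>. (\<Sum>m<d. ennreal (p m) * ennreal (exp (b / p m * (L m \<omega>)\<^sup>2))) \<partial>M)"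
    using p by (intro nn_integral_cong, subst sum_ennreal[symmetric]) (auto simp: less_imp_le ennreal_mult')
  also have "\<dots> = (\<Sum>m<d. \<integral>\<^sup>+\<omega>. ennreal (p m) * ennreal (exp (b / p m * (L m \<omega>)\<^sup>2)) \<partial>M)"
    by (intro nn_integral_sum) auto
  also have "\<dots> \<le> (\<Sum>m<d. ennreal (p m) * 2)"
  proof (intro sum_mono)
    fix m assume m: "m \<in> {..<d}"
    have "(\<integral>\<^sup>+\<omega>. ennreal (p m) * ennreal (exp (b / p m * (L m \<omega>)\<^sup>2)) \<partial>M) = ennreal (p m) * (\<integral>\<^sup>+\<omega>. ennreal (exp (b / p m * (L m \<omega>)\<^sup>2)) \<partial>M)"
      using m by (intro nn_integral_cmult) auto
    \<comment> \<open>Since \<open>b / p m * \<kappa> m = b * K\<close>, all summands meet the same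
      threshold.\<close>
    also have "\<dots> \<le> ennreal (p m) * 2"
      using m L pos mgf b p[of m] pos[of m] K
      by (intro mult_left_mono nn_integral_exp_square_le[where \<kappa> = "\<kappa> m"]) (auto simp: p_def K_def[symmetric] field_simps)
    finally show "(\<integral>\<^sup>+\<omega>. ennreal (p m) * ennreal (exp (b / p m * (L m \<omega>)\<^sup>2)) \<partial>M) \<le> ennreal (p m) * 2" .
  qed
  also have "\<dots> = ennreal (\<Sum>m<d. p m) * 2" using p by (subst sum_ennreal[symmetric]) (auto simp: less_imp_le sum_distrib_right)
  finally show ?thesis by (simp add: p1)
qed

text \<open>\<open>X\<close> and \<open>Y\<close> will be squared norms computed from the same data,
  so the exponential does not factor; convexity of \<open>exp\<close> separates them
  instead.\<close>

lemma nn_integral_exp_bilinear_le: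
  assumes [measurable]: "X \<in> borel_measurable M" "Y \<in> borel_measurable M"
    and X: "(\<integral>\<^sup>+\<omega>. ennreal (exp (b * X \<omega>)) \<partial>M) \<le> 2" and Y: "(\<integral>\<^sup>+\<omega>. ennreal (exp (b * Y \<omega>)) \<partial>M) \<le> 2"
    and b: "b \<ge> 0" and Z: "\<And>\<omega>. \<bar>Z \<omega>\<bar> \<le> (X \<omega> + Y \<omega>) / 2"
  shows "(\<integral>\<^sup>+\<omega>. ennreal (exp (b * \<bar>Z \<omega>\<bar>)) \<partial>M) \<le> 2"
proof -
  have "exp (b * \<bar>Z \<omega>\<bar>) \<le> 1 / 2 * exp (b * X \<omega>) + 1 / 2 * exp (b * Y \<omega>)" for \<omega>
  proof -
    have "exp (b * \<bar>Z \<omega>\<bar>) \<le> exp (b * ((X \<omega> + Y \<omega>) / 2))" using mult_left_mono[OF Z b] by simp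
    also have "\<dots> = exp ((1 - 1 / 2) *\<^sub>R (b * X \<omega>) + (1 / 2) *\<^sub>R (b * Y \<omega>))" by (simp add: field_simps)
    also have "\<dots> \<le> (1 - 1 / 2) * exp (b * X \<omega>) + 1 / 2 * exp (b * Y \<omega>)"
      using convex_onD[of UNIV "\<lambda>x. exp (1 * x)" "1 / 2" "b * X \<omega>" "b * Y \<omega>"] convex_on_exp[of 1] by simp
    finally show ?thesis by simp
  qed
  note pt = this
  define h :: real where "h = 1 / 2"
  have h: "h > 0" "h * 2 + h * 2 = 2" by (simp_all add: h_def)
  have "exp (b * \<bar>Z \<omega>\<bar>) \<le> h * exp (b * X \<omega>) + h * exp (b * Y \<omega>)" for \<omega> using pt[of \<omega>] by (simp add: h_def)
  hence "(\<integral>\<^sup>+\<omega>. ennreal (exp (b * \<bar>Z \<omega>\<bar>)) \<partial>M) \<le> (\<integral>\<^sup>+\<omega>. ennreal h * ennreal (exp (b * X \<omega>)) + ennreal h * ennreal (exp (b * Y \<omega>)) \<partial>M)"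
    by (intro nn_integral_mono) (simp add: h less_imp_le flip: ennreal_mult ennreal_plus)
  also have "\<dots> = ennreal h * (\<integral>\<^sup>+\<omega>. ennreal (exp (b * X \<omega>)) \<partial>M) + ennreal h * (\<integral>\<^sup>+\<omega>. ennreal (exp (b * Y \<omega>)) \<partial>M)"
    by (simp add: nn_integral_add nn_integral_cmult)
  also have "\<dots> \<le> ennreal h * 2 + ennreal h * 2" using X Y by (intro add_mono mult_left_mono) auto
  also have "\<dots> = ennreal (h * 2 + h * 2)"
    using h(1) by (simp only: ennreal_plus ennreal_mult ennreal_numeral less_imp_le mult_nonneg_nonneg zero_le_numeral)
  also have "\<dots> = 2" unfolding h by simp
  finally show ?thesis .
qed

end

section \<open>Bernstein's inequality\<close>

lemma exp_le_quadratic: "exp x \<le> 1 + x + x\<^sup>2 / 2 * exp \<bar>x\<bar>" for x :: real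
proof -
  obtain t where t: "\<bar>t\<bar> \<le> \<bar>x\<bar>" "exp x = (\<Sum>m<2. x ^ m / fact m) + exp t / fact 2 * x\<^sup>2"
    using Maclaurin_exp_le[of x 2] by auto
  have "exp t * x\<^sup>2 \<le> exp \<bar>x\<bar> * x\<^sup>2" using t(1) by (intro mult_right_mono) auto
  thus ?thesis using t(2) by (simp add: numeral_2_eq_2 mult.commute)
qed

context prob_space
begin

text \<open>The exponential moment condition says that the Orlicz norm of \<open>Z\<close> for
  \<open>exp x - 1\<close> is at most \<open>1 / \<theta>\<close>; sub-exponential tails are carried
  in this form throughout.\<close>

lemma sub_exponential_integrable:
  assumes [measurable]: "Z \<in> borel_measurable M" and \<theta>: "\<theta> > 0"
    and Z: "(\<integral>\<^sup>+\<omega>. ennreal (exp (\<theta> * \<bar>Z \<omega>\<bar>)) \<partial>M) \<le> 2"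
  shows "integrable M (\<lambda>\<omega>. exp (\<theta> * \<bar>Z \<omega>\<bar>))" "(\<integral>\<omega>. exp (\<theta> * \<bar>Z \<omega>\<bar>) \<partial>M) \<le> 2" "integrable M Z"
proof -
  have fin: "(\<integral>\<^sup>+\<omega>. ennreal (exp (\<theta> * \<bar>Z \<omega>\<bar>)) \<partial>M) < \<infinity>" using Z by (rule order.strict_trans1) simp
  show int: "integrable M (\<lambda>\<omega>. exp (\<theta> * \<bar>Z \<omega>\<bar>))" using fin by (intro integrableI_bounded) auto
  have "ennreal (\<integral>\<omega>. exp (\<theta> * \<bar>Z \<omega>\<bar>) \<partial>M) \<le> ennreal 2"
    using Z by (subst nn_integral_eq_integral[OF int, symmetric]) auto
  thus "(\<integral>\<omega>. exp (\<theta> * \<bar>Z \<omega>\<bar>) \<partial>M) \<le> 2" by (subst (asm) ennreal_le_iff) auto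
  have "integrable M (\<lambda>\<omega>. exp (\<theta> * \<bar>Z \<omega>\<bar>) / \<theta>)" using int by simp
  thus "integrable M Z"
  proof (rule Bochner_Integration.integrable_bound)
    have "\<bar>z\<bar> \<le> exp (\<theta> * \<bar>z\<bar>) / \<theta>" for z
    proof -
      have "\<theta> * \<bar>z\<bar> \<le> exp (\<theta> * \<bar>z\<bar>)" using exp_ge_add_one_self[of "\<theta> * \<bar>z\<bar>"] by linarith
      thus ?thesis using \<theta> by (simp add: field_simps)
    qed
    thus "AE \<omega> in M. norm (Z \<omega>) \<le> norm (exp (\<theta> * \<bar>Z \<omega>\<bar>) / \<theta>)" using \<theta> by simp
  qed simp
qed

text \<open>In the quadratic Taylor remainder, \<open>exp \<bar>s * z\<bar>\<close> uses at most
  half of the exponent \<open>\<theta> * \<bar>z\<bar>\<close>, and the other half absorbs the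
  square of \<open>z\<close>. Taking expectations leaves
  \<open>1 + s * expectation Z + 8 * s\<^sup>2 / \<theta>\<^sup>2\<close>, and centering removes the
  linear term.\<close>

lemma sub_exponential_centered_mgf:
  assumes Zm[measurable]: "Z \<in> borel_measurable M" and \<theta>: "\<theta> > 0"
    and Z: "(\<integral>\<^sup>+\<omega>. ennreal (exp (\<theta> * \<bar>Z \<omega>\<bar>)) \<partial>M) \<le> 2" and s: "\<bar>s\<bar> \<le> \<theta> / 2"
  shows "(\<integral>\<^sup>+\<omega>. ennreal (exp (s * (Z \<omega> - expectation Z))) \<partial>M) \<le> ennreal (exp (8 * s\<^sup>2 / \<theta>\<^sup>2))"
proof -
  note I = sub_exponential_integrable[OF Zm \<theta> Z]
  have pt: "exp (s * z) \<le> 1 + s * z + 4 * s\<^sup>2 / \<theta>\<^sup>2 * exp (\<theta> * \<bar>z\<bar>)" for z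
  proof -
    define Y where "Y = \<theta> * \<bar>z\<bar>"
    have Y0: "Y \<ge> 0" using \<theta> by (simp add: Y_def)
    have sz: "\<bar>s * z\<bar> \<le> Y / 2" using mult_right_mono[OF s, of "\<bar>z\<bar>"] by (simp add: Y_def abs_mult)
    have "Y / 2 * (Y / 2) \<le> 2 * exp (Y / 2)"
      using exp_lower_Taylor_quadratic[of "Y / 2"] Y0 by (simp add: power2_eq_square)
    hence Y2: "Y\<^sup>2 \<le> 8 * exp (Y / 2)" by (simp add: power2_eq_square)
    have "exp (s * z) \<le> 1 + s * z + (s * z)\<^sup>2 / 2 * exp \<bar>s * z\<bar>" by (rule exp_le_quadratic)
    also have "(s * z)\<^sup>2 / 2 * exp \<bar>s * z\<bar> \<le> (s * z)\<^sup>2 / 2 * exp (Y / 2)"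
      using sz by (intro mult_left_mono) auto
    also have "\<dots> = s\<^sup>2 / (2 * \<theta>\<^sup>2) * Y\<^sup>2 * exp (Y / 2)"
      using \<theta> by (simp add: Y_def power_mult_distrib)
    also have "\<dots> \<le> s\<^sup>2 / (2 * \<theta>\<^sup>2) * (8 * exp (Y / 2)) * exp (Y / 2)"
      using Y2 by (intro mult_right_mono mult_left_mono) auto
    also have "\<dots> = 4 * s\<^sup>2 / \<theta>\<^sup>2 * (exp (Y / 2) * exp (Y / 2))" by simp
    also have "exp (Y / 2) * exp (Y / 2) = exp Y" by (simp flip: exp_add)
    finally show ?thesis by (simp add: Y_def)
  qed
  have int: "integrable M (\<lambda>\<omega>. 1 + s * Z \<omega> + 4 * s\<^sup>2 / \<theta>\<^sup>2 * exp (\<theta> * \<bar>Z \<omega>\<bar>))"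
    using I by (intro Bochner_Integration.integrable_add integrable_mult_right) auto
  have nn: "0 \<le> 1 + s * z + 4 * s\<^sup>2 / \<theta>\<^sup>2 * exp (\<theta> * \<bar>z\<bar>)" for z
    using pt[of z] exp_ge_zero[of "s * z"] by linarith
  have "(\<integral>\<^sup>+\<omega>. ennreal (exp (s * Z \<omega>)) \<partial>M) \<le> (\<integral>\<^sup>+\<omega>. ennreal (1 + s * Z \<omega> + 4 * s\<^sup>2 / \<theta>\<^sup>2 * exp (\<theta> * \<bar>Z \<omega>\<bar>)) \<partial>M)"
    using pt by (intro nn_integral_mono ennreal_leI)
  also have "\<dots> = ennreal (\<integral>\<omega>. 1 + s * Z \<omega> + 4 * s\<^sup>2 / \<theta>\<^sup>2 * exp (\<theta> * \<bar>Z \<omega>\<bar>) \<partial>M)"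
    using nn by (intro nn_integral_eq_integral int) auto
  also have "(\<integral>\<omega>. 1 + s * Z \<omega> + 4 * s\<^sup>2 / \<theta>\<^sup>2 * exp (\<theta> * \<bar>Z \<omega>\<bar>) \<partial>M)
      = 1 + s * expectation Z + 4 * s\<^sup>2 / \<theta>\<^sup>2 * (\<integral>\<omega>. exp (\<theta> * \<bar>Z \<omega>\<bar>) \<partial>M)"
    using I by (simp add: prob_space)
  also have "\<dots> \<le> 1 + s * expectation Z + 4 * s\<^sup>2 / \<theta>\<^sup>2 * 2"
    using I(2) by (intro add_left_mono mult_left_mono) auto
  also have "\<dots> = 1 + (s * expectation Z + 8 * s\<^sup>2 / \<theta>\<^sup>2)" by simp
  also have "\<dots> \<le> exp (s * expectation Z + 8 * s\<^sup>2 / \<theta>\<^sup>2)"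
    by (rule exp_ge_add_one_self)
  finally have le: "(\<integral>\<^sup>+\<omega>. ennreal (exp (s * Z \<omega>)) \<partial>M) \<le> ennreal (exp (s * expectation Z + 8 * s\<^sup>2 / \<theta>\<^sup>2))"
    by (simp add: ennreal_leI)
  have "(\<integral>\<^sup>+\<omega>. ennreal (exp (s * (Z \<omega> - expectation Z))) \<partial>M)
    = (\<integral>\<^sup>+\<omega>. ennreal (exp (- s * expectation Z)) * ennreal (exp (s * Z \<omega>)) \<partial>M)"
    by (intro nn_integral_cong) (simp add: algebra_simps flip: ennreal_mult exp_add)
  also have "\<dots> = ennreal (exp (- s * expectation Z)) * (\<integral>\<^sup>+\<omega>. ennreal (exp (s * Z \<omega>)) \<partial>M)"
    by (intro nn_integral_cmult) auto
  also have "\<dots> \<le> ennreal (exp (- s * expectation Z)) * ennreal (exp (s * expectation Z + 8 * s\<^sup>2 / \<theta>\<^sup>2))"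
    using le by (intro mult_left_mono) auto
  also have "\<dots> = ennreal (exp (8 * s\<^sup>2 / \<theta>\<^sup>2))" by (simp flip: ennreal_mult exp_add)
  finally show ?thesis .
qed

text \<open>The common law is represented by \<open>Z\<close>, because the pair defining the risk is
  only equal in law to the samples, with no joint law prescribed.\<close>

definition iid_copies :: "nat \<Rightarrow> (nat \<Rightarrow> 'a \<Rightarrow> real) \<Rightarrow> ('a \<Rightarrow> real) \<Rightarrow> bool" where
  "iid_copies n X Z \<longleftrightarrow> Z \<in> borel_measurable M \<and> indep_vars (\<lambda>_. borel) X {1..n} \<and>
     (\<forall>i\<in>{1..n}. distr M borel (X i) = distr M borel Z)"

lemma iid_copies_uminus:
  assumes "iid_copies n X Z" shows "iid_copies n (\<lambda>i \<omega>. - X i \<omega>) (\<lambda>\<omega>. - Z \<omega>)"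
proof -
  have Z: "Z \<in> borel_measurable M" and ind: "indep_vars (\<lambda>_. borel) X {1..n}"
    and eq: "\<And>i. i \<in> {1..n} \<Longrightarrow> distr M borel (X i) = distr M borel Z"
    using assms by (auto simp: iid_copies_def)
  have X: "X i \<in> borel_measurable M" if "i \<in> {1..n}" for i using ind that by (auto simp: indep_vars_def)
  have "distr M borel (\<lambda>\<omega>. - X i \<omega>) = distr M borel (\<lambda>\<omega>. - Z \<omega>)" if i: "i \<in> {1..n}" for i
    using distr_distr[of uminus borel borel "X i" M] distr_distr[of uminus borel borel Z M] X[OF i] Z eq[OF i]
    by (simp add: comp_def)
  moreover have "indep_vars (\<lambda>_. borel) (\<lambda>i \<omega>. - X i \<omega>) {1..n}"
    by (rule indep_vars_compose2[OF ind]) simp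
  ultimately show ?thesis using Z by (simp add: iid_copies_def)
qed

lemma iid_copies_upper_tail:
  assumes iid: "iid_copies n X Z" and n: "n \<ge> 1" and \<theta>: "\<theta> > 0"
    and Z: "(\<integral>\<^sup>+\<omega>. ennreal (exp (\<theta> * \<bar>Z \<omega>\<bar>)) \<partial>M) \<le> 2" and x: "x > 0"
  shows "prob {\<omega> \<in> space M. (\<Sum>i=1..n. X i \<omega>) / n - expectation Z \<ge> x}
    \<le> exp (- real n * min (\<theta>\<^sup>2 * x\<^sup>2 / 32) (\<theta> * x / 4))"
proof -
  define m where "m = expectation Z"
  have Zm[measurable]: "Z \<in> borel_measurable M" and ind: "indep_vars (\<lambda>_. borel) X {1..n}"
    and eq: "\<And>i. i \<in> {1..n} \<Longrightarrow> distr M borel (X i) = distr M borel Z"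
    using iid by (auto simp: iid_copies_def)
  have X[measurable]: "X i \<in> borel_measurable M" if "i \<in> {1..n}" for i using ind that by (auto simp: indep_vars_def)
  \<comment> \<open>Maximizes \<open>s * x - 8 * s\<^sup>2 / \<theta>\<^sup>2\<close> under
    \<open>s \<le> \<theta> / 2\<close>; the two branches become the Gaussian and the exponential
    regime.\<close>
  define s where "s = min (\<theta>\<^sup>2 * x / 16) (\<theta> / 2)"
  have s: "s > 0" "\<bar>s\<bar> \<le> \<theta> / 2" using \<theta> x by (auto simp: s_def)
  have ex: "(\<integral>\<^sup>+\<omega>. ennreal (exp (s * (X i \<omega> - m))) \<partial>M) \<le> ennreal (exp (8 * s\<^sup>2 / \<theta>\<^sup>2))" if i: "i \<in> {1..n}" for i
  proof -
    have "(\<integral>\<^sup>+\<omega>. ennreal (exp (s * (X i \<omega> - m))) \<partial>M) = (\<integral>\<^sup>+z. ennreal (exp (s * (z - m))) \<partial>distr M borel (X i))"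
      by (subst nn_integral_distr) (use X[OF i] in auto)
    also have "\<dots> = (\<integral>\<^sup>+\<omega>. ennreal (exp (s * (Z \<omega> - m))) \<partial>M)"
      unfolding eq[OF i] by (subst nn_integral_distr) auto
    also have "\<dots> \<le> ennreal (exp (8 * s\<^sup>2 / \<theta>\<^sup>2))"
      unfolding m_def by (rule sub_exponential_centered_mgf[OF Zm \<theta> Z s(2)])
    finally show ?thesis .
  qed
  define W where "W \<omega> = (\<Sum>i=1..n. X i \<omega> - m)" for \<omega>
  have W[measurable]: "W \<in> borel_measurable M" unfolding W_def[abs_def] by measurable
  have "{\<omega> \<in> space M. (\<Sum>i=1..n. X i \<omega>) / n - m \<ge> x} = {\<omega> \<in> space M. W \<omega> \<ge> real n * x}"
    using n by (auto simp: W_def sum_subtractf field_simps)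
  hence "ennreal (prob {\<omega> \<in> space M. (\<Sum>i=1..n. X i \<omega>) / n - m \<ge> x}) = emeasure M {\<omega> \<in> space M. W \<omega> \<ge> real n * x}"
    by (simp add: emeasure_eq_measure)
  also have "\<dots> \<le> ennreal (exp (- s * (real n * x))) * (\<integral>\<^sup>+\<omega>\<in>space M. ennreal (exp (s * W \<omega>)) \<partial>M)"
    by (intro Chernoff_ineq_nn_integral_ge s) auto
  also have "(\<integral>\<^sup>+\<omega>\<in>space M. ennreal (exp (s * W \<omega>)) \<partial>M) = (\<integral>\<^sup>+\<omega>. (\<Prod>i\<in>{1..n}. ennreal (exp (s * (X i \<omega> - m)))) \<partial>M)"
    by (intro nn_integral_cong) (simp add: W_def sum_distrib_left exp_sum prod_ennreal)
  also have "\<dots> = (\<Prod>i\<in>{1..n}. \<integral>\<^sup>+\<omega>. ennreal (exp (s * (X i \<omega> - m))) \<partial>M)"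
    by (intro indep_vars_nn_integral indep_vars_compose2[OF ind]) auto
  also have "ennreal (exp (- s * (real n * x))) * \<dots> \<le> ennreal (exp (- s * (real n * x))) * (\<Prod>i\<in>{1..n}. ennreal (exp (8 * s\<^sup>2 / \<theta>\<^sup>2)))"
    by (intro mult_left_mono prod_mono_ennreal ex) auto
  also have "\<dots> = ennreal (exp (- real n * (s * x - 8 * s\<^sup>2 / \<theta>\<^sup>2)))"
    by (simp add: ennreal_power algebra_simps flip: ennreal_mult exp_add exp_of_nat_mult)
  also have "\<dots> \<le> ennreal (exp (- real n * min (\<theta>\<^sup>2 * x\<^sup>2 / 32) (\<theta> * x / 4)))"
  proof -
    have "min (\<theta>\<^sup>2 * x\<^sup>2 / 32) (\<theta> * x / 4) \<le> s * x - 8 * s\<^sup>2 / \<theta>\<^sup>2"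
    proof (cases "\<theta> * x \<le> 8")
      case True
      hence "\<theta> * (\<theta> * x) \<le> \<theta> * 8" using \<theta> by (intro mult_left_mono) auto
      hence s: "s = \<theta>\<^sup>2 * x / 16" unfolding s_def by (simp add: power2_eq_square)
      have "s * x - 8 * s\<^sup>2 / \<theta>\<^sup>2 = \<theta>\<^sup>2 * x\<^sup>2 / 32"
        unfolding s using \<theta> by (simp add: field_simps power2_eq_square)
      thus ?thesis by simp
    next
      case False
      hence "\<theta> * (\<theta> * x) \<ge> \<theta> * 8" using \<theta> by (intro mult_left_mono) auto
      hence s: "s = \<theta> / 2" unfolding s_def by (simp add: power2_eq_square)
      have "s * x - 8 * s\<^sup>2 / \<theta>\<^sup>2 = \<theta> * x / 2 - 2"
        unfolding s using \<theta> by (simp add: field_simps power2_eq_square)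
      \<comment> \<open>Here \<open>\<theta> * x > 8\<close>, so the subtracted 2 is at most
        \<open>\<theta> * x / 4\<close>.\<close>
      thus ?thesis using False by simp
    qed
    thus ?thesis by (intro ennreal_leI) (simp add: mult_left_mono)
  qed
  finally show ?thesis by (simp add: m_def)
qed

lemma iid_copies_tail:
  assumes iid: "iid_copies n X Z" and n: "n \<ge> 1" and \<theta>: "\<theta> > 0"
    and Z: "(\<integral>\<^sup>+\<omega>. ennreal (exp (\<theta> * \<bar>Z \<omega>\<bar>)) \<partial>M) \<le> 2" and x: "x > 0"
  shows "prob {\<omega> \<in> space M. \<bar>(\<Sum>i=1..n. X i \<omega>) / n - expectation Z\<bar> \<ge> x}
    \<le> 2 * exp (- real n * min (\<theta>\<^sup>2 * x\<^sup>2 / 32) (\<theta> * x / 4))"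
proof -
  have [measurable]: "X i \<in> borel_measurable M" if "i \<in> {1..n}" for i
    using iid that by (auto simp: iid_copies_def indep_vars_def)
  let ?A = "{\<omega> \<in> space M. (\<Sum>i=1..n. X i \<omega>) / n - expectation Z \<ge> x}"
  let ?B = "{\<omega> \<in> space M. (\<Sum>i=1..n. - X i \<omega>) / n - expectation (\<lambda>\<omega>. - Z \<omega>) \<ge> x}"
  have "prob {\<omega> \<in> space M. \<bar>(\<Sum>i=1..n. X i \<omega>) / n - expectation Z\<bar> \<ge> x} \<le> prob (?A \<union> ?B)"
    by (intro finite_measure_mono) (auto simp: sum_negf abs_if split: if_splits)
  also have "\<dots> \<le> prob ?A + prob ?B" by (intro measure_Un_le) auto
  also have "\<dots> \<le> exp (- real n * min (\<theta>\<^sup>2 * x\<^sup>2 / 32) (\<theta> * x / 4)) + exp (- real n * min (\<theta>\<^sup>2 * x\<^sup>2 / 32) (\<theta> * x / 4))"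
    by (intro add_mono iid_copies_upper_tail[OF iid n \<theta> Z x] iid_copies_upper_tail[OF iid_copies_uminus[OF iid] n \<theta> _ x])
       (use Z in simp)
  finally show ?thesis by simp
qed

end

section \<open>Bounds uniform in the regularization parameter\<close>

text \<open>Value of the double series when coefficient \<open>(i, j)\<close> is at most
  \<open>(i + 1) * (j + 1)\<close>; the squared resolvent contributes a further
  \<open>i + 1\<close>, hence the asymmetry.\<close>

definition resolvent_series_const :: "real \<Rightarrow> real" where
  "resolvent_series_const r = (\<Sum>i. (real (Suc i))\<^sup>2 * r ^ i) * (\<Sum>j. real (Suc j) * r ^ j)"

lemma summable_Suc_power: 
  assumes "\<bar>r\<bar> < 1" shows "summable (\<lambda>j. real (Suc j) * r ^ j)"
  using geometric_deriv_sums[of r] assms by (simp add: sums_iff)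

text \<open>Termwise derivative of the series of \<open>n * x ^ n\<close>.\<close>

lemma summable_Suc_sq_power: 
  assumes "\<bar>r\<bar> < 1" shows "summable (\<lambda>j. (real (Suc j))\<^sup>2 * r ^ j)"
proof -
  have "summable (\<lambda>n. real n * x ^ n)" if "norm x < 1" for x :: real
  proof -
    have "summable (\<lambda>n. real (Suc n) * x ^ n - x ^ n)"
      using that by (intro summable_diff summable_Suc_power summable_geometric) auto
    thus ?thesis by (simp add: algebra_simps)
  qed
  from termdiff_converges[of r 1 real, OF _ this] assms
  have "summable (\<lambda>n. diffs real n * r ^ n)" by simp
  thus ?thesis by (simp add: diffs_def power2_eq_square algebra_simps)
qed

lemma resolvent_series_const_pos:
  assumes "0 \<le> r" "r < 1" shows "resolvent_series_const r > 0"
proof -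
  have "(\<Sum>i. (real (Suc i))\<^sup>2 * r ^ i) \<ge> (\<Sum>i\<in>{0}. (real (Suc i))\<^sup>2 * r ^ i)"
    using assms by (intro sum_le_suminf summable_Suc_sq_power) auto
  moreover have "(\<Sum>i. real (Suc i) * r ^ i) \<ge> (\<Sum>i\<in>{0}. real (Suc i) * r ^ i)"
    using assms by (intro sum_le_suminf summable_Suc_power) auto
  ultimately show ?thesis unfolding resolvent_series_const_def by (intro mult_pos_pos) auto
qed

text \<open>Expanding both resolvent factors into power series in \<open>t\<close> reduces a bound uniform in \<open>t\<close> to
  countably many \<open>t\<close>-free bilinear forms.\<close>
lemma resolvent_series_bound:
  fixes G a b :: "nat \<Rightarrow> nat \<Rightarrow> real" and s :: "nat \<Rightarrow> real" and d :: nat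
  assumes s: "\<And>k. k < d \<Longrightarrow> 0 \<le> s k \<and> s k \<le> 1" and t: "0 \<le> t" "t \<le> r" and r: "r < 1" and x: "x \<ge> 0"
    and le: "\<And>i j. \<bar>\<Sum>k<d. \<Sum>l<d. G k l * (s k ^ (i + 2) * (s l ^ (j + 1) * a k l - (if j = 0 then b k l else 0)))\<bar>
       \<le> x * (real (Suc i) * real (Suc j))"
  shows "\<bar>\<Sum>k<d. \<Sum>l<d. G k l * ((s k / (1 - t * s k))\<^sup>2 * (s l / (1 - t * s l) * a k l - b k l))\<bar> \<le> x * resolvent_series_const r"
proof -
  define S1 where "S1 = (\<Sum>j. real (Suc j) * r ^ j)"
  define S2 where "S2 = (\<Sum>i. (real (Suc i))\<^sup>2 * r ^ i)"
  have r0: "0 \<le> r" using t by simp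
  have S1: "(\<lambda>j. real (Suc j) * r ^ j) sums S1" unfolding S1_def using r r0 by (intro summable_sums summable_Suc_power) auto
  have S2: "(\<lambda>i. (real (Suc i))\<^sup>2 * r ^ i) sums S2" unfolding S2_def using r r0 by (intro summable_sums summable_Suc_sq_power) auto
  have ts: "\<bar>t * s k\<bar> < 1" "1 - t * s k \<noteq> 0" if "k < d" for k
  proof -
    have "t * s k \<le> r * 1" using s[OF that] t by (intro mult_mono) auto
    moreover have "t * s k \<ge> 0" using s[OF that] t by simp
    ultimately show "\<bar>t * s k\<bar> < 1" "1 - t * s k \<noteq> 0" using r by auto
  qed
  define Q where "Q i j = (\<Sum>k<d. \<Sum>l<d. G k l * (s k ^ (i + 2) * (s l ^ (j + 1) * a k l - (if j = 0 then b k l else 0))))" for i j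
  define T where "T i = (\<Sum>k<d. \<Sum>l<d. G k l * (s k ^ (i + 2) * (s l / (1 - t * s l) * a k l - b k l)))" for i
  \<comment> \<open>\<open>b k l\<close> carries no second resolvent, so it belongs to the constant
    term \<open>j = 0\<close>.\<close>
  have inner: "(\<lambda>j. t ^ j * (s l ^ (j + 1) * a k l - (if j = 0 then b k l else 0))) sums (s l / (1 - t * s l) * a k l - b k l)"
    if "l < d" for k l
  proof -
    have "(\<lambda>j. s l * a k l * (t * s l) ^ j - (if j = 0 then b k l else 0)) sums (s l * a k l * (1 / (1 - t * s l)) - b k l)"
      using ts[OF that] sums_If_finite_set[of "{0}" "\<lambda>_. b k l"]
      by (intro sums_diff sums_mult geometric_sums) auto
    also have "(\<lambda>j. s l * a k l * (t * s l) ^ j - (if j = 0 then b k l else 0)) =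
       (\<lambda>j. t ^ j * (s l ^ (j + 1) * a k l - (if j = 0 then b k l else 0)))"
      by (auto simp: fun_eq_iff power_mult_distrib algebra_simps)
    finally show ?thesis by simp
  qed
  have QT: "(\<lambda>j. t ^ j * Q i j) sums T i" for i
  proof -
    have "(\<lambda>j. \<Sum>k<d. \<Sum>l<d. G k l * (s k ^ (i + 2) * (t ^ j * (s l ^ (j + 1) * a k l - (if j = 0 then b k l else 0))))) sums T i"
      unfolding T_def by (intro sums_sum sums_mult inner) auto
    also have "(\<lambda>j. \<Sum>k<d. \<Sum>l<d. G k l * (s k ^ (i + 2) * (t ^ j * (s l ^ (j + 1) * a k l - (if j = 0 then b k l else 0))))) = (\<lambda>j. t ^ j * Q i j)"
      unfolding Q_def sum_distrib_left by (intro ext sum.cong refl) (simp only: mult_ac)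
    finally show ?thesis .
  qed
  have T: "\<bar>T i\<bar> \<le> x * real (Suc i) * S1" for i
  proof -
    have "norm (T i) \<le> x * real (Suc i) * S1"
    proof (rule norm_sums_le[OF QT])
      show "(\<lambda>j. x * real (Suc i) * (real (Suc j) * r ^ j)) sums (x * real (Suc i) * S1)" by (intro sums_mult S1)
      fix j
      have "norm (t ^ j * Q i j) = t ^ j * \<bar>Q i j\<bar>" using t by (simp add: abs_mult)
      also have "\<dots> \<le> r ^ j * (x * (real (Suc i) * real (Suc j)))"
        using t le[of i j] r0 by (intro mult_mono power_mono) (auto simp: Q_def)
      finally show "norm (t ^ j * Q i j) \<le> x * real (Suc i) * (real (Suc j) * r ^ j)" by (simp only: mult_ac)
    qed
    thus ?thesis by simp
  qed
  \<comment> \<open>The square of a resolvent is a derivative of the geometric series: the source of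
    the weight \<open>i + 1\<close> and of the exponent \<open>i + 2\<close>.\<close>
  have outer: "(\<lambda>i. real (Suc i) * t ^ i * s k ^ (i + 2)) sums (s k / (1 - t * s k))\<^sup>2" if "k < d" for k
  proof -
    have "(\<lambda>i. (s k)\<^sup>2 * (of_nat (Suc i) * (t * s k) ^ i)) sums ((s k)\<^sup>2 * (1 / (1 - t * s k)\<^sup>2))"
      using ts[OF that] by (intro sums_mult geometric_deriv_sums) auto
    thus ?thesis by (simp add: power_mult_distrib power_divide power_add power2_eq_square mult_ac)
  qed
  let ?F = "\<Sum>k<d. \<Sum>l<d. G k l * ((s k / (1 - t * s k))\<^sup>2 * (s l / (1 - t * s l) * a k l - b k l))"
  have "(\<lambda>i. \<Sum>k<d. \<Sum>l<d. G k l * ((real (Suc i) * t ^ i * s k ^ (i + 2)) * (s l / (1 - t * s l) * a k l - b k l))) sums ?F"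
    by (intro sums_sum sums_mult sums_mult2 outer) auto
  also have "(\<lambda>i. \<Sum>k<d. \<Sum>l<d. G k l * ((real (Suc i) * t ^ i * s k ^ (i + 2)) * (s l / (1 - t * s l) * a k l - b k l)))
     = (\<lambda>i. real (Suc i) * t ^ i * T i)"
    unfolding T_def sum_distrib_left by (intro ext sum.cong refl) (simp only: mult_ac)
  finally have F: "(\<lambda>i. real (Suc i) * t ^ i * T i) sums ?F" .
  have S10: "S1 \<ge> 0" using r0 r by (auto simp: S1_def intro!: suminf_nonneg summable_Suc_power simp del: of_nat_Suc)
  have "norm ?F \<le> x * S1 * S2"
  proof (rule norm_sums_le[OF F])
    show "(\<lambda>i. x * S1 * ((real (Suc i))\<^sup>2 * r ^ i)) sums (x * S1 * S2)" by (intro sums_mult S2)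
    fix i
    have "norm (real (Suc i) * t ^ i * T i) = real (Suc i) * t ^ i * \<bar>T i\<bar>"
      using t by (simp add: abs_mult del: of_nat_Suc)
    also have "\<dots> \<le> real (Suc i) * r ^ i * (x * real (Suc i) * S1)"
      using t T[of i] r0 by (intro mult_mono power_mono mult_left_mono mult_nonneg_nonneg) auto
    finally show "norm (real (Suc i) * t ^ i * T i) \<le> x * S1 * ((real (Suc i))\<^sup>2 * r ^ i)"
      by (simp only: mult_ac power2_eq_square)
  qed
  thus ?thesis by (simp add: resolvent_series_const_def S1_def S2_def mult_ac)
qed

section \<open>Union bound over countably many deviations\<close>

context prob_space
begin

lemma prob_UN_geometric_le:
  assumes A: "\<And>i::nat. A i \<in> events" and le: "\<And>i. prob (A i) \<le> c * q ^ i" and q: "0 \<le> q" "q \<le> 1 / 2" and c: "c \<ge> 0"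
  shows "prob (\<Union>i. A i) \<le> 2 * c"
proof -
  have S: "(\<lambda>i. c * q ^ i) sums (c * (1 / (1 - q)))" using q by (intro sums_mult geometric_sums) auto
  have sm: "summable (\<lambda>i. prob (A i))"
    using le by (intro summable_comparison_test_ev[OF _ sums_summable[OF S]] always_eventually) auto
  have "prob (\<Union>i. A i) \<le> (\<Sum>i. prob (A i))" using A by (intro finite_measure_subadditive_countably sm) auto
  also have "\<dots> \<le> (\<Sum>i. c * q ^ i)" by (intro suminf_le le sm sums_summable[OF S])
  also have "\<dots> = c * (1 / (1 - q))" using S by (simp add: sums_iff)
  also have "\<dots> \<le> c * 2" using q c by (intro mult_left_mono) (auto simp: field_simps)
  finally show ?thesis by simp
qed

text \<open>Two geometric sums with ratio at most 1/2 cost a factor 2 each, on top of the 2 of a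
  two-sided tail: the origin of the final prefactor 8. For larger ratios the claimed bound exceeds
  1.\<close>

lemma prob_double_UN_exp_le:
  assumes A: "\<And>i j::nat. A i j \<in> events" and le: "\<And>i j. prob (A i j) \<le> 2 * exp (- a * real (Suc (i + j)))"
  shows "prob (\<Union>i j. A i j) \<le> 8 * exp (- a)"
proof (cases "exp (- a) \<le> 1 / 2")
  case True
  have "prob (\<Union>j. A i j) \<le> 2 * (2 * exp (- a) * exp (- a) ^ i)" for i
  proof (rule prob_UN_geometric_le[OF A])
    fix j
    have "exp (- a * real (Suc (i + j))) = exp (- a) * exp (- a) ^ i * exp (- a) ^ j"
      by (simp add: algebra_simps flip: exp_of_nat_mult exp_add)
    thus "prob (A i j) \<le> 2 * exp (- a) * exp (- a) ^ i * exp (- a) ^ j" using le[of i j] by simp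
  qed (use True in auto)
  hence "prob (\<Union>i. \<Union>j. A i j) \<le> 2 * (4 * exp (- a))"
    using A True by (intro prob_UN_geometric_le[where q = "exp (- a)"]) (auto simp: mult.assoc)
  thus ?thesis by simp
next
  case False
  hence "1 \<le> 8 * exp (- a)" by simp
  thus ?thesis by (rule order_trans[OF prob_le_1])
qed

text \<open>The growing thresholds make the union summable: with
  \<open>w = (i + 1) * (j + 1)\<close> both Bernstein exponents grow at least like \<open>w\<close>,
  and \<open>w \<ge> i + j + 1\<close>. The series bound can afford such thresholds, as its powers
  of \<open>t\<close> decay geometrically.\<close>

lemma prob_iid_family_deviation_le:
  fixes X :: "nat \<Rightarrow> nat \<Rightarrow> nat \<Rightarrow> 'a \<Rightarrow> real"
  assumes iid: "\<And>i j. iid_copies n (X i j) (Z i j)" and n: "n \<ge> 1" and \<theta>: "\<theta> > 0"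
    and Z: "\<And>i j. (\<integral>\<^sup>+\<omega>. ennreal (exp (\<theta> * \<bar>Z i j \<omega>\<bar>)) \<partial>M) \<le> 2" and x: "x > 0"
  defines "A i j \<equiv> {\<omega> \<in> space M. \<bar>(\<Sum>m=1..n. X i j m \<omega>) / n - expectation (Z i j)\<bar> \<ge> x * (real (Suc i) * real (Suc j))}"
  shows "A i j \<in> events" "prob (\<Union>i j. A i j) \<le> 8 * exp (- (real n * min (\<theta>\<^sup>2 * x\<^sup>2 / 32) (\<theta> * x / 4)))"
proof -
  have [measurable]: "X i j m \<in> borel_measurable M" if "m \<in> {1..n}" for i j m
    using iid[of i j] that by (auto simp: iid_copies_def indep_vars_def)
  show A: "A i j \<in> events" for i j unfolding A_def by measurable
  show "prob (\<Union>i j. A i j) \<le> 8 * exp (- (real n * min (\<theta>\<^sup>2 * x\<^sup>2 / 32) (\<theta> * x / 4)))"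
  proof (rule prob_double_UN_exp_le[OF A])
    fix i j
    define w where "w = real (Suc i) * real (Suc j)"
    have w: "w \<ge> real (Suc (i + j))" by (simp add: w_def algebra_simps)
    have w1: "w \<ge> 1" using w by simp
    have "w * 1 \<le> w * w" using w1 by (intro mult_left_mono) auto
    hence "\<theta>\<^sup>2 * x\<^sup>2 / 32 * w \<le> \<theta>\<^sup>2 * x\<^sup>2 / 32 * w\<^sup>2"
      by (intro mult_left_mono) (auto simp: power2_eq_square)
    hence "min (\<theta>\<^sup>2 * x\<^sup>2 / 32 * w) (\<theta> * x / 4 * w) \<le> min (\<theta>\<^sup>2 * (x * w)\<^sup>2 / 32) (\<theta> * (x * w) / 4)"
      by (intro min.mono) (auto simp: power_mult_distrib mult_ac)
    hence "min (\<theta>\<^sup>2 * x\<^sup>2 / 32) (\<theta> * x / 4) * w \<le> min (\<theta>\<^sup>2 * (x * w)\<^sup>2 / 32) (\<theta> * (x * w) / 4)"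
      using w1 by (simp add: min_mult_distrib_right)
    moreover have "min (\<theta>\<^sup>2 * x\<^sup>2 / 32) (\<theta> * x / 4) * real (Suc (i + j)) \<le> min (\<theta>\<^sup>2 * x\<^sup>2 / 32) (\<theta> * x / 4) * w"
      using w \<theta> x by (intro mult_left_mono) auto
    ultimately have le: "min (\<theta>\<^sup>2 * x\<^sup>2 / 32) (\<theta> * x / 4) * real (Suc (i + j)) \<le> min (\<theta>\<^sup>2 * (x * w)\<^sup>2 / 32) (\<theta> * (x * w) / 4)"
      by linarith
    have "prob (A i j) \<le> 2 * exp (- real n * min (\<theta>\<^sup>2 * (x * w)\<^sup>2 / 32) (\<theta> * (x * w) / 4))"
      unfolding A_def w_def[symmetric] using x w1 by (intro iid_copies_tail[OF iid n \<theta> Z]) auto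
    also have "\<dots> \<le> 2 * exp (- (real n * min (\<theta>\<^sup>2 * x\<^sup>2 / 32) (\<theta> * x / 4)) * real (Suc (i + j)))"
      using mult_left_mono[OF le, of "real n"] by (simp add: mult.assoc del: of_nat_Suc)
    finally show "prob (A i j) \<le> \<dots>" .
  qed
qed

end

section \<open>Risk and empirical risk in diagonal coordinates\<close>

locale diagonalized_model = diagonalized_problem d K A \<Gamma> C0 V nu + prob_space M
  for d K A \<Gamma> C0 V nu and M :: "'w measure" +
  fixes u \<xi> :: "'w \<Rightarrow> real vec" and lam_star Csig :: real
  assumes lam_star: "lam_star > 0" and Csig: "Csig > 0"
    and model: "linear_model Csig M d K \<Gamma> C0 lam_star u \<xi>"
begin

lemma u_sub_gaussian: "sub_gaussian_vec Csig M d ((1 / lam_star) \<cdot>\<^sub>m C0) u"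
  and noise_sub_gaussian: "sub_gaussian_vec Csig M K \<Gamma> \<xi>"
  and u_noise_indep: "indep_var (borel_vec d) u (borel_vec K) \<xi>"
  using model by (auto simp: linear_model_def)

lemma u_measurable: "u \<in> measurable M (borel_vec d)" and noise_measurable: "\<xi> \<in> measurable M (borel_vec K)"
  using u_sub_gaussian noise_sub_gaussian by (auto simp: sub_gaussian_vec_def)

lemma u_carrier: "\<omega> \<in> space M \<Longrightarrow> u \<omega> \<in> carrier_vec d" and noise_carrier: "\<omega> \<in> space M \<Longrightarrow> \<xi> \<omega> \<in> carrier_vec K"
  using measurable_space[OF u_measurable] measurable_space[OF noise_measurable] by simp_all

abbreviation "y \<equiv> observation A u \<xi>"

lemma y_measurable: "y \<in> measurable M (borel_vec K)"
  unfolding observation_def[abs_def]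
  by (intro measurable_add_vec noise_measurable measurable_compose[OF u_measurable measurable_mult_mat_vec[OF A]])

definition w :: "nat \<Rightarrow> 'w \<Rightarrow> real" where "w k \<omega> = (U *\<^sub>v u \<omega>) $ k"
definition z :: "nat \<Rightarrow> 'w \<Rightarrow> real" where "z k \<omega> = (B *\<^sub>v \<xi> \<omega>) $ k"

lemma w_eq: "k < d \<Longrightarrow> w k \<omega> = row U k \<bullet> u \<omega>" and z_eq: "k < d \<Longrightarrow> z k \<omega> = row B k \<bullet> \<xi> \<omega>"
  using carriers by (simp_all add: w_def z_def)

lemma B_y: "k < d \<Longrightarrow> \<omega> \<in> space M \<Longrightarrow> (B *\<^sub>v y \<omega>) $ k = nu k * w k \<omega> + z k \<omega>"
  unfolding observation_def w_def z_def using A carriers u_carrier[of \<omega>] noise_carrier[of \<omega>] BA_vec[of "u \<omega>" k]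
  by (simp add: mult_add_distrib_mat_vec[of _ d K] del: index_mult_mat_vec)

lemma w_second_moment:
  assumes "k < d" "l < d"
  shows "integrable M (\<lambda>\<omega>. w k \<omega> * w l \<omega>)" "expectation (\<lambda>\<omega>. w k \<omega> * w l \<omega>) = (if k = l then 1 / lam_star else 0)"
proof -
  have r: "row U k \<in> carrier_vec d" "row U l \<in> carrier_vec d" using carriers assms by auto
  note cov = sub_gaussian_vec_covariance[OF u_sub_gaussian r]
  show "integrable M (\<lambda>\<omega>. w k \<omega> * w l \<omega>)" using cov(1) assms by (simp add: w_eq)
  have "row U k \<bullet> ((1 / lam_star \<cdot>\<^sub>m C0) *\<^sub>v row U l) = (1 / lam_star) * (row U k \<bullet> (C0 *\<^sub>v row U l))"
    using C0 r carriers assms by (simp add: smult_mult_mat_vec[of _ d d])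
  also have "C0 *\<^sub>v row U l = col (C0 * transpose_mat U) l"
    using carriers C0 assms by (simp add: col_mult2[of _ d d _ d])
  also have "row U k \<bullet> \<dots> = (U * (C0 * transpose_mat U)) $$ (k,l)" using carriers C0 assms by simp
  also have "U * (C0 * transpose_mat U) = U * C0 * transpose_mat U" using carriers C0 by (simp add: assoc_mult_mat[of _ d d _ d _ d])
  also have "\<dots> = 1\<^sub>m d" by (rule signal_cov)
  finally show "expectation (\<lambda>\<omega>. w k \<omega> * w l \<omega>) = (if k = l then 1 / lam_star else 0)" using cov(2) assms by (simp add: w_eq)
qed

lemma z_second_moment:
  assumes "k < d" "l < d"
  shows "integrable M (\<lambda>\<omega>. z k \<omega> * z l \<omega>)" "expectation (\<lambda>\<omega>. z k \<omega> * z l \<omega>) = (if k = l then nu k else 0)"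
proof -
  have r: "row B k \<in> carrier_vec K" "row B l \<in> carrier_vec K" using carriers assms by auto
  note cov = sub_gaussian_vec_covariance[OF noise_sub_gaussian r]
  show "integrable M (\<lambda>\<omega>. z k \<omega> * z l \<omega>)" using cov(1) assms by (simp add: z_eq)
  have "\<Gamma> *\<^sub>v row B l = col (\<Gamma> * transpose_mat B) l"
    using carriers Gamma assms by (simp add: col_mult2[of _ K K _ d])
  hence "row B k \<bullet> (\<Gamma> *\<^sub>v row B l) = (B * (\<Gamma> * transpose_mat B)) $$ (k,l)" using carriers Gamma assms by simp
  also have "B * (\<Gamma> * transpose_mat B) = B * \<Gamma> * transpose_mat B" using carriers Gamma by (simp add: assoc_mult_mat[of _ d K _ K _ d])
  also have "\<dots> = D" by (rule noise_cov)
  finally show "expectation (\<lambda>\<omega>. z k \<omega> * z l \<omega>) = (if k = l then nu k else 0)" using cov(2) assms by (simp add: z_eq D_def)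
qed

lemma indep_functions:
  assumes "f \<in> measurable (borel_vec d) N" "g \<in> measurable (borel_vec K) N'"
  shows "indep_var N (\<lambda>\<omega>. f (u \<omega>)) N' (\<lambda>\<omega>. g (\<xi> \<omega>))"
  using indep_var_compose[OF u_noise_indep assms] by (simp add: comp_def)

lemma wz_second_moment:
  assumes "k < d" "l < d"
  shows "integrable M (\<lambda>\<omega>. w k \<omega> * z l \<omega>)" "expectation (\<lambda>\<omega>. w k \<omega> * z l \<omega>) = 0"
proof -
  have r: "row U k \<in> carrier_vec d" "row B l \<in> carrier_vec K" using carriers assms by auto
  have ind: "indep_var borel (\<lambda>\<omega>. row U k \<bullet> u \<omega>) borel (\<lambda>\<omega>. row B l \<bullet> \<xi> \<omega>)"
    by (intro indep_functions measurable_scalar_prod_borel_vec r)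
  note mu = sub_gaussian_vec_mean[OF u_sub_gaussian r(1)]
  note mx = sub_gaussian_vec_mean[OF noise_sub_gaussian r(2)]
  show "integrable M (\<lambda>\<omega>. w k \<omega> * z l \<omega>)"
    using indep_var_integrable[OF ind mu(1) mx(1)] assms by (simp add: w_eq z_eq)
  show "expectation (\<lambda>\<omega>. w k \<omega> * z l \<omega>) = 0"
    using indep_var_lebesgue_integral[OF ind mu(1) mx(1)] mu(2) assms by (simp add: w_eq z_eq)
qed

text \<open>The \<open>w k\<close> are uncorrelated but in general not independent, so the sum is
  taken back to one functional of \<open>u\<close> and one of \<open>\<xi>\<close>. These two are
  independent, and their variances are diagonal in the coordinates.\<close>

lemma linear_form_mgf:
  "(\<integral>\<^sup>+\<omega>. ennreal (exp (\<Sum>k<d. \<alpha> k * w k \<omega> + \<beta> k * z k \<omega>)) \<partial>M)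
     \<le> ennreal (exp (2 * Csig\<^sup>2 * (\<Sum>k<d. (\<alpha> k)\<^sup>2 / lam_star + nu k * (\<beta> k)\<^sup>2)))"
proof -
  define a where "a = transpose_mat U *\<^sub>v vec d \<alpha>"
  define b where "b = transpose_mat B *\<^sub>v vec d \<beta>"
  have ab: "a \<in> carrier_vec d" "b \<in> carrier_vec K" using carriers by (simp_all add: a_def b_def)
  have au: "a \<bullet> u \<omega> = (\<Sum>k<d. \<alpha> k * w k \<omega>)" if "\<omega> \<in> space M" for \<omega>
  proof -
    have "a \<bullet> u \<omega> = vec d \<alpha> \<bullet> (U *\<^sub>v u \<omega>)"
      unfolding a_def using carriers u_carrier[OF that] scalar_prod_mult_mat_vec[of "transpose_mat U" d d "vec d \<alpha>" "u \<omega>"] by simp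
    thus ?thesis using carriers by (simp add: scalar_prod_def[of "vec d \<alpha>"] w_def atLeast0LessThan del: index_mult_mat_vec)
  qed
  have bx: "b \<bullet> \<xi> \<omega> = (\<Sum>k<d. \<beta> k * z k \<omega>)" if "\<omega> \<in> space M" for \<omega>
  proof -
    have "b \<bullet> \<xi> \<omega> = vec d \<beta> \<bullet> (B *\<^sub>v \<xi> \<omega>)"
      unfolding b_def using carriers noise_carrier[OF that] scalar_prod_mult_mat_vec[of "transpose_mat B" K d "vec d \<beta>" "\<xi> \<omega>"] by simp
    thus ?thesis using carriers by (simp add: scalar_prod_def[of "vec d \<beta>"] z_def atLeast0LessThan del: index_mult_mat_vec)
  qed
  have va: "a \<bullet> ((1 / lam_star \<cdot>\<^sub>m C0) *\<^sub>v a) = (\<Sum>k<d. (\<alpha> k)\<^sup>2 / lam_star)"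
  proof -
    have "a \<bullet> ((1 / lam_star \<cdot>\<^sub>m C0) *\<^sub>v a) = (1 / lam_star) * (a \<bullet> (C0 *\<^sub>v a))"
      using C0 ab by (simp add: smult_mult_mat_vec[of _ d d])
    also have "a \<bullet> (C0 *\<^sub>v a) = vec d \<alpha> \<bullet> (U *\<^sub>v (C0 *\<^sub>v a))"
      unfolding a_def using carriers C0 scalar_prod_mult_mat_vec[of "transpose_mat U" d d "vec d \<alpha>" "C0 *\<^sub>v (transpose_mat U *\<^sub>v vec d \<alpha>)"] by simp
    also have "U *\<^sub>v (C0 *\<^sub>v a) = (U * C0 * transpose_mat U) *\<^sub>v vec d \<alpha>"
      unfolding a_def using carriers C0 by (simp add: assoc_mult_mat_vec[of _ d d _ d])
    also have "\<dots> = vec d \<alpha>" unfolding signal_cov by simp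
    finally show ?thesis by (simp add: scalar_prod_def atLeast0LessThan power2_eq_square sum_divide_distrib)
  qed
  have vb: "b \<bullet> (\<Gamma> *\<^sub>v b) = (\<Sum>k<d. nu k * (\<beta> k)\<^sup>2)"
  proof -
    have "b \<bullet> (\<Gamma> *\<^sub>v b) = vec d \<beta> \<bullet> (B *\<^sub>v (\<Gamma> *\<^sub>v b))"
      unfolding b_def using carriers Gamma scalar_prod_mult_mat_vec[of "transpose_mat B" K d "vec d \<beta>" "\<Gamma> *\<^sub>v (transpose_mat B *\<^sub>v vec d \<beta>)"] by simp
    also have "B *\<^sub>v (\<Gamma> *\<^sub>v b) = (B * \<Gamma> * transpose_mat B) *\<^sub>v vec d \<beta>"
      unfolding b_def using carriers Gamma by (simp add: assoc_mult_mat_vec[of _ d K _ d] assoc_mult_mat_vec[of _ d K _ K])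
    also have "\<dots> = vec d (\<lambda>k. nu k * \<beta> k)" unfolding noise_cov
    proof (intro eq_vecI)
      fix i assume "i < dim_vec (vec d (\<lambda>k. nu k * \<beta> k))"
      hence i: "i < d" by simp
      have "(D *\<^sub>v vec d \<beta>) $ i = (\<Sum>j<d. D $$ (i,j) * vec d \<beta> $ j)" using carriers i by (intro mult_mat_vec_index) auto
      also have "\<dots> = (\<Sum>j<d. if j = i then nu i * \<beta> i else 0)" using i by (intro sum.cong) (auto simp: D_def)
      finally show "(D *\<^sub>v vec d \<beta>) $ i = vec d (\<lambda>k. nu k * \<beta> k) $ i" using i by simp
    qed (use carriers in auto)
    finally show ?thesis by (simp add: scalar_prod_def atLeast0LessThan power2_eq_square mult_ac)
  qed
  have ind: "indep_var borel (\<lambda>\<omega>. ennreal (exp (a \<bullet> u \<omega>))) borel (\<lambda>\<omega>. ennreal (exp (b \<bullet> \<xi> \<omega>)))"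
    using measurable_scalar_prod_borel_vec[OF ab(1)] measurable_scalar_prod_borel_vec[OF ab(2)]
    by (intro indep_functions[of "\<lambda>v. ennreal (exp (a \<bullet> v))" borel "\<lambda>v. ennreal (exp (b \<bullet> v))" borel]) auto
  have "(\<integral>\<^sup>+\<omega>. ennreal (exp (\<Sum>k<d. \<alpha> k * w k \<omega> + \<beta> k * z k \<omega>)) \<partial>M)
     = (\<integral>\<^sup>+\<omega>. ennreal (exp (a \<bullet> u \<omega>)) * ennreal (exp (b \<bullet> \<xi> \<omega>)) \<partial>M)"
    by (intro nn_integral_cong) (simp add: au bx sum.distrib exp_add ennreal_mult)
  also have "\<dots> = (\<integral>\<^sup>+\<omega>. ennreal (exp (a \<bullet> u \<omega>)) \<partial>M) * (\<integral>\<^sup>+\<omega>. ennreal (exp (b \<bullet> \<xi> \<omega>)) \<partial>M)"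
  proof -
    \<comment> \<open>As a family over the booleans the pair admits the product formula for
      nonnegative integrals, without integrability.\<close>
    have "indep_vars (\<lambda>_. borel) (case_bool (\<lambda>\<omega>. ennreal (exp (a \<bullet> u \<omega>))) (\<lambda>\<omega>. ennreal (exp (b \<bullet> \<xi> \<omega>)))) UNIV"
      using ind unfolding indep_var_def by (rule back_subst[of "\<lambda>N. indep_vars N _ UNIV"]) (simp add: fun_eq_iff split: bool.split)
    from indep_vars_nn_integral[OF _ this] show ?thesis by (simp add: UNIV_bool mult.commute)
  qed
  also have "\<dots> \<le> ennreal (exp (2 * Csig\<^sup>2 * (a \<bullet> ((1 / lam_star \<cdot>\<^sub>m C0) *\<^sub>v a)))) * ennreal (exp (2 * Csig\<^sup>2 * (b \<bullet> (\<Gamma> *\<^sub>v b))))"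
    by (intro mult_mono sub_gaussian_vec_mgf[OF u_sub_gaussian] sub_gaussian_vec_mgf[OF noise_sub_gaussian] ab) auto
  also have "\<dots> = ennreal (exp (2 * Csig\<^sup>2 * (\<Sum>k<d. (\<alpha> k)\<^sup>2 / lam_star + nu k * (\<beta> k)\<^sup>2)))"
    by (simp add: va vb sum.distrib distrib_left exp_add ennreal_mult)
  finally show ?thesis .
qed

end

section \<open>Loss of a single data pair\<close>

context diagonalized_problem
begin

definition gcoord :: "nat \<Rightarrow> real vec \<times> real vec \<Rightarrow> real" where "gcoord k p = (B *\<^sub>v snd p) $ k"
definition wcoord :: "nat \<Rightarrow> real vec \<times> real vec \<Rightarrow> real" where "wcoord k p = (U *\<^sub>v fst p) $ k"
text \<open>The resolvent at the expansion point, scaled into the unit interval.\<close>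

definition shrink :: "real \<Rightarrow> nat \<Rightarrow> real" where "shrink lu k = lu / (nu k + lu)"
text \<open>Coefficient of \<open>t ^ j\<close> in the error
  \<open>gcoord k p / (nu k + lam) - wcoord k p\<close>, where
  \<open>t = (lu - lam) / lu\<close>.\<close>

definition coeff :: "real \<Rightarrow> nat \<Rightarrow> nat \<Rightarrow> real vec \<times> real vec \<Rightarrow> real" where
  "coeff lu j k p = shrink lu k ^ (j + 1) * (gcoord k p / lu) - (if j = 0 then wcoord k p else 0)"
text \<open>The gradient of the loss pairs the error with its derivative in \<open>t\<close>.
  Differentiation shifts the first index to \<open>Suc i\<close>; the accompanying factor
  \<open>i + 1\<close> is left to the series bound.\<close>

definition bform :: "real \<Rightarrow> nat \<Rightarrow> nat \<Rightarrow> real vec \<times> real vec \<Rightarrow> real" where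
  "bform lu i j p = (\<Sum>k<d. \<Sum>l<d. gram k l * (coeff lu (Suc i) k p * coeff lu j l p))"
definition gg :: "real \<Rightarrow> nat \<Rightarrow> nat \<Rightarrow> real vec \<times> real vec \<Rightarrow> real" where "gg lu k l p = gcoord k p * gcoord l p / lu\<^sup>2"
definition gw :: "real \<Rightarrow> nat \<Rightarrow> nat \<Rightarrow> real vec \<times> real vec \<Rightarrow> real" where "gw lu k l p = gcoord k p * wcoord l p / lu"

text \<open>The shape that \<open>resolvent_series_bound\<close> expects. At index
  \<open>Suc i\<close> the signal part of \<open>coeff\<close> is absent, so only two kinds of
  products occur.\<close>

lemma bform_eq: "bform lu i j p = (\<Sum>k<d. \<Sum>l<d. gram k l *
    (shrink lu k ^ (i + 2) * (shrink lu l ^ (j + 1) * gg lu k l p - (if j = 0 then gw lu k l p else 0))))"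
  unfolding bform_def coeff_def gg_def gw_def
  by (intro sum.cong refl) (simp add: algebra_simps power2_eq_square)

lemma shrink_bounds: "lu > 0 \<Longrightarrow> k < d \<Longrightarrow> 0 \<le> shrink lu k \<and> shrink lu k \<le> 1"
  using nu_nonneg[of k] by (auto simp: shrink_def field_simps)

lemma measurable_coords:
  assumes "k < d"
  shows "gcoord k \<in> borel_measurable (borel_vec d \<Otimes>\<^sub>M borel_vec K)" "wcoord k \<in> borel_measurable (borel_vec d \<Otimes>\<^sub>M borel_vec K)"
  unfolding gcoord_def[abs_def] wcoord_def[abs_def]
  by (rule measurable_compose[OF measurable_compose[OF measurable_snd measurable_mult_mat_vec[OF carriers(2)]] measurable_vec_index[OF assms]])
     (rule measurable_compose[OF measurable_compose[OF measurable_fst measurable_mult_mat_vec[OF carriers(1)]] measurable_vec_index[OF assms]])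

lemma measurable_bform [measurable]: "bform lu i j \<in> borel_measurable (borel_vec d \<Otimes>\<^sub>M borel_vec K)"
proof -
  note [measurable] = measurable_coords
  show ?thesis unfolding bform_eq[abs_def] gg_def gw_def by measurable
qed

lemma loss_eq_coords:
  assumes "lam > 0" "snd p \<in> carrier_vec K" "fst p \<in> carrier_vec d"
  shows "(vec_norm (tikhonov A \<Gamma> C0 lam (snd p) - fst p))\<^sup>2 = (\<Sum>k<d. \<Sum>l<d. gram k l *
     ((gcoord k p / (nu k + lam) - wcoord k p) * (gcoord l p / (nu l + lam) - wcoord l p)))"
  using loss_eq[OF assms] by (simp add: gcoord_def wcoord_def)

lemma gram_sym: "gram k l = gram l k" by (simp add: gram_def mult.commute)

text \<open>Symmetry of \<open>gram\<close> makes both terms of the product rule equal. The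
  asymmetric result, one squared and one simple resolvent, allows two separate series
  expansions.\<close>

lemma loss_derivative:
  assumes lam: "lam > 0"
  shows "((\<lambda>lam. \<Sum>k<d. \<Sum>l<d. gram k l *
     ((gcoord k p / (nu k + lam) - wcoord k p) * (gcoord l p / (nu l + lam) - wcoord l p)))
     has_real_derivative (-2 * (\<Sum>k<d. \<Sum>l<d. gram k l * (1 / (nu k + lam)\<^sup>2 *
        (1 / (nu l + lam) * (gcoord k p * gcoord l p) - gcoord k p * wcoord l p))))) (at lam)"
proof -
  define f where "f k lam = gcoord k p / (nu k + lam) - wcoord k p" for k lam
  define f' where "f' k = - gcoord k p / (nu k + lam)\<^sup>2" for k
  have f: "(f k has_real_derivative f' k) (at lam)" if "k < d" for k
  proof -
    have "nu k + lam \<noteq> 0" using nu_nonneg[OF that] lam by simp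
    thus ?thesis unfolding f_def[abs_def] f'_def
      by (auto intro!: derivative_eq_intros simp: power2_eq_square)
  qed
  have "((\<lambda>lam. \<Sum>k<d. \<Sum>l<d. gram k l * (f k lam * f l lam)) has_real_derivative
     (\<Sum>k<d. \<Sum>l<d. gram k l * (f' k * f l lam + f' l * f k lam))) (at lam)"
    by (intro DERIV_sum DERIV_cmult DERIV_mult f) auto
  also have "(\<Sum>k<d. \<Sum>l<d. gram k l * (f' k * f l lam + f' l * f k lam)) =
     (\<Sum>k<d. \<Sum>l<d. gram k l * (f' k * f l lam)) + (\<Sum>k<d. \<Sum>l<d. gram k l * (f' l * f k lam))"
    by (simp add: distrib_left sum.distrib)
  also have "(\<Sum>k<d. \<Sum>l<d. gram k l * (f' l * f k lam)) = (\<Sum>l<d. \<Sum>k<d. gram k l * (f' l * f k lam))" by (rule sum.swap)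
  also have "\<dots> = (\<Sum>k<d. \<Sum>l<d. gram k l * (f' k * f l lam))" by (simp add: gram_sym)
  finally have "((\<lambda>lam. \<Sum>k<d. \<Sum>l<d. gram k l * (f k lam * f l lam)) has_real_derivative
     2 * (\<Sum>k<d. \<Sum>l<d. gram k l * (f' k * f l lam))) (at lam)" by simp
  also have "2 * (\<Sum>k<d. \<Sum>l<d. gram k l * (f' k * f l lam)) = -2 * (\<Sum>k<d. \<Sum>l<d. gram k l * (1 / (nu k + lam)\<^sup>2 *
        (1 / (nu l + lam) * (gcoord k p * gcoord l p) - gcoord k p * wcoord l p)))"
    unfolding sum_distrib_left f'_def f_def
    by (intro sum.cong refl) (simp add: algebra_simps)
  finally show ?thesis unfolding f_def .
qed

end

section \<open>Second moments and the risk\<close>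

context diagonalized_model
begin

lemma bilinear_moment:
  assumes kl: "k < d" "l < d"
  shows "integrable M (\<lambda>\<omega>. (\<alpha> * w k \<omega> + \<beta> * z k \<omega>) * (\<alpha>' * w l \<omega> + \<beta>' * z l \<omega>))"
    "expectation (\<lambda>\<omega>. (\<alpha> * w k \<omega> + \<beta> * z k \<omega>) * (\<alpha>' * w l \<omega> + \<beta>' * z l \<omega>)) =
      (if k = l then \<alpha> * \<alpha>' / lam_star + \<beta> * \<beta>' * nu k else 0)"
proof -
  have eq: "(\<alpha> * w k \<omega> + \<beta> * z k \<omega>) * (\<alpha>' * w l \<omega> + \<beta>' * z l \<omega>) =
     \<alpha> * \<alpha>' * (w k \<omega> * w l \<omega>) + \<alpha> * \<beta>' * (w k \<omega> * z l \<omega>) + \<beta> * \<alpha>' * (w l \<omega> * z k \<omega>) + \<beta> * \<beta>' * (z k \<omega> * z l \<omega>)" for \<omega>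
    by (simp add: algebra_simps)
  note I = w_second_moment[OF kl] z_second_moment[OF kl] wz_second_moment[OF kl] wz_second_moment[OF kl(2,1)]
  show "integrable M (\<lambda>\<omega>. (\<alpha> * w k \<omega> + \<beta> * z k \<omega>) * (\<alpha>' * w l \<omega> + \<beta>' * z l \<omega>))"
    unfolding eq using I by (intro Bochner_Integration.integrable_add integrable_mult_right)
  show "expectation (\<lambda>\<omega>. (\<alpha> * w k \<omega> + \<beta> * z k \<omega>) * (\<alpha>' * w l \<omega> + \<beta>' * z l \<omega>)) =
      (if k = l then \<alpha> * \<alpha>' / lam_star + \<beta> * \<beta>' * nu k else 0)"
    unfolding eq using I by simp
qed

abbreviation "obs \<omega> \<equiv> (u \<omega>, y \<omega>)"

lemma wcoord_obs: "wcoord k (obs \<omega>) = w k \<omega>" by (simp add: wcoord_def w_def)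

lemma gcoord_obs: "k < d \<Longrightarrow> \<omega> \<in> space M \<Longrightarrow> gcoord k (obs \<omega>) = nu k * w k \<omega> + 1 * z k \<omega>"
  by (simp add: gcoord_def B_y del: index_mult_mat_vec)

lemma moment_cong:
  assumes "\<And>\<omega>. \<omega> \<in> space M \<Longrightarrow> f \<omega> = (\<alpha> * w k \<omega> + \<beta> * z k \<omega>) * (\<alpha>' * w l \<omega> + \<beta>' * z l \<omega>)" "k < d" "l < d"
  shows "integrable M f" "expectation f = (if k = l then \<alpha> * \<alpha>' / lam_star + \<beta> * \<beta>' * nu k else 0)"
  using bilinear_moment[OF assms(2,3), of \<alpha> \<beta> \<alpha>' \<beta>'] assms(1)
  by (simp_all cong: Bochner_Integration.integrable_cong Bochner_Integration.integral_cong)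

lemma gg_moment:
  assumes "k < d" "l < d"
  shows "integrable M (\<lambda>\<omega>. gg lu k l (obs \<omega>))"
    "expectation (\<lambda>\<omega>. gg lu k l (obs \<omega>)) = (if k = l then ((nu k)\<^sup>2 / lam_star + nu k) / lu\<^sup>2 else 0)"
proof -
  have eq: "gg lu k l (obs \<omega>) = (nu k / lu * w k \<omega> + 1 / lu * z k \<omega>) * (nu l / lu * w l \<omega> + 1 / lu * z l \<omega>)" if "\<omega> \<in> space M" for \<omega>
    using that assms by (simp add: gg_def gcoord_obs power2_eq_square add_divide_distrib[symmetric])
  show "integrable M (\<lambda>\<omega>. gg lu k l (obs \<omega>))" by (rule moment_cong(1)[OF eq assms])
  show "expectation (\<lambda>\<omega>. gg lu k l (obs \<omega>)) = (if k = l then ((nu k)\<^sup>2 / lam_star + nu k) / lu\<^sup>2 else 0)"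
    by (rule trans[OF moment_cong(2)[OF eq assms]], cases "k = l") (simp_all add: power2_eq_square add_divide_distrib)
qed

lemma gw_moment:
  assumes "k < d" "l < d"
  shows "integrable M (\<lambda>\<omega>. gw lu k l (obs \<omega>))"
    "expectation (\<lambda>\<omega>. gw lu k l (obs \<omega>)) = (if k = l then nu k / lam_star / lu else 0)"
proof -
  have eq: "gw lu k l (obs \<omega>) = (nu k / lu * w k \<omega> + 1 / lu * z k \<omega>) * (1 * w l \<omega> + 0 * z l \<omega>)" if "\<omega> \<in> space M" for \<omega>
    using that assms by (simp add: gw_def gcoord_obs wcoord_obs add_divide_distrib[symmetric])
  show "integrable M (\<lambda>\<omega>. gw lu k l (obs \<omega>))" by (rule moment_cong(1)[OF eq assms])
  show "expectation (\<lambda>\<omega>. gw lu k l (obs \<omega>)) = (if k = l then nu k / lam_star / lu else 0)"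
    by (rule trans[OF moment_cong(2)[OF eq assms]], cases "k = l") simp_all
qed

lemma expectation_bform:
  "expectation (\<lambda>\<omega>. bform lu i j (obs \<omega>)) = (\<Sum>k<d. \<Sum>l<d. gram k l *
    (shrink lu k ^ (i + 2) * (shrink lu l ^ (j + 1) * expectation (\<lambda>\<omega>. gg lu k l (obs \<omega>))
       - (if j = 0 then expectation (\<lambda>\<omega>. gw lu k l (obs \<omega>)) else 0))))"
proof -
  have if_eq: "(if j = 0 then x else 0) = (if j = 0 then 1 else 0) * x" for x :: real by simp
  show ?thesis
    unfolding bform_eq if_eq[of "gw _ _ _ _"] if_eq[of "expectation _"]
    using gg_moment(1) gw_moment(1)
    by (subst Bochner_Integration.integral_sum; (intro sum.cong refl)?)
       (auto intro!: Bochner_Integration.integral_sum Bochner_Integration.integrable_sum integrable_mult_right Bochner_Integration.integrable_diff)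
qed

text \<open>The error coordinate is \<open>(z k - lam * w k) / (nu k + lam)\<close>; in expectation
  only the diagonal of \<open>gram\<close> survives.\<close>

lemma risk_eq:
  assumes lam: "lam > 0"
  shows "risk M A \<Gamma> C0 u y lam = (\<Sum>k<d. gram k k * ((lam\<^sup>2 / lam_star + nu k) / (nu k + lam)\<^sup>2))"
proof -
  have pos: "nu k + lam > 0" if "k < d" for k using nu_nonneg[OF that] lam by simp
  define f where "f k l \<omega> = (gcoord k (obs \<omega>) / (nu k + lam) - wcoord k (obs \<omega>)) * (gcoord l (obs \<omega>) / (nu l + lam) - wcoord l (obs \<omega>))" for k l \<omega>
  have f: "integrable M (f k l)" "expectation (f k l) = (if k = l then (lam\<^sup>2 / lam_star + nu k) / (nu k + lam)\<^sup>2 else 0)"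
    if kl: "k < d" "l < d" for k l
  proof -
    have eq: "f k l \<omega> = (- lam / (nu k + lam) * w k \<omega> + 1 / (nu k + lam) * z k \<omega>) * (- lam / (nu l + lam) * w l \<omega> + 1 / (nu l + lam) * z l \<omega>)"
      if "\<omega> \<in> space M" for \<omega>
    proof -
      have "gcoord k (obs \<omega>) / (nu k + lam) - wcoord k (obs \<omega>) = - lam / (nu k + lam) * w k \<omega> + 1 / (nu k + lam) * z k \<omega>" if "k < d" for k
      proof -
        have "gcoord k (obs \<omega>) / (nu k + lam) - wcoord k (obs \<omega>) = ((nu k * w k \<omega> + z k \<omega>) - (nu k + lam) * w k \<omega>) / (nu k + lam)"
          using \<open>\<omega> \<in> space M\<close> that pos[OF that] by (simp add: gcoord_obs wcoord_obs diff_divide_distrib)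
        also have "(nu k * w k \<omega> + z k \<omega>) - (nu k + lam) * w k \<omega> = - lam * w k \<omega> + z k \<omega>" by (simp add: algebra_simps)
        finally show ?thesis by (simp add: add_divide_distrib diff_divide_distrib)
      qed
      thus ?thesis using kl by (simp add: f_def)
    qed
    show "integrable M (f k l)" by (rule moment_cong(1)[OF eq kl])
    show "expectation (f k l) = (if k = l then (lam\<^sup>2 / lam_star + nu k) / (nu k + lam)\<^sup>2 else 0)"
      by (rule trans[OF moment_cong(2)[OF eq kl]], cases "k = l") (simp_all add: power2_eq_square add_divide_distrib)
  qed
  have "risk M A \<Gamma> C0 u y lam = expectation (\<lambda>\<omega>. \<Sum>k<d. \<Sum>l<d. gram k l * f k l \<omega>)"
    unfolding risk_def f_def
    using loss_eq_coords[OF lam, of "obs _"] u_carrier measurable_space[OF y_measurable]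
    by (intro Bochner_Integration.integral_cong refl) simp
  also have "\<dots> = (\<Sum>k<d. expectation (\<lambda>\<omega>. \<Sum>l<d. gram k l * f k l \<omega>))"
    using f(1) by (intro Bochner_Integration.integral_sum Bochner_Integration.integrable_sum integrable_mult_right) auto
  also have "\<dots> = (\<Sum>k<d. \<Sum>l<d. expectation (\<lambda>\<omega>. gram k l * f k l \<omega>))"
    using f(1) by (intro sum.cong refl Bochner_Integration.integral_sum integrable_mult_right) auto
  also have "\<dots> = (\<Sum>k<d. \<Sum>l<d. if k = l then gram k k * ((lam\<^sup>2 / lam_star + nu k) / (nu k + lam)\<^sup>2) else 0)"
    using f(2) by (intro sum.cong refl) simp
  also have "\<dots> = (\<Sum>k<d. gram k k * ((lam\<^sup>2 / lam_star + nu k) / (nu k + lam)\<^sup>2))" by simp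
  finally show ?thesis .
qed

text \<open>Each summand is stationary at \<open>lam_star\<close> by itself, whatever
  \<open>nu k\<close> is, because there \<open>lam\<^sup>2 / lam_star + nu k\<close> coincides with
  \<open>nu k + lam\<close>.\<close>

lemma risk_stationary: "(risk M A \<Gamma> C0 u y has_real_derivative 0) (at lam_star)"
proof -
  have "((\<lambda>lam. \<Sum>k<d. gram k k * ((lam\<^sup>2 / lam_star + nu k) / (nu k + lam)\<^sup>2)) has_real_derivative
      (\<Sum>k<d. gram k k * 0)) (at lam_star)"
  proof (intro DERIV_sum DERIV_cmult)
    fix k assume "k \<in> {..<d}"
    hence pos: "nu k + lam_star > 0" using nu_nonneg[of k] lam_star by simp
    have "((\<lambda>lam. (lam\<^sup>2 / lam_star + nu k) / (nu k + lam)\<^sup>2) has_real_derivative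
        ((2 * lam_star / lam_star) * (nu k + lam_star)\<^sup>2 - (lam_star\<^sup>2 / lam_star + nu k) * (2 * (nu k + lam_star)))
          / ((nu k + lam_star)\<^sup>2 * (nu k + lam_star)\<^sup>2)) (at lam_star)"
      using pos lam_star by (auto intro!: derivative_eq_intros)
    also have "(2 * lam_star / lam_star) * (nu k + lam_star)\<^sup>2 - (lam_star\<^sup>2 / lam_star + nu k) * (2 * (nu k + lam_star)) = 0"
      using lam_star by (simp add: power2_eq_square algebra_simps)
    finally show "((\<lambda>lam. (lam\<^sup>2 / lam_star + nu k) / (nu k + lam)\<^sup>2) has_real_derivative 0) (at lam_star)" by simp
  qed
  hence "((\<lambda>lam. \<Sum>k<d. gram k k * ((lam\<^sup>2 / lam_star + nu k) / (nu k + lam)\<^sup>2)) has_real_derivative 0) (at lam_star)" by simp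
  thus ?thesis
    \<comment> \<open>The closed form of the risk is available for positive parameters only, so the
      derivative is transferred on the open half-line.\<close>
    by (rule has_field_derivative_transform_within_open[where S = "{0<..}"]) (use lam_star risk_eq in auto)
qed

end

section \<open>Sub-exponential bounds for the series coefficients\<close>

context diagonalized_model
begin

text \<open>From \<open>s * nu k / lu = 1 - s\<close> follows \<open>\<alpha> = - s\<close> for
  \<open>j = 0\<close> and \<open>0 \<le> \<alpha> \<le> 1\<close> otherwise, while
  \<open>nu k * \<beta>\<^sup>2 \<le> (1 - s) * s / lu\<close>. The variance bound is thus free of
  \<open>nu\<close>, \<open>j\<close> and the dimension.\<close>

lemma coeff_obs:
  assumes "lu > 0" "k < d"
  obtains \<alpha> \<beta> where "\<And>\<omega>. \<omega> \<in> space M \<Longrightarrow> coeff lu j k (obs \<omega>) = \<alpha> * w k \<omega> + \<beta> * z k \<omega>"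
    "\<alpha>\<^sup>2 / lam_star + nu k * \<beta>\<^sup>2 \<le> 1 / lam_star + 1 / lu"
proof -
  define s where "s = shrink lu k"
  have s: "0 \<le> s" "s \<le> 1" using shrink_bounds[OF assms] by (auto simp: s_def)
  have nu: "nu k \<ge> 0" using nu_nonneg assms by simp
  have "s * nu k / lu = nu k / (nu k + lu)" using assms by (simp add: s_def shrink_def)
  also have "\<dots> = 1 - s" using nu assms by (simp add: s_def shrink_def field_simps)
  finally have snu1: "s * nu k / lu = 1 - s" .
  hence snu: "0 \<le> s * nu k / lu" "s * nu k / lu \<le> 1" using s by auto
  define \<alpha> where "\<alpha> = s ^ (j + 1) * (nu k / lu) - (if j = 0 then 1 else 0)"
  define \<beta> where "\<beta> = s ^ (j + 1) / lu"
  have "\<bar>\<alpha>\<bar> \<le> 1"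
  proof (cases "j = 0")
    case True
    thus ?thesis using snu1 s by (simp add: \<alpha>_def)
  next
    case False
    have "\<alpha> = s ^ j * (s * nu k / lu)" using False by (simp add: \<alpha>_def)
    moreover have "s ^ j * (s * nu k / lu) \<le> 1 * 1" using s snu by (intro mult_mono power_le_one) auto
    moreover have "s ^ j * (s * nu k / lu) \<ge> 0" using s snu by (intro mult_nonneg_nonneg) auto
    ultimately show ?thesis by simp
  qed
  hence "\<alpha>\<^sup>2 \<le> 1" by (simp add: abs_square_le_1)
  hence a: "\<alpha>\<^sup>2 / lam_star \<le> 1 / lam_star" using lam_star by (intro divide_right_mono) auto
  have "s ^ (j + 1) \<le> s" using s power_decreasing[of 1 "j + 1" s] by simp
  hence "\<beta>\<^sup>2 \<le> (s / lu)\<^sup>2" unfolding \<beta>_def using assms s by (intro power_mono divide_right_mono) auto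
  hence "nu k * \<beta>\<^sup>2 \<le> nu k * (s / lu)\<^sup>2" using nu by (intro mult_left_mono)
  also have "\<dots> = (s * nu k / lu) * (s / lu)" by (simp add: power2_eq_square)
  also have "\<dots> \<le> 1 * (1 / lu)" using s snu assms by (intro mult_mono divide_right_mono) auto
  finally have b: "nu k * \<beta>\<^sup>2 \<le> 1 / lu" by simp
  show ?thesis
  proof (rule that[of \<alpha> \<beta>])
    fix \<omega> assume "\<omega> \<in> space M"
    thus "coeff lu j k (obs \<omega>) = \<alpha> * w k \<omega> + \<beta> * z k \<omega>"
      using assms unfolding coeff_def \<alpha>_def \<beta>_def s_def[symmetric]
      by (simp add: gcoord_obs wcoord_obs field_simps)
  qed (use a b in simp)
qed

text \<open>\<open>L j m\<close> is component \<open>m\<close> of \<open>V\<close> applied to the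
  coefficients of index \<open>j\<close>, so the form is an inner product, at most half the sum of
  two squared norms. The variance proxies add up to
  \<open>2 * Csig\<^sup>2 * (1 / lam_star + 1 / lu)\<close> times the trace of \<open>C0\<close>;
  the factor \<open>8 * exp 1\<close> for squares then makes the 16.\<close>

lemma bform_sub_exponential:
  assumes lu: "lu > 0" and \<theta>: "\<theta> \<ge> 0" "16 * exp 1 * Csig\<^sup>2 * (1 / lam_star + 1 / lu) * mat_trace C0 * \<theta> \<le> 1"
  shows "(\<integral>\<^sup>+\<omega>. ennreal (exp (\<theta> * \<bar>bform lu i j (obs \<omega>)\<bar>)) \<partial>M) \<le> 2"
proof -
  define L where "L j m \<omega> = (\<Sum>k<d. V $$ (m,k) * coeff lu j k (obs \<omega>))" for j m \<omega>
  define \<kappa> where "\<kappa> m = 2 * Csig\<^sup>2 * (1 / lam_star + 1 / lu) * (\<Sum>k<d. (V $$ (m,k))\<^sup>2)" for m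
  have pos: "1 / lam_star + 1 / lu > 0" using lam_star lu by (intro add_pos_pos) auto
  have obs: "obs \<in> measurable M (borel_vec d \<Otimes>\<^sub>M borel_vec K)"
    by (intro measurable_Pair u_measurable y_measurable)
  have coeff: "(\<lambda>\<omega>. coeff lu j k (obs \<omega>)) \<in> borel_measurable M" if "k < d" for j k
    unfolding coeff_def using measurable_compose[OF obs measurable_coords(1)[OF that]] measurable_compose[OF obs measurable_coords(2)[OF that]]
    by simp
  have L: "L j m \<in> borel_measurable M" for j m
    unfolding L_def[abs_def] by (intro borel_measurable_sum borel_measurable_times coeff) auto
  have sq: "(\<integral>\<^sup>+\<omega>. ennreal (exp (\<theta> * (\<Sum>m<d. (L j m \<omega>)\<^sup>2))) \<partial>M) \<le> 2" for j
  proof (rule nn_integral_exp_sum_squares_le[OF L _ _ \<theta>(1)])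
    show "\<kappa> m > 0" if "m < d" for m using row_pos[OF that] pos Csig by (simp add: \<kappa>_def)
    have \<kappa>_sum: "(\<Sum>m<d. \<kappa> m) = 2 * Csig\<^sup>2 * (1 / lam_star + 1 / lu) * mat_trace C0"
      by (simp add: \<kappa>_def sum_row_eq_trace flip: sum_distrib_left)
    show "8 * exp 1 * (\<Sum>m<d. \<kappa> m) * \<theta> \<le> 1"
      using \<theta>(2) unfolding \<kappa>_sum by (simp add: algebra_simps)
    fix m s
    have "\<forall>k. \<exists>\<alpha> \<beta>. k < d \<longrightarrow> (\<forall>\<omega>\<in>space M. coeff lu j k (obs \<omega>) = \<alpha> * w k \<omega> + \<beta> * z k \<omega>) \<and>
        \<alpha>\<^sup>2 / lam_star + nu k * \<beta>\<^sup>2 \<le> 1 / lam_star + 1 / lu"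
      using coeff_obs[OF lu, of _ j] by metis
    then obtain \<alpha> \<beta> where ab: "\<And>k \<omega>. k < d \<Longrightarrow> \<omega> \<in> space M \<Longrightarrow> coeff lu j k (obs \<omega>) = \<alpha> k * w k \<omega> + \<beta> k * z k \<omega>"
      "\<And>k. k < d \<Longrightarrow> (\<alpha> k)\<^sup>2 / lam_star + nu k * (\<beta> k)\<^sup>2 \<le> 1 / lam_star + 1 / lu" by metis
    have "(\<integral>\<^sup>+\<omega>. ennreal (exp (s * L j m \<omega>)) \<partial>M)
      = (\<integral>\<^sup>+\<omega>. ennreal (exp (\<Sum>k<d. (s * V $$ (m,k) * \<alpha> k) * w k \<omega> + (s * V $$ (m,k) * \<beta> k) * z k \<omega>)) \<partial>M)"
      unfolding L_def sum_distrib_left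
      by (intro nn_integral_cong arg_cong[of _ _ "\<lambda>x. ennreal (exp x)"] sum.cong refl) (simp add: ab(1) algebra_simps)
    also have "\<dots> \<le> ennreal (exp (2 * Csig\<^sup>2 * (\<Sum>k<d. (s * V $$ (m,k) * \<alpha> k)\<^sup>2 / lam_star + nu k * (s * V $$ (m,k) * \<beta> k)\<^sup>2)))"
      by (rule linear_form_mgf)
    also have "\<dots> \<le> ennreal (exp (\<kappa> m * s\<^sup>2))"
    proof -
      have "(\<Sum>k<d. (s * V $$ (m,k) * \<alpha> k)\<^sup>2 / lam_star + nu k * (s * V $$ (m,k) * \<beta> k)\<^sup>2)
        = (\<Sum>k<d. (s * V $$ (m,k))\<^sup>2 * ((\<alpha> k)\<^sup>2 / lam_star + nu k * (\<beta> k)\<^sup>2))"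
        by (intro sum.cong refl) (simp add: power_mult_distrib algebra_simps)
      also have "\<dots> \<le> (\<Sum>k<d. (s * V $$ (m,k))\<^sup>2 * (1 / lam_star + 1 / lu))"
        using ab(2) by (intro sum_mono mult_left_mono) auto
      also have "\<dots> = s\<^sup>2 * (1 / lam_star + 1 / lu) * (\<Sum>k<d. (V $$ (m,k))\<^sup>2)"
        by (simp add: power_mult_distrib sum_distrib_left mult_ac)
      finally have "2 * Csig\<^sup>2 * (\<Sum>k<d. (s * V $$ (m,k) * \<alpha> k)\<^sup>2 / lam_star + nu k * (s * V $$ (m,k) * \<beta> k)\<^sup>2)
        \<le> 2 * Csig\<^sup>2 * (s\<^sup>2 * (1 / lam_star + 1 / lu) * (\<Sum>k<d. (V $$ (m,k))\<^sup>2))" by (rule mult_left_mono) simp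
      thus ?thesis by (intro ennreal_leI) (simp add: \<kappa>_def mult_ac)
    qed
    finally show "(\<integral>\<^sup>+\<omega>. ennreal (exp (s * L j m \<omega>)) \<partial>M) \<le> ennreal (exp (\<kappa> m * s\<^sup>2))" .
  qed
  show ?thesis
  proof (rule nn_integral_exp_bilinear_le[OF _ _ sq[of "Suc i"] sq[of j] \<theta>(1)])
    fix \<omega>
    have "bform lu i j (obs \<omega>) = (\<Sum>m<d. L (Suc i) m \<omega> * L j m \<omega>)"
      unfolding bform_def sum_gram L_def ..
    also have "\<bar>\<dots>\<bar> \<le> (\<Sum>m<d. \<bar>L (Suc i) m \<omega> * L j m \<omega>\<bar>)" by (rule sum_abs)
    also have "\<dots> \<le> (\<Sum>m<d. ((L (Suc i) m \<omega>)\<^sup>2 + (L j m \<omega>)\<^sup>2) / 2)"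
    proof (intro sum_mono)
      fix m
      have "0 \<le> (\<bar>L (Suc i) m \<omega>\<bar> - \<bar>L j m \<omega>\<bar>)\<^sup>2" by simp
      thus "\<bar>L (Suc i) m \<omega> * L j m \<omega>\<bar> \<le> ((L (Suc i) m \<omega>)\<^sup>2 + (L j m \<omega>)\<^sup>2) / 2"
        by (simp add: power2_diff abs_mult)
    qed
    also have "\<dots> = ((\<Sum>m<d. (L (Suc i) m \<omega>)\<^sup>2) + (\<Sum>m<d. (L j m \<omega>)\<^sup>2)) / 2"
      by (simp add: sum.distrib flip: sum_divide_distrib)
    finally show "\<bar>bform lu i j (obs \<omega>)\<bar> \<le> ((\<Sum>m<d. (L (Suc i) m \<omega>)\<^sup>2) + (\<Sum>m<d. (L j m \<omega>)\<^sup>2)) / 2" .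
  qed (intro borel_measurable_sum borel_measurable_power L)+
qed

end

section \<open>Empirical and population gradients\<close>

text \<open>Used with powers of \<open>shrink\<close>, where \<open>c\<close> indicates
  \<open>j = 0\<close>, and with \<open>rgain\<close>, where \<open>c = 1\<close>.\<close>

lemma mean_bilinear_sum:
  fixes f g :: "nat \<Rightarrow> nat \<Rightarrow> nat \<Rightarrow> real" and G :: "nat \<Rightarrow> nat \<Rightarrow> real" and n d :: nat
  shows "(\<Sum>m=1..n. \<Sum>k<d. \<Sum>l<d. G k l * (R k * (T l * f k l m - c * g k l m))) / n
    = (\<Sum>k<d. \<Sum>l<d. G k l * (R k * (T l * ((\<Sum>m=1..n. f k l m) / n) - c * ((\<Sum>m=1..n. g k l m) / n))))"
proof -
  let ?h = "\<lambda>k l m. G k l * (R k * (T l * (f k l m / n) - c * (g k l m / n)))"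
  have "(\<Sum>m=1..n. \<Sum>k<d. \<Sum>l<d. G k l * (R k * (T l * f k l m - c * g k l m))) / n = (\<Sum>m=1..n. \<Sum>k<d. \<Sum>l<d. ?h k l m)"
    unfolding sum_divide_distrib
    by (intro sum.cong refl) (simp only: times_divide_eq_right[symmetric] diff_divide_distrib)
  also have "\<dots> = (\<Sum>k<d. \<Sum>m=1..n. \<Sum>l<d. ?h k l m)" by (rule sum.swap)
  also have "\<dots> = (\<Sum>k<d. \<Sum>l<d. \<Sum>m=1..n. ?h k l m)" by (intro sum.cong refl sum.swap)
  finally show ?thesis by (simp only: sum_subtractf sum_divide_distrib sum_distrib_left[symmetric])
qed

context diagonalized_model
begin

definition rgain :: "real \<Rightarrow> real \<Rightarrow> nat \<Rightarrow> real" where "rgain lu lam k = lu / (nu k + lam)"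

lemma shrink_resolvent:
  assumes "lu > 0" "lam > 0" "k < d"
  shows "shrink lu k / (1 - (lu - lam) / lu * shrink lu k) = rgain lu lam k"
proof -
  have p: "nu k + lu > 0" "nu k + lam > 0" using nu_nonneg[OF assms(3)] assms by auto
  have "1 - (lu - lam) / lu * shrink lu k = 1 - (lu - lam) / (nu k + lu)"
    using assms by (simp add: shrink_def)
  also have "\<dots> = ((nu k + lu) - (lu - lam)) / (nu k + lu)" using p by (simp only: diff_divide_distrib) simp
  finally have "1 - (lu - lam) / lu * shrink lu k = (nu k + lam) / (nu k + lu)" by simp
  thus ?thesis using p assms by (simp add: shrink_def rgain_def)
qed

text \<open>Fermat's criterion, with the derivative of the averaged loss written in scaled
  resolvents and freed of the factor \<open>- 2 / lu\<close>.\<close>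

lemma empirical_stationarity:
  assumes lam: "lam > 0" and lu: "lu > 0" and n: "n \<ge> 1"
    and carr: "\<And>m. m \<in> {1..n} \<Longrightarrow> us m \<omega> \<in> carrier_vec d \<and> ys m \<omega> \<in> carrier_vec K"
    and min: "local_minimum_at (empirical_risk A \<Gamma> C0 n us ys \<omega>) lam"
  shows "(\<Sum>k<d. \<Sum>l<d. gram k l * ((rgain lu lam k)\<^sup>2 *
     (rgain lu lam l * ((\<Sum>m=1..n. gg lu k l (us m \<omega>, ys m \<omega>)) / n) - (\<Sum>m=1..n. gw lu k l (us m \<omega>, ys m \<omega>)) / n))) = 0"
proof -
  define p where "p m = (us m \<omega>, ys m \<omega>)" for m
  define ell where "ell m lam = (\<Sum>k<d. \<Sum>l<d. gram k l *
     ((gcoord k (p m) / (nu k + lam) - wcoord k (p m)) * (gcoord l (p m) / (nu l + lam) - wcoord l (p m))))" for m lam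
  define D where "D m = (\<Sum>k<d. \<Sum>l<d. gram k l * ((rgain lu lam k)\<^sup>2 *
     (rgain lu lam l * gg lu k l (p m) - gw lu k l (p m))))" for m
  have deriv: "(ell m has_real_derivative (- 2 / lu) * D m) (at lam)" for m
  proof -
    have "(-2 * (\<Sum>k<d. \<Sum>l<d. gram k l * (1 / (nu k + lam)\<^sup>2 *
        (1 / (nu l + lam) * (gcoord k (p m) * gcoord l (p m)) - gcoord k (p m) * wcoord l (p m))))) = (- 2 / lu) * D m"
      unfolding D_def sum_distrib_left
    proof (intro sum.cong refl)
      fix k l assume "k \<in> {..<d}" "l \<in> {..<d}"
      hence "nu k + lam > 0" "nu l + lam > 0" using nu_nonneg lam by (simp_all add: add_nonneg_pos)
      thus "- 2 * (gram k l * (1 / (nu k + lam)\<^sup>2 * (1 / (nu l + lam) * (gcoord k (p m) * gcoord l (p m)) - gcoord k (p m) * wcoord l (p m))))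
        = - 2 / lu * (gram k l * ((rgain lu lam k)\<^sup>2 * (rgain lu lam l * gg lu k l (p m) - gw lu k l (p m))))"
        using lu by (simp add: rgain_def gg_def gw_def right_diff_distrib power2_eq_square)
    qed
    thus ?thesis using loss_derivative[OF lam, of "p m"] unfolding ell_def by simp
  qed
  have "((\<lambda>t. 1 / real n * (\<Sum>m=1..n. ell m t)) has_real_derivative 1 / real n * (\<Sum>m=1..n. (- 2 / lu) * D m)) (at lam)"
    by (intro DERIV_cmult DERIV_sum deriv)
  moreover have "1 / real n * (\<Sum>m=1..n. ell m t) = empirical_risk A \<Gamma> C0 n us ys \<omega> t" if "t \<in> {0<..}" for t
    unfolding empirical_risk_def
  proof (intro arg_cong2[where f = "(*)"] sum.cong refl)
    fix m assume "m \<in> {1..n}"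
    thus "ell m t = (vec_norm (tikhonov A \<Gamma> C0 t (ys m \<omega>) - us m \<omega>))\<^sup>2"
      using loss_eq_coords[of t "p m"] that carr unfolding ell_def by (simp add: p_def)
  qed
  ultimately have der: "(empirical_risk A \<Gamma> C0 n us ys \<omega> has_real_derivative 1 / real n * (\<Sum>m=1..n. (- 2 / lu) * D m)) (at lam)"
    using lam by (auto intro: has_field_derivative_transform_within_open[where S = "{0<..}"])
  obtain e where e: "e > 0" "\<forall>t. dist t lam < e \<longrightarrow> empirical_risk A \<Gamma> C0 n us ys \<omega> lam \<le> empirical_risk A \<Gamma> C0 n us ys \<omega> t"
    using min unfolding local_minimum_at_def eventually_nhds_metric by auto
  have "1 / real n * (\<Sum>m=1..n. (- 2 / lu) * D m) = 0"
    by (rule DERIV_local_min[OF der e(1)]) (use e(2) in \<open>auto simp: dist_real_def abs_minus_commute\<close>)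
  hence "1 / real n * ((- 2 / lu) * (\<Sum>m=1..n. D m)) = 0" unfolding sum_distrib_left .
  hence "(\<Sum>m=1..n. D m) = 0" using n lu by simp
  hence "0 = (\<Sum>m=1..n. D m) / n" by simp
  also have "\<dots> = (\<Sum>k<d. \<Sum>l<d. gram k l * ((rgain lu lam k)\<^sup>2 *
     (rgain lu lam l * ((\<Sum>m=1..n. gg lu k l (p m)) / n) - (\<Sum>m=1..n. gw lu k l (p m)) / n)))"
    unfolding D_def using mean_bilinear_sum[where c = 1] by simp
  finally show ?thesis by (simp add: p_def)
qed

text \<open>On the diagonal, \<open>(nu k / lam_star + 1) / (nu k + lam) - 1 / lam_star\<close>
  equals \<open>(1 - lam / lam_star) / (nu k + lam)\<close>. The factor
  \<open>1 - lam / lam_star\<close> is common to all coordinates, so their contributions cannot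
  cancel, and no local Taylor expansion around \<open>lam_star\<close> is involved.\<close>

lemma population_gradient:
  assumes lam: "lam > 0" and lu: "lu > 0"
  shows "(\<Sum>k<d. \<Sum>l<d. gram k l * ((rgain lu lam k)\<^sup>2 *
     (rgain lu lam l * expectation (\<lambda>\<omega>. gg lu k l (obs \<omega>)) - expectation (\<lambda>\<omega>. gw lu k l (obs \<omega>)))))
     = lu * (1 - lam / lam_star) * (\<Sum>k<d. gram k k * nu k / (nu k + lam) ^ 3)"
proof -
  have "(\<Sum>k<d. \<Sum>l<d. gram k l * ((rgain lu lam k)\<^sup>2 *
     (rgain lu lam l * expectation (\<lambda>\<omega>. gg lu k l (obs \<omega>)) - expectation (\<lambda>\<omega>. gw lu k l (obs \<omega>)))))
    = (\<Sum>k<d. \<Sum>l<d. if k = l then gram k k * ((rgain lu lam k)\<^sup>2 *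
     (rgain lu lam k * (((nu k)\<^sup>2 / lam_star + nu k) / lu\<^sup>2) - nu k / lam_star / lu)) else 0)"
    by (intro sum.cong refl) (simp add: gg_moment(2) gw_moment(2))
  also have "\<dots> = (\<Sum>k<d. gram k k * ((rgain lu lam k)\<^sup>2 *
     (rgain lu lam k * (((nu k)\<^sup>2 / lam_star + nu k) / lu\<^sup>2) - nu k / lam_star / lu)))" by simp
  also have "\<dots> = (\<Sum>k<d. lu * (1 - lam / lam_star) * (gram k k * nu k / (nu k + lam) ^ 3))"
  proof (intro sum.cong refl)
    fix k assume "k \<in> {..<d}"
    hence p: "nu k + lam > 0" using nu_nonneg[of k] lam by (simp add: add_nonneg_pos)
    define c where "c = nu k + lam"
    have nu_c: "nu k = c - lam" by (simp add: c_def)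
    have "rgain lu lam k * (((nu k)\<^sup>2 / lam_star + nu k) / lu\<^sup>2) - nu k / lam_star / lu
       = nu k / lu * ((nu k / lam_star + 1) / (nu k + lam) - 1 / lam_star)"
      using lu p lam_star unfolding rgain_def c_def[symmetric] by (simp add: power2_eq_square field_simps)
    also have "(nu k / lam_star + 1) / (nu k + lam) - 1 / lam_star = (1 - lam / lam_star) / (nu k + lam)"
      using lam_star p unfolding c_def[symmetric] nu_c by (simp add: field_simps)
    finally have "(rgain lu lam k)\<^sup>2 * (rgain lu lam k * (((nu k)\<^sup>2 / lam_star + nu k) / lu\<^sup>2) - nu k / lam_star / lu)
      = (rgain lu lam k)\<^sup>2 * (nu k / lu * ((1 - lam / lam_star) / (nu k + lam)))" by simp
    also have "\<dots> = lu * (1 - lam / lam_star) * (nu k / (nu k + lam) ^ 3)"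
      using lu by (simp add: rgain_def power2_eq_square power3_eq_cube mult_ac)
    finally show "gram k k * ((rgain lu lam k)\<^sup>2 * (rgain lu lam k * (((nu k)\<^sup>2 / lam_star + nu k) / lu\<^sup>2) - nu k / lam_star / lu))
      = lu * (1 - lam / lam_star) * (gram k k * nu k / (nu k + lam) ^ 3)" by simp
  qed
  finally show ?thesis unfolding sum_distrib_left[symmetric] .
qed

text \<open>By the eigenvalue bound all denominators are at most the cube of
  \<open>h * \<tau> + lu\<close>, which leaves the trace of \<open>C0 H C0\<close> in the
  numerator.\<close>

lemma population_gradient_lower_bound:
  assumes lam: "0 < lam" "lam < lu" and h: "op_norm H \<le> h" "h \<ge> 0" and tr: "mat_trace C0 \<le> \<tau>"
    and q: "q \<le> mat_trace (C0 * H * C0)"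
  shows "q / (h * \<tau> + lu) ^ 3 \<le> (\<Sum>k<d. gram k k * nu k / (nu k + lam) ^ 3)"
proof -
  have gle: "gram k k \<le> \<tau>" if "k < d" for k
  proof -
    have "gram k k \<le> (\<Sum>k<d. gram k k)" using that by (intro member_le_sum gram_diag_nonneg) auto
    thus ?thesis using tr by (simp add: trace_gram)
  qed
  have nule: "nu k \<le> h * \<tau>" if "k < d" for k
  proof -
    have "nu k \<le> op_norm H * gram k k" by (rule nu_le[OF that])
    also have "\<dots> \<le> h * gram k k" using h gram_diag_nonneg by (intro mult_right_mono)
    also have "\<dots> \<le> h * \<tau>" using h gle[OF that] by (intro mult_left_mono)
    finally show ?thesis .
  qed
  have p: "h * \<tau> + lu > 0" if "k < d" for k using nule[OF that] nu_nonneg[OF that] lam by linarith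
  show ?thesis
  proof (cases "d = 0")
    \<comment> \<open>No index is available to show that the base is positive, but the trace
      vanishes and so \<open>q \<le> 0\<close>.\<close>
    case True
    hence "q \<le> 0" using q by (simp flip: trace_gram_nu)
    moreover have "(h * \<tau> + lu) ^ 3 \<ge> 0"
      using tr h lam True by (simp add: mult_nonneg_nonneg flip: trace_gram)
    ultimately show ?thesis using True by (simp add: divide_nonpos_nonneg)
  next
    case False
    hence P: "(h * \<tau> + lu) ^ 3 > 0" using p[of 0] by simp
    have "q / (h * \<tau> + lu) ^ 3 \<le> (\<Sum>k<d. gram k k * nu k) / (h * \<tau> + lu) ^ 3"
      using q P by (intro divide_right_mono) (auto simp: trace_gram_nu)
    also have "\<dots> \<le> (\<Sum>k<d. gram k k * nu k / (nu k + lam) ^ 3)"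
      unfolding sum_divide_distrib
    proof (intro sum_mono divide_left_mono power_mono)
      fix k assume "k \<in> {..<d}"
      hence k: "k < d" by simp
      show "nu k + lam \<le> h * \<tau> + lu" using nule[OF k] lam by simp
      show "0 \<le> nu k + lam" using nu_nonneg[OF k] lam by simp
      show "0 \<le> gram k k * nu k" using nu_nonneg[OF k] gram_diag_nonneg by simp
      have "nu k + lam > 0" using nu_nonneg[OF k] lam by simp
      thus "0 < (h * \<tau> + lu) ^ 3 * (nu k + lam) ^ 3" using P by simp
    qed
    finally show ?thesis .
  qed
qed

end

section \<open>Concentration of the estimator\<close>

context diagonalized_model
begin

lemma iid_copies_bform:
  assumes iid: "iid_samples M d K n u y us ys"
  shows "iid_copies n (\<lambda>m \<omega>. bform lu i j (us m \<omega>, ys m \<omega>)) (\<lambda>\<omega>. bform lu i j (obs \<omega>))"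
proof -
  let ?N = "borel_vec d \<Otimes>\<^sub>M borel_vec K"
  have ind: "indep_vars (\<lambda>_. ?N) (\<lambda>m \<omega>. (us m \<omega>, ys m \<omega>)) {1..n}"
    and eq: "\<And>m. m \<in> {1..n} \<Longrightarrow> distr M ?N (\<lambda>\<omega>. (us m \<omega>, ys m \<omega>)) = distr M ?N obs"
    using iid by (auto simp: iid_samples_def)
  have obs: "obs \<in> measurable M ?N" by (intro measurable_Pair u_measurable y_measurable)
  have samples: "(\<lambda>\<omega>. (us m \<omega>, ys m \<omega>)) \<in> measurable M ?N" if "m \<in> {1..n}" for m
    using ind that by (auto simp: indep_vars_def)
  have "distr M borel (\<lambda>\<omega>. bform lu i j (us m \<omega>, ys m \<omega>)) = distr M borel (\<lambda>\<omega>. bform lu i j (obs \<omega>))" if m: "m \<in> {1..n}" for m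
    using distr_distr[OF measurable_bform samples[OF m], of lu i j] distr_distr[OF measurable_bform obs, of lu i j] eq[OF m]
    by (simp add: comp_def)
  moreover have "indep_vars (\<lambda>_. borel) (\<lambda>m \<omega>. bform lu i j (us m \<omega>, ys m \<omega>)) {1..n}"
    by (rule indep_vars_compose2[OF ind measurable_bform])
  moreover have "(\<lambda>\<omega>. bform lu i j (obs \<omega>)) \<in> borel_measurable M" by (rule measurable_compose[OF obs measurable_bform])
  ultimately show ?thesis by (simp add: iid_copies_def)
qed

text \<open>All \<open>i\<close> and \<open>j\<close> share the same two matrices of centered
  averages, which is what the series bound requires of \<open>a\<close> and
  \<open>b\<close>.\<close>

lemma mean_bform_deviation:
  fixes n :: nat
  shows "(\<Sum>m=1..n. bform lu i j (P m)) / n - expectation (\<lambda>\<omega>. bform lu i j (obs \<omega>)) = (\<Sum>k<d. \<Sum>l<d. gram k l *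
    (shrink lu k ^ (i + 2) * (shrink lu l ^ (j + 1) * ((\<Sum>m=1..n. gg lu k l (P m)) / n - expectation (\<lambda>\<omega>. gg lu k l (obs \<omega>)))
       - (if j = 0 then (\<Sum>m=1..n. gw lu k l (P m)) / n - expectation (\<lambda>\<omega>. gw lu k l (obs \<omega>)) else 0))))"
proof -
  define c where "c = (if j = 0 then 1 else 0 :: real)"
  have c: "(if j = 0 then x else 0) = c * x" for x by (simp add: c_def)
  have mean: "(\<Sum>m=1..n. bform lu i j (P m)) / n = (\<Sum>k<d. \<Sum>l<d. gram k l *
    (shrink lu k ^ (i + 2) * (shrink lu l ^ (j + 1) * ((\<Sum>m=1..n. gg lu k l (P m)) / n) - c * ((\<Sum>m=1..n. gw lu k l (P m)) / n))))"
    unfolding bform_eq c by (rule mean_bilinear_sum)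
  show ?thesis
    unfolding mean expectation_bform c sum_subtractf[symmetric]
    by (intro sum.cong refl) (simp add: algebra_simps)
qed

text \<open>A deterministic statement about one outcome. As the empirical gradient is zero, its
  deviation from the mean is minus the population gradient: the series bounds it from above, the
  explicit formula from below.\<close>

lemma deviation_at_local_minimum:
  assumes lam: "0 < lam_l" "lam_l < lam" "lam < lu" and n: "n \<ge> 1" and x: "x \<ge> 0"
    and carr: "\<And>m. m \<in> {1..n} \<Longrightarrow> us m \<omega> \<in> carrier_vec d \<and> ys m \<omega> \<in> carrier_vec K"
    and min: "local_minimum_at (empirical_risk A \<Gamma> C0 n us ys \<omega>) lam"
    and dev: "\<And>i j. \<bar>(\<Sum>m=1..n. bform lu i j (us m \<omega>, ys m \<omega>)) / n - expectation (\<lambda>\<omega>. bform lu i j (obs \<omega>))\<bar>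
       \<le> x * (real (Suc i) * real (Suc j))"
    and h: "op_norm H \<le> h" "h \<ge> 0" and tr: "mat_trace C0 \<le> \<tau>" and q: "0 \<le> q" "q \<le> mat_trace (C0 * H * C0)"
  shows "lu * (\<bar>lam - lam_star\<bar> / lam_star) * (q / (h * \<tau> + lu) ^ 3) \<le> x * resolvent_series_const (1 - lam_l / lu)"
proof -
  define P where "P m = (us m \<omega>, ys m \<omega>)" for m
  define a where "a k l = (\<Sum>m=1..n. gg lu k l (P m)) / n - expectation (\<lambda>\<omega>. gg lu k l (obs \<omega>))" for k l
  define b where "b k l = (\<Sum>m=1..n. gw lu k l (P m)) / n - expectation (\<lambda>\<omega>. gw lu k l (obs \<omega>))" for k l
  define t where "t = (lu - lam) / lu"
  define F where "F = (\<Sum>k<d. \<Sum>l<d. gram k l * ((rgain lu lam k)\<^sup>2 *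
     (rgain lu lam l * expectation (\<lambda>\<omega>. gg lu k l (obs \<omega>)) - expectation (\<lambda>\<omega>. gw lu k l (obs \<omega>)))))"
  have pos: "lam > 0" "lu > 0" using lam by auto
  have bound: "\<bar>\<Sum>k<d. \<Sum>l<d. gram k l * ((shrink lu k / (1 - t * shrink lu k))\<^sup>2 *
      (shrink lu l / (1 - t * shrink lu l) * a k l - b k l))\<bar> \<le> x * resolvent_series_const (1 - lam_l / lu)"
  proof (rule resolvent_series_bound[OF shrink_bounds[OF pos(2)] _ _ _ x])
    show "0 \<le> t" "t \<le> 1 - lam_l / lu" "1 - lam_l / lu < 1" using lam pos by (auto simp: t_def field_simps)
    show "\<bar>\<Sum>k<d. \<Sum>l<d. gram k l * (shrink lu k ^ (i + 2) * (shrink lu l ^ (j + 1) * a k l - (if j = 0 then b k l else 0)))\<bar>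
       \<le> x * (real (Suc i) * real (Suc j))" for i j
      using dev[of i j] unfolding mean_bform_deviation[where P = "\<lambda>m. (us m \<omega>, ys m \<omega>)"] a_def b_def P_def .
  qed
  have "(\<Sum>k<d. \<Sum>l<d. gram k l * ((shrink lu k / (1 - t * shrink lu k))\<^sup>2 *
      (shrink lu l / (1 - t * shrink lu l) * a k l - b k l)))
    = (\<Sum>k<d. \<Sum>l<d. gram k l * ((rgain lu lam k)\<^sup>2 * (rgain lu lam l * a k l - b k l)))"
    using shrink_resolvent[OF pos(2,1)] by (intro sum.cong refl) (simp add: t_def)
  also have "\<dots> = (\<Sum>k<d. \<Sum>l<d. gram k l * ((rgain lu lam k)\<^sup>2 *
     (rgain lu lam l * ((\<Sum>m=1..n. gg lu k l (P m)) / n) - (\<Sum>m=1..n. gw lu k l (P m)) / n))) - F"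
    unfolding F_def sum_subtractf[symmetric] a_def b_def by (intro sum.cong refl) (simp add: algebra_simps)
  also have "\<dots> = - F"
    using empirical_stationarity[OF pos n carr min] by (simp add: P_def)
  finally have "\<bar>F\<bar> \<le> x * resolvent_series_const (1 - lam_l / lu)" using bound by simp
  moreover have "\<bar>F\<bar> = lu * \<bar>1 - lam / lam_star\<bar> * \<bar>\<Sum>k<d. gram k k * nu k / (nu k + lam) ^ 3\<bar>"
    unfolding F_def population_gradient[OF pos] using pos by (simp add: abs_mult)
  moreover have "\<bar>1 - lam / lam_star\<bar> = \<bar>lam - lam_star\<bar> / lam_star"
    using lam_star by (simp add: abs_if field_simps)
  moreover have "lu * (\<bar>lam - lam_star\<bar> / lam_star) * (q / (h * \<tau> + lu) ^ 3)
      \<le> lu * (\<bar>lam - lam_star\<bar> / lam_star) * \<bar>\<Sum>k<d. gram k k * nu k / (nu k + lam) ^ 3\<bar>"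
    using population_gradient_lower_bound[OF pos(1) lam(3) h tr q(2)] pos lam_star
    by (intro mult_left_mono mult_nonneg_nonneg) auto
  ultimately show ?thesis by simp
qed

text \<open>\<open>\<theta>\<close> is the largest value that the sub-exponential bound allows when
  \<open>\<tau>\<close> replaces the trace. \<open>c\<close> is chosen such that for deviations of
  size \<open>x = c * \<epsilon>\<close> the upper and the lower bound on the gradient meet exactly
  at distance \<open>\<epsilon>\<close> from \<open>lam_star\<close>.\<close>

lemma local_min_estimator_concentration:
  assumes lam: "0 < lam_l" "lam_l < lam_u" and n: "n \<ge> 1"
    and iid: "iid_samples M d K n u y us ys"
    and est: "local_min_estimator M A \<Gamma> C0 lam_l lam_u n us ys lhat"
    and h: "op_norm H \<le> h" "h \<ge> 0" and tr: "mat_trace C0 \<le> \<tau>" "\<tau> > 0" and q: "0 < q" "q \<le> mat_trace (C0 * H * C0)"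
    and \<epsilon>: "\<epsilon> > 0"
  defines "\<theta> \<equiv> 1 / (16 * exp 1 * Csig\<^sup>2 * (1 / lam_star + 1 / lam_u) * \<tau>)"
    and "c \<equiv> lam_u / lam_star * (q / (h * \<tau> + lam_u) ^ 3) / resolvent_series_const (1 - lam_l / lam_u)"
  shows "prob {\<omega> \<in> space M. \<bar>lhat \<omega> - lam_star\<bar> > \<epsilon> \<and> lam_l < lhat \<omega> \<and> lhat \<omega> < lam_u}
    \<le> 8 * exp (- (min (\<theta>\<^sup>2 * c\<^sup>2 / 32) (\<theta> * c / 4)) * real n * min \<epsilon> (\<epsilon>\<^sup>2))"
proof -
  have lu: "lam_u > 0" using lam by simp
  have R: "resolvent_series_const (1 - lam_l / lam_u) > 0" using lam lu by (intro resolvent_series_const_pos) auto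
  have den: "(h * \<tau> + lam_u) ^ 3 > 0" using h tr lu by (intro zero_less_power add_nonneg_pos) auto
  have c: "c > 0" unfolding c_def using lu lam_star q den R by simp
  define Q where "Q = 16 * exp 1 * Csig\<^sup>2 * (1 / lam_star + 1 / lam_u)"
  have "1 / lam_star + 1 / lam_u > 0" using lam_star lu by (intro add_pos_pos) auto
  hence Q: "Q > 0" using Csig by (simp add: Q_def)
  have \<theta>Q: "\<theta> = 1 / (Q * \<tau>)" by (simp add: \<theta>_def Q_def)
  have \<theta>: "\<theta> > 0" unfolding \<theta>Q using Q tr(2) by simp
  have "Q * mat_trace C0 * \<theta> \<le> Q * \<tau> * \<theta>"
    using Q tr(1) \<theta> by (intro mult_right_mono mult_left_mono) auto
  also have "\<dots> = 1" unfolding \<theta>Q using Q tr(2) by simp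
  finally have \<theta>1: "16 * exp 1 * Csig\<^sup>2 * (1 / lam_star + 1 / lam_u) * mat_trace C0 * \<theta> \<le> 1" by (simp only: Q_def)
  define x where "x = c * \<epsilon>"
  have x: "x > 0" using c \<epsilon> by (simp add: x_def)
  define bad where "bad i j = {\<omega> \<in> space M. \<bar>(\<Sum>m=1..n. bform lam_u i j (us m \<omega>, ys m \<omega>)) / n
      - expectation (\<lambda>\<omega>. bform lam_u i j (obs \<omega>))\<bar> \<ge> x * (real (Suc i) * real (Suc j))}" for i j
  have dev: "bad i j \<in> events" "prob (\<Union>i j. bad i j) \<le> 8 * exp (- (real n * min (\<theta>\<^sup>2 * x\<^sup>2 / 32) (\<theta> * x / 4)))" for i j
    using prob_iid_family_deviation_le[where X = "\<lambda>i j m \<omega>. bform lam_u i j (us m \<omega>, ys m \<omega>)"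
      and Z = "\<lambda>i j \<omega>. bform lam_u i j (obs \<omega>)", OF iid_copies_bform[OF iid, of lam_u] n \<theta>
      bform_sub_exponential[OF lu less_imp_le[OF \<theta>] \<theta>1] x] unfolding bad_def by blast+
  have lhat: "lhat \<in> borel_measurable M" and ae: "AE \<omega> in M. lhat \<omega> \<in> {lam_l<..<lam_u} \<longrightarrow>
        local_minimum_at (empirical_risk A \<Gamma> C0 n us ys \<omega>) (lhat \<omega>)"
    using est by (auto simp: local_min_estimator_def)
  have carr: "us m \<omega> \<in> carrier_vec d \<and> ys m \<omega> \<in> carrier_vec K" if "m \<in> {1..n}" "\<omega> \<in> space M" for m \<omega>
  proof -
    have "(\<lambda>\<omega>. (us m \<omega>, ys m \<omega>)) \<in> measurable M (borel_vec d \<Otimes>\<^sub>M borel_vec K)"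
      using iid that(1) by (auto simp: iid_samples_def indep_vars_def)
    from measurable_space[OF this that(2)] show ?thesis by (simp add: space_pair_measure)
  qed
  have "prob {\<omega> \<in> space M. \<bar>lhat \<omega> - lam_star\<bar> > \<epsilon> \<and> lam_l < lhat \<omega> \<and> lhat \<omega> < lam_u} \<le> prob (\<Union>i j. bad i j)"
  \<comment> \<open>The estimator is a local minimum only almost everywhere, so the inclusion of
    events holds up to a null set.\<close>
  proof (rule finite_measure_mono_AE)
    show "(\<Union>i j. bad i j) \<in> events" using dev(1) by auto
    show "AE \<omega> in M. \<omega> \<in> {\<omega> \<in> space M. \<bar>lhat \<omega> - lam_star\<bar> > \<epsilon> \<and> lam_l < lhat \<omega> \<and> lhat \<omega> < lam_u} \<longrightarrow> \<omega> \<in> (\<Union>i j. bad i j)"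
      using ae
    proof eventually_elim
      case (elim \<omega>)
      show ?case
      proof (intro impI, rule ccontr)
        assume "\<omega> \<in> {\<omega> \<in> space M. \<bar>lhat \<omega> - lam_star\<bar> > \<epsilon> \<and> lam_l < lhat \<omega> \<and> lhat \<omega> < lam_u}"
        hence \<omega>: "\<omega> \<in> space M" "\<bar>lhat \<omega> - lam_star\<bar> > \<epsilon>" "lam_l < lhat \<omega>" "lhat \<omega> < lam_u" by auto
        assume "\<omega> \<notin> (\<Union>i j. bad i j)"
        hence good: "\<bar>(\<Sum>m=1..n. bform lam_u i j (us m \<omega>, ys m \<omega>)) / n - expectation (\<lambda>\<omega>. bform lam_u i j (obs \<omega>))\<bar>
            \<le> x * (real (Suc i) * real (Suc j))" for i j
          using \<omega>(1) by (force simp: bad_def not_le intro: less_imp_le)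
        have min: "local_minimum_at (empirical_risk A \<Gamma> C0 n us ys \<omega>) (lhat \<omega>)" using elim \<omega> by simp
        have "lam_u * (\<epsilon> / lam_star) * (q / (h * \<tau> + lam_u) ^ 3)
            < lam_u * (\<bar>lhat \<omega> - lam_star\<bar> / lam_star) * (q / (h * \<tau> + lam_u) ^ 3)"
          using \<omega>(2) lu lam_star q(1) den by (intro mult_strict_right_mono mult_strict_left_mono divide_strict_right_mono) auto
        also have "\<dots> \<le> x * resolvent_series_const (1 - lam_l / lam_u)"
          by (rule deviation_at_local_minimum[OF lam(1) \<omega>(3,4) n less_imp_le[OF x] carr[OF _ \<omega>(1)] min good h tr(1) less_imp_le[OF q(1)] q(2)])
        also have "\<dots> = lam_u * (\<epsilon> / lam_star) * (q / (h * \<tau> + lam_u) ^ 3)"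
          unfolding x_def c_def using R by simp
        finally show False by simp
      qed
    qed
  qed
  also have "\<dots> \<le> 8 * exp (- (real n * min (\<theta>\<^sup>2 * x\<^sup>2 / 32) (\<theta> * x / 4)))" by (rule dev(2))
  also have "\<dots> \<le> 8 * exp (- (min (\<theta>\<^sup>2 * c\<^sup>2 / 32) (\<theta> * c / 4)) * real n * min \<epsilon> (\<epsilon>\<^sup>2))"
  proof -
    define C where "C = min (\<theta>\<^sup>2 * c\<^sup>2 / 32) (\<theta> * c / 4)"
    have C: "C \<ge> 0" "C \<le> \<theta>\<^sup>2 * c\<^sup>2 / 32" "C \<le> \<theta> * c / 4" using \<theta> c by (auto simp: C_def)
    \<comment> \<open>\<open>min \<epsilon> (\<epsilon>\<^sup>2)\<close> lies below both regimes,
      which merges them into one exponent.\<close>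
    have "C * min \<epsilon> (\<epsilon>\<^sup>2) \<le> \<theta>\<^sup>2 * c\<^sup>2 / 32 * \<epsilon>\<^sup>2"
      by (rule mult_mono[OF C(2)]) (use C(1) \<epsilon> in auto)
    moreover have "C * min \<epsilon> (\<epsilon>\<^sup>2) \<le> \<theta> * c / 4 * \<epsilon>"
      by (rule mult_mono[OF C(3)]) (use C(1) \<epsilon> \<theta> c in auto)
    ultimately have "C * min \<epsilon> (\<epsilon>\<^sup>2) \<le> min (\<theta>\<^sup>2 * x\<^sup>2 / 32) (\<theta> * x / 4)" by (simp add: x_def power_mult_distrib mult_ac)
    hence "real n * (C * min \<epsilon> (\<epsilon>\<^sup>2)) \<le> real n * min (\<theta>\<^sup>2 * x\<^sup>2 / 32) (\<theta> * x / 4)" by (rule mult_left_mono) simp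
    thus ?thesis unfolding C_def[symmetric] by (simp add: mult_ac)
  qed
  finally show ?thesis .
qed

end

section \<open>Uniform constants and the theorem\<close>

lemma diagonalized_model_exists:
  assumes "A \<in> carrier_mat K d" "sym_pos_def K \<Gamma>" "sym_pos_def d C0" "lam_star > 0" "Csig > 0"
    and lm: "linear_model Csig M d K \<Gamma> C0 lam_star u \<xi>"
  obtains V nu where "diagonalized_model d K A \<Gamma> C0 V nu M u \<xi> lam_star Csig"
proof -
  obtain V nu where "diagonalized_problem d K A \<Gamma> C0 V nu" using diagonalized_problem_exists[OF assms(1-3)] by auto
  moreover have "prob_space M" using lm by (simp add: linear_model_def)
  ultimately have "diagonalized_model d K A \<Gamma> C0 V nu M u \<xi> lam_star Csig"
    using assms by (simp add: diagonalized_model_def diagonalized_model_axioms_def)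
  thus ?thesis by (rule that)
qed

text \<open>The constants are obtained before any dimension, matrix or probability space is
  introduced, and the norms enter through inequalities, so one statement serves a fixed
  \<open>C0\<close> as well as prescribed norms.\<close>

lemma uniform_concentration:
  fixes lam_l lam_u lam_star Csig h \<tau> q :: real
  assumes lam: "0 < lam_l" "lam_l < lam_star" "lam_star < lam_u" and "0 < Csig" and h: "h \<ge> 0" and \<tau>: "\<tau> > 0" and q: "q > 0"
  obtains Cst cst where "Cst > 0" "cst > 0"
    "\<And>d K A \<Gamma> C0 (M :: 'w measure) u \<xi> n us ys lhat \<epsilon>.
       A \<in> carrier_mat K d \<Longrightarrow> sym_pos_def K \<Gamma> \<Longrightarrow> sym_pos_def d C0 \<Longrightarrow>
       mat_trace C0 \<le> \<tau> \<Longrightarrow> op_norm (data_hessian A \<Gamma>) \<le> h \<Longrightarrow>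
       q \<le> mat_trace (C0 * data_hessian A \<Gamma> * C0) \<Longrightarrow>
       linear_model Csig M d K \<Gamma> C0 lam_star u \<xi> \<Longrightarrow>
       1 \<le> n \<Longrightarrow> iid_samples M d K n u (observation A u \<xi>) us ys \<Longrightarrow>
       local_min_estimator M A \<Gamma> C0 lam_l lam_u n us ys lhat \<Longrightarrow> 0 < \<epsilon> \<Longrightarrow>
       \<P>(\<omega> in M. \<bar>lhat \<omega> - lam_star\<bar> > \<epsilon> \<and> lam_l < lhat \<omega> \<and> lhat \<omega> < lam_u)
         \<le> Cst * exp (- cst * real n * min \<epsilon> (\<epsilon>\<^sup>2))"
proof -
  define \<theta> where "\<theta> = 1 / (16 * exp 1 * Csig\<^sup>2 * (1 / lam_star + 1 / lam_u) * \<tau>)"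
  define c where "c = lam_u / lam_star * (q / (h * \<tau> + lam_u) ^ 3) / resolvent_series_const (1 - lam_l / lam_u)"
  have "resolvent_series_const (1 - lam_l / lam_u) > 0" using lam by (intro resolvent_series_const_pos) auto
  moreover have "(h * \<tau> + lam_u) ^ 3 > 0" using h \<tau> lam by (intro zero_less_power add_nonneg_pos) auto
  ultimately have c: "c > 0" using lam q by (simp add: c_def)
  have \<theta>: "\<theta> > 0" unfolding \<theta>_def using lam \<tau> assms(4)
    by (intro divide_pos_pos mult_pos_pos add_pos_pos) auto
  show thesis
  proof (rule that[of 8 "min (\<theta>\<^sup>2 * c\<^sup>2 / 32) (\<theta> * c / 4)"], simp, use c \<theta> in simp, goal_cases)
    case (1 d K A \<Gamma> C0 M u \<xi> n us ys lhat \<epsilon>)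
    obtain V nu where "diagonalized_model d K A \<Gamma> C0 V nu M u \<xi> lam_star Csig"
      using diagonalized_model_exists[OF 1(1-3) _ assms(4) 1(7)] lam by auto
    then interpret diagonalized_model d K A \<Gamma> C0 V nu M u \<xi> lam_star Csig .
    show ?case
      unfolding \<theta>_def c_def using lam
      by (intro local_min_estimator_concentration[OF lam(1) _ 1(8-10,5) h 1(4) \<tau> q 1(6,11)]) auto
  qed
qed

text \<open>For \<open>A = 0\<close> the regularized solution is zero for all positive parameters,
  so the empirical risk is constant there and every point of the interval is a local minimum. With
  \<open>C0\<close> and the Hessian norm fixed, \<open>A \<noteq> 0\<close> bounds the trace of
  \<open>C0 H C0\<close> from below. When \<open>C0\<close> varies, the listed norms leave this
  trace arbitrarily small, since \<open>H\<close> may act where \<open>C0\<close> is small; hence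
  the further quantity \<open>q\<close>.\<close>

theorem theorem2p5:
  fixes lam_l lam_u lam_star Csig :: real
  assumes "0 < lam_l" "lam_l < 1 / 2 * lam_star" "3 / 2 * lam_star < lam_u" "0 < Csig"
  shows
    "(\<forall>d K A \<Gamma> C0 (M :: 'w measure) u \<xi>.
        A \<in> carrier_mat K d \<and> sym_pos_def K \<Gamma> \<and> sym_pos_def d C0 \<and>
        linear_model Csig M d K \<Gamma> C0 lam_star u \<xi> \<longrightarrow>
        (risk M A \<Gamma> C0 u (observation A u \<xi>) has_real_derivative 0) (at lam_star))
   \<and> (\<forall>d C0 h. sym_pos_def d C0 \<longrightarrow>
        (\<exists>Cst>0. \<exists>cst>0. \<forall>K A \<Gamma> (M :: 'w measure) u \<xi> n us ys lhat \<epsilon>.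
           A \<in> carrier_mat K d \<and> A \<noteq> 0\<^sub>m K d \<and> sym_pos_def K \<Gamma> \<and>
           op_norm (data_hessian A \<Gamma>) = h \<and>
           linear_model Csig M d K \<Gamma> C0 lam_star u \<xi> \<and>
           1 \<le> n \<and> iid_samples M d K n u (observation A u \<xi>) us ys \<and>
           local_min_estimator M A \<Gamma> C0 lam_l lam_u n us ys lhat \<and>
           0 < \<epsilon> \<and> \<epsilon> < 1 \<longrightarrow>
           \<P>(\<omega> in M. \<bar>lhat \<omega> - lam_star\<bar> > \<epsilon> \<and> lam_l < lhat \<omega> \<and> lhat \<omega> < lam_u)
             \<le> Cst * exp (- cst * real n * min \<epsilon> (\<epsilon>\<^sup>2))))
   \<and> (\<forall>trC frC h a g q. 0 < q \<longrightarrow>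
        (\<exists>Cst>0. \<exists>cst>0. \<forall>d K A \<Gamma> C0 (M :: 'w measure) u \<xi> n us ys lhat \<epsilon>.
           A \<in> carrier_mat K d \<and> sym_pos_def K \<Gamma> \<and> sym_pos_def d C0 \<and>
           mat_trace C0 = trC \<and> frobenius_norm C0 = frC \<and>
           op_norm (data_hessian A \<Gamma>) = h \<and> op_norm A = a \<and> op_norm \<Gamma> = g \<and>
           q \<le> mat_trace (C0 * data_hessian A \<Gamma> * C0) \<and>
           linear_model Csig M d K \<Gamma> C0 lam_star u \<xi> \<and>
           1 \<le> n \<and> iid_samples M d K n u (observation A u \<xi>) us ys \<and>
           local_min_estimator M A \<Gamma> C0 lam_l lam_u n us ys lhat \<and>
           0 < \<epsilon> \<and> \<epsilon> < 1 \<longrightarrow>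
           \<P>(\<omega> in M. \<bar>lhat \<omega> - lam_star\<bar> > \<epsilon> \<and> lam_l < lhat \<omega> \<and> lhat \<omega> < lam_u)
             \<le> Cst * exp (- cst * real n * min \<epsilon> (\<epsilon>\<^sup>2))))"
proof (intro conjI allI impI, goal_cases)
  case (1 d K A \<Gamma> C0 M u \<xi>)
  have "lam_star > 0" using assms by simp
  then obtain V nu where "diagonalized_model d K A \<Gamma> C0 V nu M u \<xi> lam_star Csig"
    using diagonalized_model_exists 1 assms(4) by blast
  thus ?case by (rule diagonalized_model.risk_stationary)
next
  case (2 d C0 h)
  \<comment> \<open>Solves \<open>op_norm_data_hessian_le\<close> for the trace; the added 1 keeps
    the denominator positive also for \<open>d = 0\<close>, when the trace of the inverse is
    zero.\<close>
  define q where "q = h / ((mat_trace (mat_inv C0))\<^sup>2 + 1)"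
  have nonzero: "h > 0 \<and> q \<le> mat_trace (C0 * data_hessian A \<Gamma> * C0)"
    if AG: "A \<in> carrier_mat K d" "A \<noteq> 0\<^sub>m K d" "sym_pos_def K \<Gamma>" "op_norm (data_hessian A \<Gamma>) = h" for K A \<Gamma>
  proof -
    obtain V nu where "diagonalized_problem d K A \<Gamma> C0 V nu"
      using diagonalized_problem_exists[OF AG(1,3) 2] by auto
    then interpret diagonalized_problem d K A \<Gamma> C0 V nu .
    have "h > 0" using data_hessian_op_norm_pos[OF AG(1,3,2)] AG(4) by simp
    have "0 \<le> mat_trace (C0 * H * C0)"
      unfolding trace_gram_nu[symmetric] by (intro sum_nonneg mult_nonneg_nonneg gram_diag_nonneg nu_nonneg) auto
    hence "h \<le> ((mat_trace (mat_inv C0))\<^sup>2 + 1) * mat_trace (C0 * H * C0)"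
      using op_norm_data_hessian_le AG(4) by (simp add: distrib_right)
    hence "q \<le> mat_trace (C0 * H * C0)"
      unfolding q_def by (subst pos_divide_le_eq) (auto simp: mult.commute intro: add_nonneg_pos)
    thus ?thesis using \<open>h > 0\<close> by simp
  qed
  show ?case
  proof (cases "h > 0")
    case True
    hence "q > 0" by (simp add: q_def add_nonneg_pos)
    show ?thesis
    \<comment> \<open>\<open>max\<close> with 1, because \<open>\<tau>\<close> has to be positive
      and the trace is zero for \<open>d = 0\<close>.\<close>
    proof (rule uniform_concentration[where 'w = 'w, of lam_l lam_star lam_u Csig h "max (mat_trace C0) 1" q], goal_cases)
      case (8 Cst cst)
      note conc = this
      show ?case
      proof (rule exI[of _ Cst], rule conjI, rule conc(1), rule exI[of _ cst], rule conjI, rule conc(2),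
          intro allI impI, elim conjE, goal_cases)
        case (1 K A \<Gamma> M u \<xi> n us ys lhat \<epsilon>)
        show ?case
          by (rule conc(3)[OF 1(1,3) 2 _ _ _ 1(5-9)]) (use 1(4) nonzero[OF 1(1-4)] in auto)
      qed
    qed (use assms True \<open>q > 0\<close> in auto)
  next
    \<comment> \<open>No nonzero \<open>A\<close> has such a Hessian norm, so the claim is vacuous
      and any constants do.\<close>
    case False
    hence "\<not> (A \<in> carrier_mat K d \<and> A \<noteq> 0\<^sub>m K d \<and> sym_pos_def K \<Gamma> \<and> op_norm (data_hessian A \<Gamma>) = h)" for K A \<Gamma>
      using nonzero[of A K \<Gamma>] by blast
    thus ?thesis by (intro exI[of _ 1] conjI) auto
  qed
next
  case (3 trC frC h a g q)
  show ?case
  \<comment> \<open>\<open>h\<close> and \<open>trC\<close> are arbitrary reals here; the maxima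
    supply the required signs.\<close>
  proof (rule uniform_concentration[where 'w = 'w, of lam_l lam_star lam_u Csig "max h 0" "max trC 1" q], goal_cases)
    case (8 Cst cst)
    note conc = this
    show ?case
    proof (rule exI[of _ Cst], rule conjI, rule conc(1), rule exI[of _ cst], rule conjI, rule conc(2),
        intro allI impI, elim conjE, goal_cases)
      case (1 d K A \<Gamma> C0 M u \<xi> n us ys lhat \<epsilon>)
      show ?case
        by (rule conc(3)[OF 1(1-3) _ _ 1(9-14)]) (use 1(4,6) in auto)
    qed
  qed (use assms 3 in auto)
qed

end
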